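(* Let $\kappa\in(0,4/\pi)$ and $0<\lambda\le\lambda^{\rm HFB}_\kappa$. If $I^{\rm HFB}_{0,\kappa}(\lambda)$ has a minimizer, then $I^{\rm HFB}_{m,\kappa}(\lambda)$ has no minimizer for every $m>0$.
   Context: $\mathfrak S_1$ and $\mathfrak S_2$ are the spaces of trace-class and Hilbert--Schmidt operators on $L^2(\mathbb R^3;\mathbb C)$. Let $\mathcal X$ be the real Banach space of pairs $(\gamma,\alpha)\in\mathfrak S_1\times\mathfrak S_2$ with $\gamma^*=\gamma$, $\alpha^T=-\alpha$ and finite norm $$\|(\gamma,\alpha)\|_{\mathcal X}=\|(1-\Delta)^{1/4}\gamma(1-\Delta)^{1/4}\|_{\mathfrak S_1}+\|(1-\Delta)^{1/4}\alpha\|_{\mathfrak S_2}.$$ Let $\mathcal K$ be the set of $(\gamma,\alpha)\in\mathcal X$ with $\operatorname{Tr}\gamma<\infty$ and $$0\le\begin{pmatrix}\gamma&\alpha\\ \alpha^*&1-\bar\gamma\end{pmatrix}\le 1\quad\text{on } L^2(\mathbb R^3;\mathbb C)\oplus L^2(\mathbb R^3;\mathbb C),$$ where $\bar\gamma$ is the operator with kernel $\overline{\gamma(x,y)}$. Write $\gamma(x,y),\alpha(x,y)$ for integral kernels, $\rho_\gamma(x)=\gamma(x,x)$, $$D(\rho,\rho)=\iint_{\mathbb R^3\times\mathbb R^3}\frac{\rho(x)\rho(y)}{|x-y|}\,dx\,dy,\qquad X(\gamma)=\iint_{\mathbb R^3\times\mathbb R^3}\frac{|\gamma(x,y)|^2}{|x-y|}\,dx\,dy,$$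 and similarly $X(\alpha)=\iint|\alpha(x,y)|^2|x-y|^{-1}dx\,dy$. For an operator $A\ge0$, $\operatorname{Tr}(A\gamma)$ means $\operatorname{Tr}(A^{1/2}\gamma A^{1/2})$. For $m\ge0$, $\kappa>0$, $\lambda>0$ put $$\mathcal E^{\rm HFB}_{m,\kappa}(\gamma,\alpha)=\operatorname{Tr}\big((\sqrt{-\Delta+m^2}-m)\gamma\big)-\tfrac\kappa2D(\rho_\gamma,\rho_\gamma)+\tfrac\kappa2X(\gamma)-\tfrac\kappa2X(\alpha),$$ $$I^{\rm HFB}_{m,\kappa}(\lambda)=\inf\{\mathcal E^{\rm HFB}_{m,\kappa}(\gamma,\alpha):(\gamma,\alpha)\in\mathcal K,\ \operatorname{Tr}\gamma=\lambda\}.$$ A minimizer of $I^{\rm HFB}_{m,\kappa}(\lambda)$ is an admissible pair attaining this infimum. For $\kappa\in(0,4/\pi)$ it is known that there is a unique number $\lambda^{\rm HFB}_\kappa\in(0,\infty)$ (the critical mass), independent of $m\ge0$, such that $I^{\rm HFB}_{m,\kappa}(\lambda)>-\infty$ if $0<\lambda\le\lambda^{\rm HFB}_\kappa$ and $I^{\rm HFB}_{m,\kappa}(\lambda)=-\infty$ if $\lambda>\lambda^{\rm HFB}_\kappa$. *)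

theory Defs
  imports "HOL-Analysis.Analysis"
begin

section \<open>The Hilbert space of square-integrable complex functions\<close>

definition sq_integrable :: "('a::euclidean_space \<Rightarrow> complex) \<Rightarrow> bool" where
  "sq_integrable f \<longleftrightarrow>
     f \<in> borel_measurable borel \<and> integrable lborel (\<lambda>x. (cmod (f x))\<^sup>2)"

lemma sq_integrable_measurable [measurable_dest]:
  "sq_integrable f \<Longrightarrow> f \<in> borel_measurable borel"
  by (simp add: sq_integrable_def)

lemma sq_integrable_zero: "sq_integrable (\<lambda>_. 0)"
  by (simp add: sq_integrable_def)

lemma sq_integrable_add:
  assumes "sq_integrable f" "sq_integrable g"
  shows "sq_integrable (\<lambda>x. f x + g x)"
proof -
  have [measurable]: "f \<in> borel_measurable borel" "g \<in> borel_measurable borel"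
    using assms by (auto simp: sq_integrable_def)
  have int: "integrable lborel (\<lambda>x. 2 * (cmod (f x))\<^sup>2 + 2 * (cmod (g x))\<^sup>2)"
    using assms by (auto simp: sq_integrable_def)
  have bound: "(cmod (a + b))\<^sup>2 \<le> 2 * (cmod a)\<^sup>2 + 2 * (cmod b)\<^sup>2" for a b
  proof -
    have "(cmod (a + b))\<^sup>2 \<le> (cmod a + cmod b)\<^sup>2"
      by (intro power_mono norm_triangle_ineq) auto
    also have "\<dots> \<le> 2 * (cmod a)\<^sup>2 + 2 * (cmod b)\<^sup>2"
      using sum_squares_bound[of "cmod a" "cmod b"] by (simp add: power2_sum)
    finally show ?thesis .
  qed
  have "integrable lborel (\<lambda>x. (cmod (f x + g x))\<^sup>2)"
  proof (rule Bochner_Integration.integrable_bound[OF int])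
    show "AE x in lborel. norm ((cmod (f x + g x))\<^sup>2) \<le>
        norm (2 * (cmod (f x))\<^sup>2 + 2 * (cmod (g x))\<^sup>2)"
      using bound by (intro AE_I2) simp
  qed measurable
  then show ?thesis by (simp add: sq_integrable_def)
qed

lemma sq_integrable_scale:
  assumes "sq_integrable f"
  shows "sq_integrable (\<lambda>x. c * f x)"
  using assms by (auto simp: sq_integrable_def norm_mult power_mult_distrib)

lemma sq_integrable_cnj:
  assumes "sq_integrable f"
  shows "sq_integrable (\<lambda>x. cnj (f x))"
proof -
  have "cnj \<in> borel_measurable borel"
    by (rule borel_measurable_continuous_onI) (rule continuous_on_cnj[OF continuous_on_id])
  then have "(\<lambda>x. cnj (f x)) \<in> borel_measurable borel"
    using assms by (intro measurable_compose[of f borel borel cnj]) (auto simp: sq_integrable_def)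
  then show ?thesis
    using assms by (simp add: sq_integrable_def)
qed

lemma integrable_cnj_mult:
  assumes "sq_integrable f" "sq_integrable g"
  shows "integrable lborel (\<lambda>x. cnj (f x) * g x)"
proof -
  have [measurable]: "(\<lambda>x. cnj (f x)) \<in> borel_measurable borel" "g \<in> borel_measurable borel"
    using assms sq_integrable_cnj[of f] by (auto simp: sq_integrable_def)
  have int: "integrable lborel (\<lambda>x. (cmod (f x))\<^sup>2 + (cmod (g x))\<^sup>2)"
    using assms by (auto simp: sq_integrable_def)
  have bound: "cmod a * cmod b \<le> (cmod a)\<^sup>2 + (cmod b)\<^sup>2" for a b
  proof -
    have "0 \<le> cmod a * cmod b" by simp
    then show ?thesis
      using sum_squares_bound[of "cmod a" "cmod b"] unfolding mult.assoc by linarith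
  qed
  show ?thesis
  proof (rule Bochner_Integration.integrable_bound[OF int])
    show "AE x in lborel. norm (cnj (f x) * g x) \<le> norm ((cmod (f x))\<^sup>2 + (cmod (g x))\<^sup>2)"
      using bound by (intro AE_I2) (simp add: norm_mult)
  qed measurable
qed

quotient_type (overloaded) 'a L2 = "'a::euclidean_space \<Rightarrow> complex" /
  partial: "\<lambda>f g. sq_integrable f \<and> sq_integrable g \<and> (AE x in lborel. f x = g x)"
proof (rule part_equivpI)
  show "\<exists>f::'a \<Rightarrow> complex. sq_integrable f \<and> sq_integrable f \<and> (AE x in lborel. f x = f x)"
    using sq_integrable_zero by auto
  show "symp (\<lambda>f g::'a \<Rightarrow> complex.
      sq_integrable f \<and> sq_integrable g \<and> (AE x in lborel. f x = g x))"
    by (intro sympI) (auto elim: eventually_mono)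
  show "transp (\<lambda>f g::'a \<Rightarrow> complex.
      sq_integrable f \<and> sq_integrable g \<and> (AE x in lborel. f x = g x))"
    by (intro transpI) (auto elim: eventually_elim2)
qed

lift_definition cinner :: "'a::euclidean_space L2 \<Rightarrow> 'a L2 \<Rightarrow> complex" is
  "\<lambda>f g. \<integral>x. cnj (f x) * g x \<partial>lborel"
proof -
  fix f f' g g' :: "'a \<Rightarrow> complex"
  assume f: "sq_integrable f \<and> sq_integrable f' \<and> (AE x in lborel. f x = f' x)"
    and g: "sq_integrable g \<and> sq_integrable g' \<and> (AE x in lborel. g x = g' x)"
  have "AE x in lborel. cnj (f x) * g x = cnj (f' x) * g' x"
    using f g by (auto elim: eventually_elim2)
  moreover have "(\<lambda>x. cnj (f x) * g x) \<in> borel_measurable lborel"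
      "(\<lambda>x. cnj (f' x) * g' x) \<in> borel_measurable lborel"
    using borel_measurable_integrable[OF integrable_cnj_mult[of f g]]
      borel_measurable_integrable[OF integrable_cnj_mult[of f' g']] f g by simp_all
  ultimately show "(\<integral>x. cnj (f x) * g x \<partial>lborel) = (\<integral>x. cnj (f' x) * g' x \<partial>lborel)"
    by (intro integral_cong_AE)
qed

lift_definition cscale :: "complex \<Rightarrow> 'a::euclidean_space L2 \<Rightarrow> 'a L2" is
  "\<lambda>c f x. c * f x"
  using sq_integrable_scale by (auto elim: eventually_mono)

lift_definition cnj_L2 :: "'a::euclidean_space L2 \<Rightarrow> 'a L2" is "\<lambda>f x. cnj (f x)"
  using sq_integrable_cnj by (auto elim: eventually_mono)

instantiation L2 :: (euclidean_space) real_inner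
begin

lift_definition zero_L2 :: "'a L2" is "\<lambda>_. 0"
  using sq_integrable_zero by auto

lift_definition plus_L2 :: "'a L2 \<Rightarrow> 'a L2 \<Rightarrow> 'a L2" is "\<lambda>f g x. f x + g x"
  using sq_integrable_add by (auto elim: eventually_elim2)

definition uminus_L2 :: "'a L2 \<Rightarrow> 'a L2" where "uminus_L2 f = cscale (-1) f"

definition minus_L2 :: "'a L2 \<Rightarrow> 'a L2 \<Rightarrow> 'a L2" where "minus_L2 f g = f + (- g)"

definition scaleR_L2 :: "real \<Rightarrow> 'a L2 \<Rightarrow> 'a L2" where
  "scaleR_L2 r f = cscale (complex_of_real r) f"

definition inner_L2 :: "'a L2 \<Rightarrow> 'a L2 \<Rightarrow> real" where "inner_L2 f g = Re (cinner f g)"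

definition norm_L2 :: "'a L2 \<Rightarrow> real" where "norm_L2 f = sqrt (inner f f)"

definition sgn_L2 :: "'a L2 \<Rightarrow> 'a L2" where "sgn_L2 f = inverse (norm f) *\<^sub>R f"

definition dist_L2 :: "'a L2 \<Rightarrow> 'a L2 \<Rightarrow> real" where "dist_L2 f g = norm (f - g)"

definition uniformity_L2 :: "('a L2 \<times> 'a L2) filter" where
  "uniformity_L2 = (INF e\<in>{0 <..}. principal {(f, g). dist f g < e})"

definition open_L2 :: "'a L2 set \<Rightarrow> bool" where
  "open_L2 U \<longleftrightarrow> (\<forall>f\<in>U. eventually (\<lambda>(f', g). f' = f \<longrightarrow> g \<in> U) uniformity)"

instance
proof
  fix f g h :: "'a L2" and r s :: real
  show "f + g + h = f + (g + h)"
    by transfer (auto simp: add.assoc intro!: sq_integrable_add)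
  show "f + g = g + f"
    by transfer (auto simp: add.commute intro!: sq_integrable_add)
  show "0 + f = f"
    by transfer auto
  show "- f + f = 0"
    unfolding uminus_L2_def
    by transfer (simp add: sq_integrable_zero)
  show "f - g = f + - g"
    by (fact minus_L2_def)
  show "r *\<^sub>R (f + g) = r *\<^sub>R f + r *\<^sub>R g"
    unfolding scaleR_L2_def
    by transfer (auto simp: distrib_left intro!: sq_integrable_add sq_integrable_scale)
  show "(r + s) *\<^sub>R f = r *\<^sub>R f + s *\<^sub>R f"
    unfolding scaleR_L2_def
    by transfer (auto simp: distrib_right intro!: sq_integrable_add sq_integrable_scale)
  show "r *\<^sub>R s *\<^sub>R f = (r * s) *\<^sub>R f"
    unfolding scaleR_L2_def
    by transfer (auto simp: mult.assoc intro!: sq_integrable_scale)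
  show "1 *\<^sub>R f = f"
    unfolding scaleR_L2_def by transfer auto
  show "dist f g = norm (f - g)"
    by (fact dist_L2_def)
  show "sgn f = inverse (norm f) *\<^sub>R f"
    by (fact sgn_L2_def)
  show "(uniformity :: ('a L2 \<times> 'a L2) filter) =
      (INF e\<in>{0 <..}. principal {(f, g). dist f g < e})"
    by (fact uniformity_L2_def)
  show "open U \<longleftrightarrow> (\<forall>f\<in>U. \<forall>\<^sub>F (f', g) in uniformity. f' = f \<longrightarrow> g \<in> U)" for U :: "'a L2 set"
    by (fact open_L2_def)
  show "norm f = sqrt (f \<bullet> f)"
    by (fact norm_L2_def)
  show "f \<bullet> g = g \<bullet> f"
    unfolding inner_L2_def
  proof transfer
    fix f g :: "'a \<Rightarrow> complex"
    have "(\<integral>x. cnj (g x) * f x \<partial>lborel) = cnj (\<integral>x. cnj (f x) * g x \<partial>lborel)"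
      by (subst Bochner_Integration.integral_cnj[symmetric]) (simp add: mult.commute)
    then show "Re (\<integral>x. cnj (f x) * g x \<partial>lborel) = Re (\<integral>x. cnj (g x) * f x \<partial>lborel)"
      by simp
  qed
  show "(f + g) \<bullet> h = f \<bullet> h + g \<bullet> h"
    unfolding inner_L2_def
  proof transfer
    fix f g h :: "'a \<Rightarrow> complex"
    assume "sq_integrable f \<and> sq_integrable f \<and> (AE x in lborel. f x = f x)"
      "sq_integrable g \<and> sq_integrable g \<and> (AE x in lborel. g x = g x)"
      "sq_integrable h \<and> sq_integrable h \<and> (AE x in lborel. h x = h x)"
    then show "Re (\<integral>x. cnj (f x + g x) * h x \<partial>lborel) =
        Re (\<integral>x. cnj (f x) * h x \<partial>lborel) + Re (\<integral>x. cnj (g x) * h x \<partial>lborel)"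
      by (simp add: ring_distribs integrable_cnj_mult)
  qed
  show "(r *\<^sub>R f) \<bullet> g = r * (f \<bullet> g)"
    unfolding inner_L2_def scaleR_L2_def
    by transfer (simp add: mult.assoc)
  have self: "Re (\<integral>x. cnj (f x) * f x \<partial>lborel) = (\<integral>x. (cmod (f x))\<^sup>2 \<partial>lborel)"
    for f :: "'a \<Rightarrow> complex"
  proof -
    have "(\<lambda>x. cnj (f x) * f x) = (\<lambda>x. complex_of_real ((cmod (f x))\<^sup>2))"
      by (simp add: fun_eq_iff complex_norm_square mult.commute del: of_real_power)
    then show ?thesis by (simp del: of_real_power)
  qed
  show "0 \<le> f \<bullet> f"
    unfolding inner_L2_def by transfer (simp add: self)
  show "f \<bullet> f = 0 \<longleftrightarrow> f = 0"
    unfolding inner_L2_def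
  proof transfer
    fix f :: "'a \<Rightarrow> complex"
    assume "sq_integrable f \<and> sq_integrable f \<and> (AE x in lborel. f x = f x)"
    then have f: "sq_integrable f" by simp
    then have "integrable lborel (\<lambda>x. (cmod (f x))\<^sup>2)"
      by (simp add: sq_integrable_def)
    then have "(\<integral>x. (cmod (f x))\<^sup>2 \<partial>lborel) = 0 \<longleftrightarrow> (AE x in lborel. (cmod (f x))\<^sup>2 = 0)"
      by (intro integral_nonneg_eq_0_iff_AE) auto
    then show "Re (\<integral>x. cnj (f x) * f x \<partial>lborel) = 0 \<longleftrightarrow>
        sq_integrable f \<and> sq_integrable (\<lambda>_::'a. 0) \<and> (AE x in lborel. f x = 0)"
      using f by (simp add: self sq_integrable_zero)
  qed
qed

end


section \<open>Bounded, trace-class and Hilbert--Schmidt operators\<close>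

definition bounded_op :: "('a::euclidean_space L2 \<Rightarrow> 'a L2) \<Rightarrow> bool" where
  "bounded_op T \<longleftrightarrow> bounded_linear T \<and> (\<forall>c f. T (cscale c f) = cscale c (T f))"

definition onb :: "(nat \<Rightarrow> 'a::euclidean_space L2) \<Rightarrow> bool" where
  "onb e \<longleftrightarrow> (\<forall>j k. cinner (e j) (e k) = (if j = k then 1 else 0)) \<and>
     (\<forall>f. (\<forall>k. cinner (e k) f = 0) \<longrightarrow> f = 0)"

definition hilbert_schmidt :: "('a::euclidean_space L2 \<Rightarrow> 'a L2) \<Rightarrow> bool" where
  "hilbert_schmidt T \<longleftrightarrow>
     bounded_op T \<and> (\<exists>e. onb e \<and> summable (\<lambda>k. (norm (T (e k)))\<^sup>2))"

text \<open>On a Hilbert space, trace-class and nuclear operators coincide; the trace norm is the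
  infimum of the sums \<open>\<Sum>k. norm (f k) * norm (g k)\<close> over all representations below.\<close>

definition nuclear_rep ::
  "('a::euclidean_space L2 \<Rightarrow> 'a L2) \<Rightarrow> (nat \<Rightarrow> 'a L2) \<Rightarrow> (nat \<Rightarrow> 'a L2) \<Rightarrow> bool" where
  "nuclear_rep T f g \<longleftrightarrow> summable (\<lambda>k. norm (f k) * norm (g k)) \<and>
     (\<forall>h. (\<lambda>k. cscale (cinner (g k) h) (f k)) sums T h)"

definition trace_class :: "('a::euclidean_space L2 \<Rightarrow> 'a L2) \<Rightarrow> bool" where
  "trace_class T \<longleftrightarrow> bounded_op T \<and> (\<exists>f g. nuclear_rep T f g)"

definition op_trace :: "('a::euclidean_space L2 \<Rightarrow> 'a L2) \<Rightarrow> complex" where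
  "op_trace T = (THE t. \<forall>e. onb e \<longrightarrow> (\<lambda>k. cinner (e k) (T (e k))) sums t)"

text \<open>If \<open>T\<close> has kernel \<open>K (x, y)\<close>, then \<open>conj_op T\<close> has kernel \<open>cnj (K (x, y))\<close> and
  \<open>transpose_op T\<close> has kernel \<open>K (y, x)\<close>. For complex-linear operators the library's
  \<^const>\<open>adjoint\<close>, taken with respect to the real inner product, is the usual
  Hilbert-space adjoint.\<close>

definition conj_op :: "('a::euclidean_space L2 \<Rightarrow> 'a L2) \<Rightarrow> 'a L2 \<Rightarrow> 'a L2" where
  "conj_op T f = cnj_L2 (T (cnj_L2 f))"

definition transpose_op :: "('a::euclidean_space L2 \<Rightarrow> 'a L2) \<Rightarrow> 'a L2 \<Rightarrow> 'a L2" where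
  "transpose_op T = adjoint (conj_op T)"

definition int_kernel ::
  "('a::euclidean_space L2 \<Rightarrow> 'a L2) \<Rightarrow> ('a \<times> 'a) L2" where
  "int_kernel T = (THE K. \<forall>f. AE x in lborel.
     rep_L2 (T f) x = (\<integral>y. rep_L2 K (x, y) * rep_L2 f y \<partial>lborel))"

text \<open>The diagonal is a null set, so \<open>\<gamma>(x,x)\<close> is read off from an expansion
  \<open>\<gamma>(x,y) = (\<Sum>k. f k x * cnj (g k y))\<close>; for trace-class \<open>\<gamma>\<close> the resulting
  function is independent of the expansion up to a null set, and real a.e. when
  \<open>\<gamma>\<close> is self-adjoint.\<close>

definition density :: "('a::euclidean_space L2 \<Rightarrow> 'a L2) \<Rightarrow> 'a \<Rightarrow> real" where
  "density T = (SOME \<rho>. \<rho> \<in> borel_measurable borel \<and>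
     (\<exists>f g. nuclear_rep T f g \<and>
       (AE x in lborel.
         (\<lambda>k. rep_L2 (f k) x * cnj (rep_L2 (g k) x)) sums complex_of_real (\<rho> x))))"


section \<open>Functions of the momentum operator\<close>

text \<open>The bounded extension from \<open>L\<^sup>1 \<inter> L\<^sup>2\<close> to \<open>L\<^sup>2\<close>, with the unitary normalisation.\<close>

definition fourier :: "'a::euclidean_space L2 \<Rightarrow> 'a L2" where
  "fourier = (THE F. bounded_op F \<and>
     (\<forall>f. integrable lborel (rep_L2 f) \<longrightarrow>
       (AE p in lborel. rep_L2 (F f) p =
          complex_of_real ((2 * pi) powr (- real DIM('a) / 2)) *
          (\<integral>x. cis (- (p \<bullet> x)) * rep_L2 f x \<partial>lborel))))"

text \<open>\<open>multiplier a f g\<close>: \<open>f\<close> lies in the domain of the self-adjoint operator \<open>a(-i\<nabla>)\<close>,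
  with value \<open>g\<close>. In particular \<open>-\<Delta>\<close> corresponds to \<open>a p = (norm p)\<^sup>2\<close>.\<close>

definition multiplier ::
  "('a::euclidean_space \<Rightarrow> real) \<Rightarrow> 'a L2 \<Rightarrow> 'a L2 \<Rightarrow> bool" where
  "multiplier a f g \<longleftrightarrow>
     (AE p in lborel. rep_L2 (fourier g) p = complex_of_real (a p) * rep_L2 (fourier f) p)"

text \<open>With \<open>A = a(-i\<nabla>)\<close>: \<open>T\<close> is everywhere defined and equal to \<open>A \<circ> \<alpha>\<close>, respectively it is
  the bounded extension of \<open>A \<circ> \<gamma> \<circ> A\<close> from the (dense) domain of \<open>A\<close>.\<close>

definition left_mult ::
  "('a::euclidean_space \<Rightarrow> real) \<Rightarrow> ('a L2 \<Rightarrow> 'a L2) \<Rightarrow> ('a L2 \<Rightarrow> 'a L2) \<Rightarrow> bool" where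
  "left_mult a \<alpha> T \<longleftrightarrow> (\<forall>f. multiplier a (\<alpha> f) (T f))"

definition sandwich ::
  "('a::euclidean_space \<Rightarrow> real) \<Rightarrow> ('a L2 \<Rightarrow> 'a L2) \<Rightarrow> ('a L2 \<Rightarrow> 'a L2) \<Rightarrow> bool" where
  "sandwich a \<gamma> T \<longleftrightarrow>
     bounded_op T \<and> (\<forall>f g. multiplier a f g \<longrightarrow> multiplier a (\<gamma> g) (T f))"

text \<open>\<open>Tr(A\<gamma>) = Tr(A\<^sup>1\<^sup>/\<^sup>2 \<gamma> A\<^sup>1\<^sup>/\<^sup>2)\<close> for \<open>A = a(-i\<nabla>) \<ge> 0\<close>.\<close>

definition trace_mult ::
  "('a::euclidean_space \<Rightarrow> real) \<Rightarrow> ('a L2 \<Rightarrow> 'a L2) \<Rightarrow> real" where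
  "trace_mult a \<gamma> = Re (op_trace (THE T. sandwich (\<lambda>p. sqrt (a p)) \<gamma> T))"


section \<open>The Hartree--Fock--Bogoliubov variational problem\<close>

type_synonym op3 = "(real^3) L2 \<Rightarrow> (real^3) L2"

definition bessel :: "real^3 \<Rightarrow> real" where
  "bessel p = (1 + (norm p)\<^sup>2) powr (1/4)"

definition X_space :: "(op3 \<times> op3) set" where
  "X_space = {(\<gamma>, \<alpha>). trace_class \<gamma> \<and> hilbert_schmidt \<alpha> \<and>
     adjoint \<gamma> = \<gamma> \<and> transpose_op \<alpha> = (\<lambda>f. - \<alpha> f) \<and>
     (\<exists>T. sandwich bessel \<gamma> T \<and> trace_class T) \<and>
     (\<exists>T. left_mult bessel \<alpha> T \<and> hilbert_schmidt T)}"

definition hfb_matrix ::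
  "op3 \<Rightarrow> op3 \<Rightarrow> (real^3) L2 \<times> (real^3) L2 \<Rightarrow> (real^3) L2 \<times> (real^3) L2" where
  "hfb_matrix \<gamma> \<alpha> = (\<lambda>(f, g). (\<gamma> f + \<alpha> g, adjoint \<alpha> f + (g - conj_op \<gamma> g)))"

text \<open>The matrix is self-adjoint on \<^term>\<open>X_space\<close>, so its quadratic form is real and is
  given by the real inner product. The condition \<open>Tr \<gamma> < \<infinity>\<close> is part of \<^const>\<open>trace_class\<close>.\<close>

definition K_set :: "(op3 \<times> op3) set" where
  "K_set = {(\<gamma>, \<alpha>). (\<gamma>, \<alpha>) \<in> X_space \<and>
     (\<forall>\<phi>. 0 \<le> \<phi> \<bullet> hfb_matrix \<gamma> \<alpha> \<phi> \<and> \<phi> \<bullet> hfb_matrix \<gamma> \<alpha> \<phi> \<le> \<phi> \<bullet> \<phi>)}"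

definition direct_energy :: "(real^3 \<Rightarrow> real) \<Rightarrow> real" where
  "direct_energy \<rho> = (\<integral>(x, y). \<rho> x * \<rho> y / norm (x - y) \<partial>lborel)"

definition exchange_energy :: "op3 \<Rightarrow> real" where
  "exchange_energy T =
     (\<integral>(x, y). (cmod (rep_L2 (int_kernel T) (x, y)))\<^sup>2 / norm (x - y) \<partial>lborel)"

text \<open>By the Hardy--Kato inequality, all the terms are finite on \<^term>\<open>K_set\<close>.\<close>

definition E_HFB :: "real \<Rightarrow> real \<Rightarrow> op3 \<Rightarrow> op3 \<Rightarrow> real" where
  "E_HFB m \<kappa> \<gamma> \<alpha> =
     trace_mult (\<lambda>p. sqrt ((norm p)\<^sup>2 + m\<^sup>2) - m) \<gamma>
     - \<kappa> / 2 * direct_energy (density \<gamma>)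
     + \<kappa> / 2 * exchange_energy \<gamma> - \<kappa> / 2 * exchange_energy \<alpha>"

definition admissible :: "real \<Rightarrow> (op3 \<times> op3) set" where
  "admissible l = {(\<gamma>, \<alpha>). (\<gamma>, \<alpha>) \<in> K_set \<and> op_trace \<gamma> = complex_of_real l}"

definition I_HFB :: "real \<Rightarrow> real \<Rightarrow> real \<Rightarrow> ereal" where
  "I_HFB m \<kappa> l = (INF (\<gamma>, \<alpha>)\<in>admissible l. ereal (E_HFB m \<kappa> \<gamma> \<alpha>))"

definition minimizer :: "real \<Rightarrow> real \<Rightarrow> real \<Rightarrow> op3 \<Rightarrow> op3 \<Rightarrow> bool" where
  "minimizer m \<kappa> l \<gamma> \<alpha> \<longleftrightarrow>
     (\<gamma>, \<alpha>) \<in> admissible l \<and> ereal (E_HFB m \<kappa> \<gamma> \<alpha>) = I_HFB m \<kappa> l"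

text \<open>Well defined for \<open>0 < \<kappa> < 4/\<pi>\<close>; one number serves all masses \<open>m \<ge> 0\<close>.\<close>

definition critical_mass :: "real \<Rightarrow> real" where
  "critical_mass \<kappa> = (THE c. 0 < c \<and>
     (\<forall>m\<ge>0. (\<forall>l. 0 < l \<and> l \<le> c \<longrightarrow> I_HFB m \<kappa> l > -\<infinity>) \<and>
             (\<forall>l>c. I_HFB m \<kappa> l = -\<infinity>)))"

end

theory Submission
  imports Defs "HOL-Probability.Characteristic_Functions"
begin

text \<open>Under the unitary dilations \<open>f \<mapsto> s\<^sup>3\<^sup>/\<^sup>2 f(s \<cdot>)\<close> of \<open>L\<^sup>2(\<real>\<^sup>3)\<close> the massless kinetic energy, the direct
  energy and both exchange energies are multiplied by \<open>s\<close>, while admissibility and the trace are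
  preserved. So a minimizer of the massless problem has energy \<open>0\<close>: otherwise a larger or a smaller
  \<open>s\<close> would lower it (\<open>massless_minimizer_energy\<close>). Let \<open>\<sigma> \<ge> 0\<close> be the momentum density of its
  one-particle density matrix, so that \<open>\<integral>\<sigma> = l\<close>. The dilated minimizer has the massive energy
  \<open>\<integral>(sqrt (s\<^sup>2p\<^sup>2 + m\<^sup>2) - m - s\<bar>p\<bar>) \<sigma>(p) dp\<close>, which tends to \<open>-m l\<close> as \<open>s \<rightarrow> \<infinity>\<close>; the
  massive infimum is therefore at most \<open>-m l\<close> (\<open>massive_energy_le\<close>). It is not attained: every
  admissible pair has nonnegative massless energy, and \<open>sqrt (p\<^sup>2 + m\<^sup>2) > \<bar>p\<bar>\<close> puts its massive energy
  strictly above \<open>-m l\<close> (\<open>massive_energy_gt\<close>).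

  The scaling laws presuppose that the Fourier transform, the kernel of an operator, the density and
  the trace, which are introduced by description or choice, are actually determined by their
  defining properties. This is what most of the development is about. The Fourier transform is shown
  to be a contraction by inserting a Gaussian, and to be unitary by Plancherel's identity for
  indicators of boxes (\<open>ifourier_fourier\<close>). Traces and densities are computed from nuclear
  representations by Parseval's identity (\<open>nuclear_trace_sums\<close>, \<open>pair_density_unique\<close>). Kernels are
  handled in the weak form \<open>\<langle>g, T f\<rangle> = \<langle>g \<otimes> cnj f, K\<rangle>\<close> (\<open>weak_kernel_iff\<close>). The kinetic energy is
  expressed by the momentum density in \<open>momentum_density\<close>, and everything meets in
  \<open>dilation_profile_exists\<close>.\<close>

section \<open>The space of square-integrable functions\<close>

lemma sq_integrable_rep [simp]: "sq_integrable (rep_L2 f)"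
  using Quotient3_rep_reflp[OF Quotient3_L2] by blast

lemma measurable_rep_L2 [measurable]: "rep_L2 f \<in> borel_measurable borel"
  using sq_integrable_rep[of f] by (simp add: sq_integrable_def)

lemma abs_rep_L2 [simp]: "abs_L2 (rep_L2 f) = f"
  by (rule Quotient3_abs_rep[OF Quotient3_L2])

lemma rep_abs_L2: "sq_integrable f \<Longrightarrow> AE x in lborel. rep_L2 (abs_L2 f) x = f x"
  using Quotient3_rep_abs[OF Quotient3_L2, of f] by auto

lemma abs_L2_cong:
  assumes "sq_integrable f" "sq_integrable g" "AE x in lborel. f x = g x"
  shows "abs_L2 f = abs_L2 g"
  using Quotient3_rel_abs[OF Quotient3_L2, of f g] assms by auto

lemma L2_eqI: "AE x in lborel. rep_L2 f x = rep_L2 g x \<Longrightarrow> f = g"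
  using abs_L2_cong[of "rep_L2 f" "rep_L2 g"] by simp

lemma L2_eq_absI:
  assumes "sq_integrable g" "AE x in lborel. rep_L2 f x = g x" shows "f = abs_L2 g"
  using abs_L2_cong[of "rep_L2 f" g] assms by simp

lemma rep_zero: "AE x in lborel. rep_L2 0 x = 0"
  unfolding zero_L2_def by (rule rep_abs_L2[OF sq_integrable_zero])

lemma rep_plus: "AE x in lborel. rep_L2 (f + g) x = rep_L2 f x + rep_L2 g x"
proof -
  have "f + g = abs_L2 (\<lambda>x. rep_L2 f x + rep_L2 g x)"
    using plus_L2.abs_eq[of "rep_L2 f" "rep_L2 g"] by (simp add: eq_onp_def)
  then show ?thesis using rep_abs_L2[OF sq_integrable_add[OF sq_integrable_rep sq_integrable_rep]]
    by metis
qed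

lemma rep_cscale: "AE x in lborel. rep_L2 (cscale c f) x = c * rep_L2 f x"
proof -
  have "cscale c f = abs_L2 (\<lambda>x. c * rep_L2 f x)"
    using cscale.abs_eq[of "rep_L2 f" c] by simp
  then show ?thesis using rep_abs_L2[OF sq_integrable_scale[OF sq_integrable_rep]] by metis
qed

lemma rep_uminus: "AE x in lborel. rep_L2 (- f) x = - rep_L2 f x"
  unfolding uminus_L2_def using rep_cscale[of "-1" f] by simp

lemma rep_minus: "AE x in lborel. rep_L2 (f - g) x = rep_L2 f x - rep_L2 g x"
  unfolding minus_L2_def using rep_plus[of f "- g"] rep_uminus[of g] by eventually_elim simp

lemma rep_cnj: "AE x in lborel. rep_L2 (cnj_L2 f) x = cnj (rep_L2 f x)"
proof -
  have "cnj_L2 f = abs_L2 (\<lambda>x. cnj (rep_L2 f x))"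
    using cnj_L2.abs_eq[of "rep_L2 f"] by simp
  then show ?thesis using rep_abs_L2[OF sq_integrable_cnj[OF sq_integrable_rep]] by metis
qed

lemma cinner_rep: "cinner f g = (\<integral>x. cnj (rep_L2 f x) * rep_L2 g x \<partial>lborel)"
  using cinner.abs_eq[of "rep_L2 f" "rep_L2 g"] by simp

lemma integrable_rep_mult: "integrable lborel (\<lambda>x. cnj (rep_L2 f x) * rep_L2 g x)"
  by (rule integrable_cnj_mult) auto

lemma integrable_rep_square: "integrable lborel (\<lambda>x. (cmod (rep_L2 f x))\<^sup>2)"
  using sq_integrable_rep[of f] by (simp only: sq_integrable_def)

lemma borel_measurable_cnj [measurable (raw)]:
  "f \<in> borel_measurable M \<Longrightarrow> (\<lambda>x. cnj (f x)) \<in> borel_measurable M"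
  by (rule borel_measurable_continuous_on[of cnj]) (auto intro!: continuous_intros)

lemma cinner_abs:
  assumes "sq_integrable f" "sq_integrable g"
  shows "cinner (abs_L2 f) (abs_L2 g) = (\<integral>x. cnj (f x) * g x \<partial>lborel)"
  using cinner.abs_eq[of f g] assms by simp

lemma cinner_self: "cinner f f = complex_of_real ((norm f)\<^sup>2)"
  and norm_sq_L2: "(norm f)\<^sup>2 = (\<integral>x. (cmod (rep_L2 f x))\<^sup>2 \<partial>lborel)"
proof -
  have "cnj z * z = complex_of_real ((cmod z)\<^sup>2)" for z
    by (simp add: complex_norm_square mult.commute del: of_real_power)
  then have *: "cinner f f = complex_of_real (\<integral>x. (cmod (rep_L2 f x))\<^sup>2 \<partial>lborel)"
    unfolding cinner_rep by (simp del: of_real_power)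
  then show "(norm f)\<^sup>2 = (\<integral>x. (cmod (rep_L2 f x))\<^sup>2 \<partial>lborel)"
    unfolding power2_norm_eq_inner inner_L2_def by simp
  with * show "cinner f f = complex_of_real ((norm f)\<^sup>2)" by (simp del: of_real_power)
qed

lemma norm_eq_of_cinner: "cinner f f = complex_of_real (r\<^sup>2) \<Longrightarrow> 0 \<le> r \<Longrightarrow> norm f = r"
  by (simp add: cinner_self power2_eq_iff_nonneg del: of_real_power)

lemma norm_sq_abs: "sq_integrable f \<Longrightarrow> (norm (abs_L2 f))\<^sup>2 = (\<integral>x. (cmod (f x))\<^sup>2 \<partial>lborel)"
  unfolding norm_sq_L2
  by (rule integral_cong_AE) (use rep_abs_L2[of f] in \<open>auto simp: sq_integrable_def elim: eventually_mono\<close>)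

lemma nn_integral_norm_sq:
  "(\<integral>\<^sup>+x. ennreal ((cmod (rep_L2 f x))\<^sup>2) \<partial>lborel) = ennreal ((norm f)\<^sup>2)"
  unfolding norm_sq_L2 by (rule nn_integral_eq_integral[OF integrable_rep_square]) simp

lemma cinner_commute: "cinner f g = cnj (cinner g f)"
proof -
  have "cnj (cinner g f) = (\<integral>x. cnj (cnj (rep_L2 g x) * rep_L2 f x) \<partial>lborel)"
    unfolding cinner_rep by (rule Bochner_Integration.integral_cnj[symmetric])
  then show ?thesis by (simp add: cinner_rep mult.commute)
qed

lemma cinner_add_right: "cinner f (g + h) = cinner f g + cinner f h"
proof -
  have "cinner f (g + h) = (\<integral>x. cnj (rep_L2 f x) * rep_L2 g x + cnj (rep_L2 f x) * rep_L2 h x \<partial>lborel)"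
    unfolding cinner_rep
    by (rule integral_cong_AE) (use rep_plus[of g h] in \<open>auto simp: ring_distribs elim: eventually_mono\<close>)
  then show ?thesis by (simp add: cinner_rep integrable_rep_mult)
qed

lemma cinner_cscale_right: "cinner f (cscale c g) = c * cinner f g"
proof -
  have "cinner f (cscale c g) = (\<integral>x. c * (cnj (rep_L2 f x) * rep_L2 g x) \<partial>lborel)"
    unfolding cinner_rep
    by (rule integral_cong_AE) (use rep_cscale[of c g] in \<open>auto elim: eventually_mono\<close>)
  then show ?thesis by (simp add: cinner_rep)
qed

lemma cinner_add_left: "cinner (f + g) h = cinner f h + cinner g h"
  by (subst (1 2 3) cinner_commute) (simp add: cinner_add_right)

lemma cinner_cscale_left: "cinner (cscale c f) g = cnj c * cinner f g"
  by (subst (1 2) cinner_commute) (simp add: cinner_cscale_right)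

lemma cinner_zero [simp]: "cinner f 0 = 0" "cinner 0 f = 0"
  using cinner_add_right[of f 0 0] cinner_add_left[of 0 0 f] by auto

lemma cinner_minus_right [simp]: "cinner f (- g) = - cinner f g"
  unfolding uminus_L2_def by (simp add: cinner_cscale_right)

lemma cinner_minus_left [simp]: "cinner (- f) g = - cinner f g"
  unfolding uminus_L2_def by (simp add: cinner_cscale_left)

lemma cinner_diff_right: "cinner f (g - h) = cinner f g - cinner f h"
  using cinner_add_right[of f g "- h"] by simp

lemma cinner_sum_left: "cinner (\<Sum>k\<in>A. g k) f = (\<Sum>k\<in>A. cinner (g k) f)"
  by (induction A rule: infinite_finite_induct) (auto simp: cinner_add_left)

lemma cscale_simps [simp]:
  fixes f :: "'a::euclidean_space L2"
  shows "cscale 1 f = f" "cscale 0 f = 0" "cscale c (0 :: 'a L2) = 0"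
  "cscale c (cscale d f) = cscale (c * d) f" "cscale c (- f) = - cscale c f"
proof -
  show "cscale 1 f = f" by (rule L2_eqI) (use rep_cscale[of 1 f] in simp)
  show "cscale 0 f = 0"
    by (rule L2_eqI) (use rep_cscale[of 0 f] rep_zero in \<open>eventually_elim, simp\<close>)
  show "cscale c (0::'a L2) = 0"
    by (rule L2_eqI)
      (use rep_cscale[of c "0::'a L2"] rep_zero[where 'a='a] in \<open>eventually_elim, simp\<close>)
  have *: "cscale c (cscale d f) = cscale (c * d) f" for c d and f :: "'a L2"
    by (rule L2_eqI) (use rep_cscale[of c "cscale d f"] rep_cscale[of d f] rep_cscale[of "c*d" f]
      in \<open>eventually_elim, simp\<close>)
  then show "cscale c (cscale d f) = cscale (c * d) f" .
  show "cscale c (- f) = - cscale c f" unfolding uminus_L2_def * by simp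
qed

lemma cscale_add_right: "cscale c (f + g) = cscale c f + cscale c g"
  by (rule L2_eqI)
    (use rep_cscale[of c "f + g"] rep_cscale[of c f] rep_cscale[of c g] rep_plus[of f g]
      rep_plus[of "cscale c f" "cscale c g"] in \<open>eventually_elim, simp add: ring_distribs\<close>)

lemma scaleR_cscale: "r *\<^sub>R f = cscale (of_real r) f"
  by (simp add: scaleR_L2_def)

lemma norm_cscale: "norm (cscale c f) = cmod c * norm (f :: 'a::euclidean_space L2)"
  by (rule norm_eq_of_cinner, unfold cinner_cscale_left cinner_cscale_right)
    (use complex_norm_square[of c] in \<open>simp_all add: cinner_self power_mult_distrib mult_ac\<close>)

text \<open>Rotating \<open>g\<close> by a phase turns the complex pairing into its real part, where the
  Cauchy--Schwarz inequality of the real inner product applies.\<close>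

lemma cinner_Cauchy_Schwarz: "cmod (cinner f g) \<le> norm f * norm g"
proof (cases "cinner f g = 0")
  case False
  define c where "c = cnj (cinner f g) / cmod (cinner f g)"
  have c: "cmod c = 1" using False by (simp add: c_def norm_divide)
  have "c * cinner f g = complex_of_real (cmod (cinner f g))"
    using False complex_norm_square[of "cinner f g"]
    by (simp add: c_def field_simps power2_eq_square)
  then have "cmod (cinner f g) = f \<bullet> cscale c g"
    unfolding inner_L2_def cinner_cscale_right by simp
  also have "\<dots> \<le> norm f * norm (cscale c g)" by (rule norm_cauchy_schwarz)
  finally show ?thesis by (simp add: norm_cscale c)
qed simp

lemma cinner_eq_zero_iff: "cinner f f = 0 \<longleftrightarrow> f = 0"
  by (simp add: cinner_self)

lemma cinner_ext: "(\<And>h. cinner h f = cinner h g) \<Longrightarrow> f = g"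
  using cinner_eq_zero_iff[of "f - g"] by (simp add: cinner_diff_right)

lemma bounded_linear_cinner_right: "bounded_linear (cinner f)"
proof
  show "cinner f (r *\<^sub>R g) = r *\<^sub>R cinner f g" for r g
    by (simp add: scaleR_cscale cinner_cscale_right scaleR_conv_of_real)
  show "\<exists>K. \<forall>g. norm (cinner f g) \<le> norm g * K"
    using cinner_Cauchy_Schwarz[of f] by (metis mult.commute)
qed (rule cinner_add_right)

lemma bounded_linear_cinner_left: "bounded_linear (\<lambda>g. cinner g f)"
proof
  show "cinner (r *\<^sub>R g) f = r *\<^sub>R cinner g f" for r g
    by (simp add: scaleR_cscale cinner_cscale_left scaleR_conv_of_real)
  show "\<exists>K. \<forall>g. norm (cinner g f) \<le> norm g * K"
    using cinner_Cauchy_Schwarz[of _ f] by auto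
qed (rule cinner_add_left)

lemma bounded_linear_cscale: "bounded_linear (cscale c)"
proof
  show "cscale c (r *\<^sub>R g) = r *\<^sub>R cscale c g" for r and g :: "'a L2"
    by (simp add: scaleR_cscale mult.commute)
  show "\<exists>K. \<forall>g::'a L2. norm (cscale c g) \<le> norm g * K"
    by (rule exI[of _ "cmod c"]) (simp add: norm_cscale mult.commute)
qed (rule cscale_add_right)

lemma cnj_L2_cnj [simp]: "cnj_L2 (cnj_L2 f) = f"
  by (rule L2_eqI) (use rep_cnj[of "cnj_L2 f"] rep_cnj[of f] in \<open>eventually_elim, simp\<close>)

lemma cnj_L2_add: "cnj_L2 (f + g) = cnj_L2 f + cnj_L2 g"
  by (rule L2_eqI) (use rep_cnj[of "f + g"] rep_cnj[of f] rep_cnj[of g] rep_plus[of f g]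
    rep_plus[of "cnj_L2 f" "cnj_L2 g"] in \<open>eventually_elim, simp\<close>)

lemma cnj_L2_cscale: "cnj_L2 (cscale c f) = cscale (cnj c) (cnj_L2 f)"
  by (rule L2_eqI) (use rep_cnj[of "cscale c f"] rep_cnj[of f] rep_cscale[of c f]
    rep_cscale[of "cnj c" "cnj_L2 f"] in \<open>eventually_elim, simp\<close>)

lemma cinner_cnj: "cinner (cnj_L2 f) (cnj_L2 g) = cnj (cinner f g)"
proof -
  have "cinner (cnj_L2 f) (cnj_L2 g) = (\<integral>x. cnj (cnj (rep_L2 f x) * rep_L2 g x) \<partial>lborel)"
    unfolding cinner_rep
  proof (rule integral_cong_AE)
    show "AE x in lborel. cnj (rep_L2 (cnj_L2 f) x) * rep_L2 (cnj_L2 g) x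
        = cnj (cnj (rep_L2 f x) * rep_L2 g x)"
      using rep_cnj[of f] rep_cnj[of g] by eventually_elim simp
  qed measurable
  then show ?thesis by (simp only: Bochner_Integration.integral_cnj cinner_rep)
qed

lemma norm_cnj_L2 [simp]: "norm (cnj_L2 f) = norm (f :: 'a::euclidean_space L2)"
  by (rule norm_eq_of_cinner, unfold cinner_cnj) (simp_all add: cinner_self)

subsection \<open>Completeness\<close>

text \<open>Riesz--Fischer. Along a subsequence with increments of norm at most \<open>2\<^sup>-\<^sup>n\<close>, the function
  \<open>\<Sum>n. 2\<^sup>n * \<bar>increment n\<bar>\<^sup>2\<close> is integrable, so almost everywhere the increments are dominated by
  a geometric series and the subsequence converges pointwise; Fatou's lemma turns this into
  convergence in norm.\<close>

lemma L2_fast_Cauchy_convergent: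
  fixes u :: "nat \<Rightarrow> 'a::euclidean_space L2"
  assumes fast: "\<And>n m. n \<le> m \<Longrightarrow> norm (u m - u n) \<le> (1/2) ^ n"
  shows "convergent u"
proof -
  define d where "d n x = rep_L2 (u (Suc n)) x - rep_L2 (u n) x" for n x
  have [measurable]: "d n \<in> borel_measurable borel" for n unfolding d_def by measurable
  let ?D = "\<lambda>m n x. ennreal ((cmod (rep_L2 (u m) x - rep_L2 (u n) x))\<^sup>2)"
  have nd: "(\<integral>\<^sup>+x. ?D m n x \<partial>lborel)
      = ennreal ((norm (u m - u n))\<^sup>2)" for m n
    unfolding nn_integral_norm_sq[symmetric]
    by (rule nn_integral_cong_AE) (use rep_minus[of "u m" "u n"] in \<open>eventually_elim, simp\<close>)
  have "(\<integral>\<^sup>+x. (\<Sum>n. ennreal (2 ^ n * (cmod (d n x))\<^sup>2)) \<partial>lborel)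
      = (\<Sum>n. \<integral>\<^sup>+x. ennreal (2 ^ n * (cmod (d n x))\<^sup>2) \<partial>lborel)"
    by (rule nn_integral_suminf) measurable
  also have "\<dots> = (\<Sum>n. ennreal (2 ^ n * (norm (u (Suc n) - u n))\<^sup>2))"
    by (intro suminf_cong) (simp add: ennreal_mult nn_integral_cmult d_def nd)
  also have "\<dots> \<le> (\<Sum>n. ennreal ((1/2) ^ n))"
  proof (intro suminf_le ennreal_leI)
    fix n
    have "(norm (u (Suc n) - u n))\<^sup>2 \<le> ((1/2) ^ n)\<^sup>2"
      by (intro power_mono fast) auto
    then have "2 ^ n * (norm (u (Suc n) - u n))\<^sup>2 \<le> 2 ^ n * ((1/2) ^ n)\<^sup>2" by simp
    also have "\<dots> = (2 * (1/2) * (1/2)) ^ n"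
      unfolding power_mult_distrib by (simp add: power2_eq_square)
    finally show "2 ^ n * (norm (u (Suc n) - u n))\<^sup>2 \<le> (1/2) ^ n" by simp
  qed auto
  also have "\<dots> = ennreal (\<Sum>n. (1/2) ^ n)"
    by (rule suminf_ennreal2) (auto intro: summable_geometric)
  also have "\<dots> < \<infinity>" by simp
  finally have "AE x in lborel. (\<Sum>n. ennreal (2 ^ n * (cmod (d n x))\<^sup>2)) \<noteq> \<infinity>"
    by (intro nn_integral_PInf_AE) auto
  then have conv: "AE x in lborel. convergent (\<lambda>n. rep_L2 (u n) x)"
  proof eventually_elim
    case (elim x)
    then have "summable (\<lambda>n. 2 ^ n * (cmod (d n x))\<^sup>2)"
      by (intro summable_suminf_not_top) (auto simp: top_ennreal_def infinity_ennreal_def)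
    then have "Bseq (\<lambda>n. 2 ^ n * (cmod (d n x))\<^sup>2)"
      using summable_LIMSEQ_zero convergent_imp_Bseq convergentI by blast
    then obtain K where K: "K > 0" "\<And>n. norm (2 ^ n * (cmod (d n x))\<^sup>2) \<le> K"
      by (auto simp: Bseq_def)
    have "cmod (d n x) \<le> sqrt K * (sqrt (1/2)) ^ n" for n
    proof -
      have "(cmod (d n x))\<^sup>2 \<le> K * (1/2) ^ n"
        using K(2)[of n] by (simp add: field_simps)
      then have "sqrt ((cmod (d n x))\<^sup>2) \<le> sqrt (K * (1/2) ^ n)" by (rule real_sqrt_le_mono)
      then show ?thesis by (simp add: real_sqrt_mult real_sqrt_power)
    qed
    moreover have "summable (\<lambda>n. sqrt K * (sqrt (1/2)) ^ n)"
      by (intro summable_mult summable_geometric) (simp add: real_sqrt_lt_1_iff)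
    ultimately have "summable (\<lambda>n. d n x)"
      by (rule summable_comparison_test'[rotated, where N=0]) 
    then have "convergent (\<lambda>N. \<Sum>n<N. d n x)" by (simp add: summable_iff_convergent)
    moreover have "(\<Sum>n<N. d n x) = rep_L2 (u N) x - rep_L2 (u 0) x" for N
      unfolding d_def by (rule sum_lessThan_telescope)
    ultimately have "convergent (\<lambda>N. rep_L2 (u N) x - rep_L2 (u 0) x + rep_L2 (u 0) x)"
      by (intro convergent_add convergent_const) auto
    then show ?case by simp
  qed
  define v where "v x = lim (\<lambda>n. rep_L2 (u n) x)" for x
  let ?V = "\<lambda>n x. ennreal ((cmod (v x - rep_L2 (u n) x))\<^sup>2)"
  have [measurable]: "v \<in> borel_measurable borel"
    unfolding v_def by (intro borel_measurable_lim_metric) auto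
  have fatou: "(\<integral>\<^sup>+x. ?V n x \<partial>lborel) \<le> ennreal (((1/2) ^ n)\<^sup>2)" for n
  proof -
    have "(\<integral>\<^sup>+x. ?V n x \<partial>lborel)
        = (\<integral>\<^sup>+x. liminf (\<lambda>m. ?D m n x) \<partial>lborel)"
    proof (rule nn_integral_cong_AE, use conv in eventually_elim)
      case (elim x)
      then have "(\<lambda>m. rep_L2 (u m) x) \<longlonglongrightarrow> v x"
        unfolding v_def by (simp add: convergent_LIMSEQ_iff)
      then have "(\<lambda>m. ?D m n x)
          \<longlonglongrightarrow> ?V n x"
        by (intro tendsto_intros)
      then show ?case by (rule lim_imp_Liminf[OF sequentially_bot, symmetric])
    qed
    also have "\<dots> \<le> liminf (\<lambda>m. \<integral>\<^sup>+x. ?D m n x \<partial>lborel)"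
      by (rule nn_integral_liminf) measurable
    also have "\<dots> \<le> liminf (\<lambda>m. ennreal (((1/2) ^ n)\<^sup>2))"
    proof (rule Liminf_mono)
      show "\<forall>\<^sub>F m in sequentially. (\<integral>\<^sup>+x. ?D m n x \<partial>lborel)
         \<le> ennreal (((1/2) ^ n)\<^sup>2)"
        using eventually_ge_at_top[of n]
        by eventually_elim (unfold nd, intro ennreal_leI power_mono fast, auto)
    qed
    finally show ?thesis by (simp add: Liminf_const)
  qed
  have sqn: "sq_integrable (\<lambda>x. v x - rep_L2 (u n) x)" for n
    using fatou[of n] unfolding sq_integrable_def
    by (auto intro!: integrableI_bounded simp: top_unique less_top[symmetric] dest: le_less_trans)
  have v: "sq_integrable v"
    using sq_integrable_add[OF sqn[of 0] sq_integrable_rep[of "u 0"]] by simp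
  have bound: "norm (abs_L2 v - u n) \<le> (1/2) ^ n" for n
  proof -
    have "abs_L2 v - u n = abs_L2 (\<lambda>x. v x - rep_L2 (u n) x)"
      by (rule L2_eq_absI[OF sqn])
        (use rep_minus[of "abs_L2 v" "u n"] rep_abs_L2[OF v] in \<open>eventually_elim, simp\<close>)
    then have "ennreal ((norm (abs_L2 v - u n))\<^sup>2) = (\<integral>\<^sup>+x. ?V n x \<partial>lborel)"
      using sqn[of n] by (simp add: norm_sq_abs nn_integral_eq_integral sq_integrable_def)
    then have "(norm (abs_L2 v - u n))\<^sup>2 \<le> ((1/2) ^ n)\<^sup>2"
      using fatou[of n] by (subst ennreal_le_iff[symmetric]) auto
    then show ?thesis by (rule power2_le_imp_le) simp
  qed
  have "(\<lambda>n. norm (u n - abs_L2 v)) \<longlonglongrightarrow> 0"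
    by (rule tendsto_sandwich[OF _ _ tendsto_const LIMSEQ_realpow_zero[of "1/2"]])
      (use bound in \<open>auto simp: norm_minus_commute\<close>)
  then show ?thesis
    by (auto simp: convergent_def tendsto_norm_zero_iff LIM_zero_iff)
qed

instance L2 :: (euclidean_space) banach
proof
  fix X :: "nat \<Rightarrow> 'a L2" assume X: "Cauchy X"
  have "\<exists>r. strict_mono r \<and> (\<forall>n. \<forall>m\<ge>r n. \<forall>m'\<ge>r n. norm (X m - X m') \<le> (1/2) ^ n)"
  proof -
    have "\<exists>N. \<forall>m\<ge>N. \<forall>m'\<ge>N. norm (X m - X m') < (1/2) ^ n" for n
      using X by (simp add: Cauchy_iff)
    then obtain N where N: "\<And>n m m'. m \<ge> N n \<Longrightarrow> m' \<ge> N n \<Longrightarrow> norm (X m - X m') < (1/2) ^ n"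
      by metis
    \<comment> \<open>The sum dominates every \<open>N k\<close> with \<open>k \<le> n\<close>, and the summand \<open>n\<close> makes \<open>r\<close> strictly increasing.\<close>
    define r where "r n = n + (\<Sum>k\<le>n. N k)" for n
    have "N n \<le> r n" for n
      unfolding r_def by (rule trans_le_add2) (auto intro: member_le_sum)
    then have "\<forall>n. \<forall>m\<ge>r n. \<forall>m'\<ge>r n. norm (X m - X m') \<le> (1/2) ^ n"
      using N by (meson le_trans less_imp_le)
    moreover have "strict_mono r" by (rule strict_monoI_Suc) (simp add: r_def)
    ultimately show ?thesis by blast
  qed
  then obtain r where r: "strict_mono r" "\<And>n m m'. m \<ge> r n \<Longrightarrow> m' \<ge> r n \<Longrightarrow> norm (X m - X m') \<le> (1/2) ^ n"
    by blast
  have "convergent (X \<circ> r)"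
    by (rule L2_fast_Cauchy_convergent) (auto intro!: r(2) strict_mono_leD[OF r(1)])
  then obtain L where L: "(X \<circ> r) \<longlonglongrightarrow> L" by (auto simp: convergent_def)
  have "X \<longlonglongrightarrow> L" by (rule Cauchy_converges_subseq[OF X r(1) L])
  then show "convergent X" by (auto simp: convergent_def)
qed

section \<open>Orthonormal bases, adjoints and traces\<close>

subsection \<open>Bounded complex-linear operators\<close>

type_synonym 'a op = "'a L2 \<Rightarrow> 'a L2"

lemma bounded_op_linear: "bounded_op T \<Longrightarrow> bounded_linear T"
  by (simp add: bounded_op_def)

lemma bounded_op_cscale: "bounded_op T \<Longrightarrow> T (cscale c f) = cscale c (T f)"
  by (simp add: bounded_op_def)

lemma bounded_op_add: "bounded_op T \<Longrightarrow> T (f + g) = T f + T g"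
  by (simp add: bounded_op_linear linear_simps(1))

lemma bounded_op_bound:
  assumes "bounded_op T" obtains K where "0 < K" "\<And>f. norm (T f) \<le> K * norm f"
  using bounded_linear.pos_bounded[OF bounded_op_linear[OF assms]] by (metis mult.commute)

lemma bounded_opI:
  assumes "\<And>f g. T (f + g) = T f + T g" "\<And>c f. T (cscale c f) = cscale c (T f)"
    and "\<And>f. norm (T f) \<le> K * norm f"
  shows "bounded_op T"
  unfolding bounded_op_def
proof (intro conjI allI assms(2))
  show "bounded_linear T"
    by (rule bounded_linear_intro[of _ K])
      (use assms in \<open>auto simp: scaleR_cscale mult.commute\<close>)
qed

lemma bounded_op_comp: "bounded_op S \<Longrightarrow> bounded_op T \<Longrightarrow> bounded_op (\<lambda>f. S (T f))"
  unfolding bounded_op_def by (simp add: bounded_linear_compose)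

lemma bounded_op_id: "bounded_op (\<lambda>f. f)"
  by (simp add: bounded_op_def bounded_linear_ident)

lemma bounded_op_tendsto:
  "bounded_op T \<Longrightarrow> (u \<longlongrightarrow> v) F \<Longrightarrow> ((\<lambda>n. T (u n)) \<longlongrightarrow> T v) F"
  by (rule bounded_linear.tendsto[OF bounded_op_linear])

text \<open>Adjointness for the complex pairing. It entails adjointness for the real inner product, in
  terms of which \<^const>\<open>adjoint\<close> is defined.\<close>

definition adjoint_pair :: "'a::euclidean_space op \<Rightarrow> 'a op \<Rightarrow> bool" where
  "adjoint_pair T S \<longleftrightarrow> (\<forall>f g. cinner (T f) g = cinner f (S g))"

lemma adjoint_pair_sym: "adjoint_pair T S \<Longrightarrow> adjoint_pair S T"
  unfolding adjoint_pair_def by (metis cinner_commute)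

lemma adjoint_pair_adjoint: "adjoint_pair T S \<Longrightarrow> adjoint T = S"
  by (rule adjoint_unique) (simp add: adjoint_pair_def inner_L2_def)

lemma adjoint_pair_comp:
  "adjoint_pair T T' \<Longrightarrow> adjoint_pair S S' \<Longrightarrow> adjoint_pair (\<lambda>f. T (S f)) (\<lambda>f. S' (T' f))"
  by (simp add: adjoint_pair_def)

text \<open>Linearity of \<open>S\<close> follows from nondegeneracy of the pairing, and its bound from
  \<open>norm (S g) ^ 2 = cinner (T (S g)) g\<close>.\<close>

lemma bounded_op_of_adjoint_pair:
  assumes T: "bounded_op T" and TS: "adjoint_pair T S" shows "bounded_op S"
proof -
  obtain K where K: "0 < K" "\<And>f. norm (T f) \<le> K * norm f" using bounded_op_bound[OF T] by blast
  have TS': "cinner f (S g) = cinner (T f) g" for f g using TS by (simp add: adjoint_pair_def)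
  show ?thesis
  proof (rule bounded_opI)
    show "norm (S g) \<le> K * norm g" for g
    proof (cases "S g = 0")
      case False
      have "complex_of_real ((norm (S g))\<^sup>2) = cinner (T (S g)) g" by (simp add: cinner_self[symmetric] TS' del: of_real_power)
      then have "(norm (S g))\<^sup>2 = cmod (cinner (T (S g)) g)"
        by (metis norm_of_real abs_of_nonneg zero_le_power2)
      also have "\<dots> \<le> norm (T (S g)) * norm g" by (rule cinner_Cauchy_Schwarz)
      also have "\<dots> \<le> K * norm (S g) * norm g" using K by (simp add: mult_right_mono)
      finally have "norm (S g) * norm (S g) \<le> norm (S g) * (K * norm g)"
        by (simp add: power2_eq_square mult_ac)
      then show ?thesis using False by simp
    qed (use K in auto)
  qed (auto intro!: cinner_ext simp: TS' cinner_add_right cinner_cscale_right)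
qed

subsection \<open>Expansions in an orthonormal basis\<close>

lemma onb_orthonormal: "onb e \<Longrightarrow> cinner (e j) (e k) = (if j = k then 1 else 0)"
  by (simp add: onb_def)

lemma onb_norm: "onb e \<Longrightarrow> norm (e k) = 1"
  by (rule norm_eq_of_cinner) (simp_all add: onb_orthonormal)

lemma norm_sq_onb_sum:
  assumes e: "onb e" and A: "finite A"
  shows "(norm (\<Sum>k\<in>A. cscale (c k) (e k)))\<^sup>2 = (\<Sum>k\<in>A. (cmod (c k))\<^sup>2)"
proof -
  have "pairwise (\<lambda>i j. orthogonal (cscale (c i) (e i)) (cscale (c j) (e j))) A"
    by (simp add: pairwise_def orthogonal_def inner_L2_def cinner_cscale_left cinner_cscale_right
        onb_orthonormal[OF e])
  from norm_sum_Pythagorean[OF A this] show ?thesis by (simp add: norm_cscale onb_norm[OF e])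
qed

text \<open>By Pythagoras the partial sums form a Cauchy sequence.\<close>

lemma orthogonal_series_summable:
  fixes u :: "nat \<Rightarrow> 'a::{real_inner, banach}"
  assumes orth: "\<And>j k. j \<noteq> k \<Longrightarrow> u j \<bullet> u k = 0" and u: "summable (\<lambda>k. (norm (u k))\<^sup>2)"
  shows "summable u"
  unfolding summable_Cauchy
proof (intro allI impI)
  fix d :: real assume "0 < d"
  then obtain N where N: "\<And>m n. m \<ge> N \<Longrightarrow> norm (\<Sum>k\<in>{m..<n}. (norm (u k))\<^sup>2) < d\<^sup>2"
    using u unfolding summable_Cauchy by (metis zero_less_power)
  have "norm (sum u {m..<n}) < d" if "m \<ge> N" for m n
  proof (rule power2_less_imp_less)
    have "pairwise (\<lambda>i j. orthogonal (u i) (u j)) {m..<n}"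
      using orth by (simp add: pairwise_def orthogonal_def)
    from norm_sum_Pythagorean[OF finite_atLeastLessThan this]
    show "(norm (sum u {m..<n}))\<^sup>2 < d\<^sup>2" using N[OF that, of n] by simp
  qed (use \<open>0 < d\<close> in simp)
  then show "\<exists>N. \<forall>m\<ge>N. \<forall>n. norm (sum u {m..<n}) < d" by blast
qed

lemma onb_series_summable:
  assumes e: "onb e" and c: "summable (\<lambda>k. (cmod (c k))\<^sup>2)"
  shows "summable (\<lambda>k. cscale (c k) (e k))"
  by (rule orthogonal_series_summable)
    (simp_all add: inner_L2_def cinner_cscale_left cinner_cscale_right onb_orthonormal[OF e]
      norm_cscale onb_norm[OF e] c)

text \<open>Testing \<open>T\<close> on the finite combination \<open>v\<close> of basis vectors with the coefficients
  \<open>cinner (T (e k)) g\<close> gives \<open>norm v ^ 2 = cinner (T v) g\<close>, and boundedness of \<open>T\<close> turns this into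
  a bound on \<open>v\<close>. For the identity this is Bessel's inequality.\<close>

lemma onb_coeffs_bound:
  fixes T :: "'a::euclidean_space op" and e :: "nat \<Rightarrow> 'a L2"
  assumes e: "onb e" and A: "finite A" and T: "bounded_op T" "0 < K" "\<And>f. norm (T f) \<le> K * norm f"
  shows "(\<Sum>k\<in>A. (cmod (cinner (T (e k)) g))\<^sup>2) \<le> (K * norm g)\<^sup>2"
proof -
  define v where "v = (\<Sum>k\<in>A. cscale (cinner (T (e k)) g) (e k))"
  have s: "(norm v)\<^sup>2 = (\<Sum>k\<in>A. (cmod (cinner (T (e k)) g))\<^sup>2)"
    unfolding v_def by (rule norm_sq_onb_sum[OF e A])
  have "cinner (T v) g = (\<Sum>k\<in>A. cnj (cinner (T (e k)) g) * cinner (T (e k)) g)"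
    by (simp add: v_def linear_sum[OF bounded_linear.linear[OF bounded_op_linear[OF T(1)]]]
        bounded_op_cscale[OF T(1)] cinner_sum_left cinner_cscale_left)
  also have "\<dots> = complex_of_real ((norm v)\<^sup>2)"
    unfolding s by (simp add: complex_norm_square mult.commute del: of_real_power)
  finally have "(norm v)\<^sup>2 \<le> norm (T v) * norm g"
    using cinner_Cauchy_Schwarz[of "T v" g] by (simp del: of_real_power)
  also have "\<dots> \<le> K * norm v * norm g" using T by (simp add: mult_right_mono)
  finally have "norm v * norm v \<le> norm v * (K * norm g)" by (simp add: power2_eq_square mult_ac)
  then have "norm v \<le> K * norm g" using T(2) by (cases "v = 0") auto
  then show ?thesis unfolding s[symmetric] by (intro power_mono) auto
qed

lemma onb_Bessel:
  assumes "onb e" "finite A" shows "(\<Sum>k\<in>A. (cmod (cinner (e k) f))\<^sup>2) \<le> (norm f)\<^sup>2"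
  using onb_coeffs_bound[OF assms bounded_op_id, of 1 f] by simp

lemma onb_coeffs_summable:
  assumes "onb e" shows "summable (\<lambda>k. (cmod (cinner (e k) f))\<^sup>2)"
  by (rule summableI_nonneg_bounded[where x = "(norm f)\<^sup>2"])
    (use onb_Bessel[OF assms] in auto)

lemma onb_expansion:
  assumes e: "onb e" shows "(\<lambda>k. cscale (cinner (e k) f) (e k)) sums f"
proof -
  have s: "(\<lambda>k. cscale (cinner (e k) f) (e k)) sums (\<Sum>k. cscale (cinner (e k) f) (e k))"
    (is "_ sums ?v") by (intro summable_sums onb_series_summable[OF e] onb_coeffs_summable[OF e])
  have "cinner (e j) (f - ?v) = 0" for j
  proof -
    have "(\<lambda>k. cinner (e j) (cscale (cinner (e k) f) (e k))) sums cinner (e j) ?v"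
      by (rule bounded_linear.sums[OF bounded_linear_cinner_right s])
    moreover have "(\<lambda>k. cinner (e j) (cscale (cinner (e k) f) (e k)))
        = (\<lambda>k. if k = j then cinner (e j) f else 0)"
      by (auto simp: cinner_cscale_right onb_orthonormal[OF e])
    ultimately have "cinner (e j) ?v = cinner (e j) f"
      using sums_single[of j "\<lambda>k. cinner (e j) f"] sums_unique2 by auto
    then show ?thesis by (simp add: cinner_diff_right)
  qed
  then have "f - ?v = 0" using e unfolding onb_def by blast
  then show ?thesis using s by simp
qed

lemma onb_Parseval:
  assumes "onb e" shows "(\<lambda>k. cinner g (e k) * cinner (e k) f) sums cinner g f"
  using bounded_linear.sums[OF bounded_linear_cinner_right onb_expansion[OF assms], of g f]
  by (simp add: cinner_cscale_right mult.commute)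

lemma onb_Parseval_abs_bound:
  assumes "onb e"
  shows "(\<Sum>k<n. cmod (cinner g (e k) * cinner (e k) f)) \<le> norm g * norm f"
proof -
  have L2: "L2_set (\<lambda>k. cmod (cinner (e k) h)) {..<n} \<le> norm h" for h
    unfolding L2_set_def using onb_Bessel[OF assms, of "{..<n}" h] by (simp add: real_le_lsqrt)
  have "(\<Sum>k<n. cmod (cinner g (e k) * cinner (e k) f))
      = (\<Sum>k<n. \<bar>cmod (cinner (e k) g)\<bar> * \<bar>cmod (cinner (e k) f)\<bar>)"
    by (intro sum.cong refl, subst cinner_commute) (simp add: norm_mult)
  also have "\<dots> \<le> L2_set (\<lambda>k. cmod (cinner (e k) g)) {..<n} * L2_set (\<lambda>k. cmod (cinner (e k) f)) {..<n}"
    by (rule L2_set_mult_ineq)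
  also have "\<dots> \<le> norm g * norm f"
    by (intro mult_mono L2) (auto simp: L2_set_nonneg)
  finally show ?thesis .
qed

text \<open>The adjoint applied to \<open>g\<close> must have the coefficients \<open>cinner (T (e k)) g\<close>, which have just
  been seen to be square summable.\<close>

lemma bounded_op_has_adjoint:
  fixes T :: "'a::euclidean_space op" and e :: "nat \<Rightarrow> 'a L2"
  assumes e: "onb e" and T: "bounded_op T"
  shows "\<exists>S. bounded_op S \<and> adjoint_pair T S"
proof -
  obtain K where K: "0 < K" "\<And>f. norm (T f) \<le> K * norm f" using bounded_op_bound[OF T] by blast
  define S where "S g = (\<Sum>k. cscale (cinner (T (e k)) g) (e k))" for g
  have S: "(\<lambda>k. cscale (cinner (T (e k)) g) (e k)) sums S g" for g
    unfolding S_def 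
    by (intro summable_sums onb_series_summable[OF e] 
        summableI_nonneg_bounded[OF _ onb_coeffs_bound[OF e finite_lessThan T K]]) auto
  have "cinner (T f) g = cinner f (S g)" for f g
  proof -
    have "(\<lambda>k. cinner f (e k) * cinner (T (e k)) g) sums cinner f (S g)"
      using bounded_linear.sums[OF bounded_linear_cinner_right S, of f g]
      by (simp add: cinner_cscale_right mult.commute)
    moreover have "(\<lambda>k. cinner f (e k) * cinner (T (e k)) g) sums cinner (T f) g"
    proof -
      have "(\<lambda>k. T (cscale (cinner (e k) f) (e k))) sums T f"
        by (rule bounded_linear.sums[OF bounded_op_linear[OF T] onb_expansion[OF e]])
      from bounded_linear.sums[OF bounded_linear_cinner_left this, of g]
      show ?thesis
        by (simp add: bounded_op_cscale[OF T] cinner_cscale_left cinner_commute[of f])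
    qed
    ultimately show ?thesis using sums_unique2 by blast
  qed
  then have "adjoint_pair T S" by (simp add: adjoint_pair_def)
  then show ?thesis using bounded_op_of_adjoint_pair[OF T] by blast
qed

lemma adjoint_pair_adjoint_self:
  fixes T :: "'a::euclidean_space op" and e :: "nat \<Rightarrow> 'a L2"
  assumes "onb e" "bounded_op T" shows "adjoint_pair T (adjoint T)"
  using bounded_op_has_adjoint[OF assms] adjoint_pair_adjoint by metis

subsection \<open>Nuclear representations\<close>

text \<open>The sum of the first \<open>n\<close> diagonal matrix elements is a series in \<open>k\<close> whose terms are
  partial sums of Parseval's expansion of \<open>cinner (g k) (f k)\<close>, bounded by
  \<open>norm (f k) * norm (g k)\<close> uniformly in \<open>n\<close>; so the limit \<open>n \<rightarrow> \<infinity>\<close> may be taken termwise.\<close>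

lemma nuclear_trace_sums:
  assumes e: "onb e" and T: "nuclear_rep T f g"
  shows "(\<lambda>j. cinner (e j) (T (e j))) sums (\<Sum>k. cinner (g k) (f k))"
proof -
  let ?a = "\<lambda>k j. cinner (g k) (e j) * cinner (e j) (f k)"
  have row: "(\<lambda>k. ?a k j) sums cinner (e j) (T (e j))" for j
  proof -
    have "(\<lambda>k. cscale (cinner (g k) (e j)) (f k)) sums T (e j)"
      using T by (simp add: nuclear_rep_def)
    from bounded_linear.sums[OF bounded_linear_cinner_right this, of "e j"]
    show ?thesis by (simp add: cinner_cscale_right)
  qed
  have "((\<lambda>n. \<Sum>k. \<Sum>j<n. ?a k j) \<longlongrightarrow> (\<Sum>k. cinner (g k) (f k))) sequentially"
  proof (rule tannerys_theorem[THEN conjunct2, THEN conjunct2])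
    show "(\<lambda>n. \<Sum>j<n. ?a k j) \<longlonglongrightarrow> cinner (g k) (f k)" for k
      using onb_Parseval[OF e] by (simp add: sums_def)
    show "\<forall>\<^sub>F (k, n) in at_top \<times>\<^sub>F sequentially. norm (\<Sum>j<n. ?a k j) \<le> norm (g k) * norm (f k)"
      by (intro always_eventually)
        (auto intro: order_trans[OF norm_sum onb_Parseval_abs_bound[OF e]])
    show "summable (\<lambda>k. norm (g k) * norm (f k))"
      using T by (simp add: nuclear_rep_def mult.commute)
  qed auto
  moreover have "(\<Sum>k. \<Sum>j<n. ?a k j) = (\<Sum>j<n. cinner (e j) (T (e j)))" for n
    using sums_sum[of "{..<n}" "\<lambda>j k. ?a k j", OF row] by (simp add: sums_iff)
  ultimately show ?thesis by (simp add: sums_def)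
qed

lemma op_trace_onb:
  fixes T :: "'a::euclidean_space op" and e :: "nat \<Rightarrow> 'a L2"
  assumes "onb e" "nuclear_rep T f g"
  shows "op_trace T = (\<Sum>k. cinner (g k) (f k))"
  unfolding op_trace_def
proof (rule the_equality)
  show "\<forall>e. onb e \<longrightarrow> (\<lambda>k. cinner (e k) (T (e k))) sums (\<Sum>k. cinner (g k) (f k))"
    using nuclear_trace_sums[OF _ assms(2)] by blast
  fix t assume "\<forall>e. onb e \<longrightarrow> (\<lambda>k. cinner (e k) (T (e k))) sums t"
  then have "(\<lambda>k. cinner (e k) (T (e k))) sums t" using assms(1) by blast
  then show "t = (\<Sum>k. cinner (g k) (f k))"
    by (rule sums_unique2[OF _ nuclear_trace_sums[OF assms]])
qed

lemma nuclear_rep_conjugate: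
  assumes T: "nuclear_rep T f g" and A: "bounded_op A" and B: "adjoint_pair B B'" "bounded_op B'"
  shows "nuclear_rep (\<lambda>h. A (T (B h))) (\<lambda>k. A (f k)) (\<lambda>k. B' (g k))"
  unfolding nuclear_rep_def
proof (intro conjI allI)
  obtain K where K: "0 < K" "\<And>f. norm (A f) \<le> K * norm f" using bounded_op_bound[OF A] by blast
  obtain L where L: "0 < L" "\<And>f. norm (B' f) \<le> L * norm f" using bounded_op_bound[OF B(2)] by blast
  have "summable (\<lambda>k. K * L * (norm (f k) * norm (g k)))"
    using T by (intro summable_mult) (simp add: nuclear_rep_def)
  then show "summable (\<lambda>k. norm (A (f k)) * norm (B' (g k)))"
  proof (rule summable_comparison_test'[where N=0])
    fix k
    have "norm (A (f k)) * norm (B' (g k)) \<le> (K * norm (f k)) * (L * norm (g k))"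
      using K L by (intro mult_mono) auto
    then show "norm (norm (A (f k)) * norm (B' (g k))) \<le> K * L * (norm (f k) * norm (g k))"
      by (simp add: mult_ac)
  qed
next
  fix h
  have "(\<lambda>k. cscale (cinner (g k) (B h)) (f k)) sums T (B h)"
    using T by (simp add: nuclear_rep_def)
  from bounded_linear.sums[OF bounded_op_linear[OF A] this]
  have "(\<lambda>k. cscale (cinner (g k) (B h)) (A (f k))) sums A (T (B h))"
    by (simp add: bounded_op_cscale[OF A])
  moreover have "cinner (g k) (B h) = cinner (B' (g k)) h" for k
    using adjoint_pair_sym[OF B(1)] by (simp add: adjoint_pair_def)
  ultimately show "(\<lambda>k. cscale (cinner (B' (g k)) h) (A (f k))) sums A (T (B h))" by simp
qed

text \<open>The adjoint series converges absolutely in norm, so it defines an operator, and pairing it with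
  arbitrary vectors identifies this operator as \<open>S\<close>.\<close>

lemma nuclear_rep_adjoint:
  assumes T: "nuclear_rep T f g" and TS: "adjoint_pair T S"
  shows "nuclear_rep S g f"
  unfolding nuclear_rep_def
proof (intro conjI allI)
  show s: "summable (\<lambda>k. norm (g k) * norm (f k))"
    using T by (simp add: nuclear_rep_def mult.commute)
  fix h
  have "summable (\<lambda>k. cscale (cinner (f k) h) (g k))"
  proof (rule summable_comparison_test'[OF summable_mult[OF s, of "norm h"], where N=0])
    fix k
    have "norm (cscale (cinner (f k) h) (g k)) \<le> (norm (f k) * norm h) * norm (g k)"
      unfolding norm_cscale by (intro mult_right_mono cinner_Cauchy_Schwarz) auto
    then show "norm (cscale (cinner (f k) h) (g k)) \<le> norm h * (norm (g k) * norm (f k))"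
      by (simp add: mult_ac)
  qed
  then have v: "(\<lambda>k. cscale (cinner (f k) h) (g k)) sums (\<Sum>k. cscale (cinner (f k) h) (g k))"
    (is "_ sums ?v") by (rule summable_sums)
  have "cinner x ?v = cinner x (S h)" for x
  proof -
    have "(\<lambda>k. cinner (f k) h * cinner x (g k)) sums cinner x ?v"
      using bounded_linear.sums[OF bounded_linear_cinner_right v, of x] by (simp add: cinner_cscale_right)
    moreover have "(\<lambda>k. cscale (cinner (g k) x) (f k)) sums T x"
      using T by (simp add: nuclear_rep_def)
    from bounded_linear.sums[OF bounded_linear_cinner_left this, of h]
    have "(\<lambda>k. cinner (f k) h * cinner x (g k)) sums cinner (T x) h"
      by (simp add: cinner_cscale_left cinner_commute[of x] mult.commute)
    ultimately have "cinner x ?v = cinner (T x) h" by (rule sums_unique2)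
    then show ?thesis using TS by (simp add: adjoint_pair_def)
  qed
  then have "?v = S h" by (rule cinner_ext)
  then show "(\<lambda>k. cscale (cinner (f k) h) (g k)) sums S h" using v by simp
qed

section \<open>Multiplication operators and densities\<close>

text \<open>Boxes form an intersection-stable generator of the Borel sets, so the integrals over all
  Borel subsets of a fixed large box vanish as well.\<close>

lemma AE_zero_if_box_integrals_zero:
  fixes h :: "'a::euclidean_space \<Rightarrow> complex"
  assumes int: "\<And>a b. set_integrable lborel (box a b) h"
    and zero: "\<And>a b. (LINT x:box a b|lborel. h x) = 0"
  shows "AE x in lborel. h x = 0"
proof -
  define B :: "nat \<Rightarrow> 'a set" where "B n = box (- (real n *\<^sub>R One)) (real n *\<^sub>R One)" for n
  have "AE x in lborel. indicator (B n) x *\<^sub>R h x = 0" for n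
  proof (rule sigma_finite_measure.density_zero[OF sigma_finite_lborel])
    have iB: "integrable lborel (\<lambda>x. indicator (B n) x *\<^sub>R h x)"
      using int unfolding B_def set_integrable_def .
    then show "integrable lborel (\<lambda>x. indicator (B n) x *\<^sub>R h x)" .
    have iAB: "set_integrable lborel A (\<lambda>x. indicator (B n) x *\<^sub>R h x)" if "A \<in> sets borel" for A
      unfolding set_integrable_def using that by (intro integrable_mult_indicator iB) auto
    fix A :: "'a set" assume "A \<in> sets lborel"
    have stable: "Int_stable (range (\<lambda>(a, b). box a b :: 'a set))"
      by (auto simp: Int_stable_def box_Int_box)
    have pow: "range (\<lambda>(a, b). box a b :: 'a set) \<subseteq> Pow UNIV" by simp
    from \<open>A \<in> sets lborel\<close> have "A \<in> sigma_sets UNIV (range (\<lambda>(a, b). box a b))"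
      by (simp add: borel_eq_box)
    then show "(LINT x:A|lborel. indicator (B n) x *\<^sub>R h x) = 0"
    proof (induction rule: sigma_sets_induct_disjoint[OF stable pow, consumes 1,
      case_names basic empty compl union])
      case (basic A)
      then obtain a b where A: "A = box a b" by auto
      obtain c d where cd: "A \<inter> B n = box c d" unfolding A B_def box_Int_box by blast
      have "(LINT x:A|lborel. indicator (B n) x *\<^sub>R h x) = (LINT x:box c d|lborel. h x)"
        unfolding set_lebesgue_integral_def cd[symmetric]
        by (intro Bochner_Integration.integral_cong refl) (auto simp: indicator_def)
      then show ?case by (simp add: zero)
    next
      case empty
      then show ?case by (simp add: set_lebesgue_integral_def)
    next
      case (compl A)
      then have A: "A \<in> sets borel" by (simp add: borel_eq_box)
      have "(LINT x:UNIV|lborel. indicator (B n) x *\<^sub>R h x)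
          = (LINT x:A|lborel. indicator (B n) x *\<^sub>R h x) + (LINT x:UNIV - A|lborel. indicator (B n) x *\<^sub>R h x)"
        using set_integral_Un[OF _ iAB[OF A] iAB[of "UNIV - A"]] A by simp
      moreover have "(LINT x:UNIV|lborel. indicator (B n) x *\<^sub>R h x) = 0"
        using zero unfolding set_lebesgue_integral_def B_def by simp
      ultimately show ?case using compl by simp
    next
      case (union A)
      then have A: "A i \<in> sets borel" for i by (auto simp: borel_eq_box)
      have "(LINT x:(\<Union>i. A i)|lborel. indicator (B n) x *\<^sub>R h x)
          = (\<Sum>i. LINT x:A i|lborel. indicator (B n) x *\<^sub>R h x)"
        using A union(1) iAB[of "\<Union>i. A i"]
        by (intro lebesgue_integral_countable_add) (auto simp: disjoint_family_on_def)
      then show ?case using union by simp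
    qed
  qed
  then have "AE x in lborel. \<forall>n. indicator (B n) x *\<^sub>R h x = 0"
    unfolding AE_all_countable by blast
  then show ?thesis
  proof eventually_elim
    case (elim x)
    obtain n where n: "norm x < real n" using reals_Archimedean2 by blast
    have "- real n < x \<bullet> i \<and> x \<bullet> i < real n" if "i \<in> Basis" for i
      using Basis_le_norm[OF that, of x] n by linarith
    then have "x \<in> B n"
      unfolding B_def box_def by auto
    then show ?case using elim by (auto simp: indicator_def split: if_splits)
  qed
qed

definition bdd_borel :: "('a::euclidean_space \<Rightarrow> real) \<Rightarrow> bool" where
  "bdd_borel c \<longleftrightarrow> c \<in> borel_measurable borel \<and> (\<exists>K. \<forall>x. \<bar>c x\<bar> \<le> K)"

lemma bdd_borel_measurable [measurable_dest]: "bdd_borel c \<Longrightarrow> c \<in> borel_measurable borel"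
  by (simp add: bdd_borel_def)

lemma bdd_borelI: "c \<in> borel_measurable borel \<Longrightarrow> (\<And>x. \<bar>c x\<bar> \<le> K) \<Longrightarrow> bdd_borel c"
  by (auto simp: bdd_borel_def)

lemma bdd_borel_bound:
  assumes "bdd_borel c" obtains K where "0 < K" "\<And>x. \<bar>c x\<bar> \<le> K"
proof -
  obtain K where "\<And>x. \<bar>c x\<bar> \<le> K" using assms by (auto simp: bdd_borel_def)
  then have "\<bar>c x\<bar> \<le> max K 1" for x by (meson max.coboundedI1)
  then show ?thesis using that[of "max K 1"] by simp
qed

lemma bdd_borel_const: "bdd_borel (\<lambda>_. r)"
  by (rule bdd_borelI[of _ "\<bar>r\<bar>"]) auto

lemma bdd_borel_indicator: "A \<in> sets borel \<Longrightarrow> bdd_borel (indicator A)"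
  by (rule bdd_borelI[of _ 1]) (auto simp: indicator_def)

lemma bdd_borel_mult: "bdd_borel c \<Longrightarrow> bdd_borel d \<Longrightarrow> bdd_borel (\<lambda>x. c x * d x)"
proof -
  assume c: "bdd_borel c" and d: "bdd_borel d"
  obtain K where K: "0 < K" "\<And>x. \<bar>c x\<bar> \<le> K" using bdd_borel_bound[OF c] by blast
  obtain L where L: "0 < L" "\<And>x. \<bar>d x\<bar> \<le> L" using bdd_borel_bound[OF d] by blast
  show ?thesis
    by (rule bdd_borelI[of _ "K * L"])
      (use c d K L in \<open>auto simp: bdd_borel_def abs_mult intro!: mult_mono\<close>)
qed

lemma sq_integrable_mult:
  assumes c: "bdd_borel c" and f: "sq_integrable f"
  shows "sq_integrable (\<lambda>x. complex_of_real (c x) * f x)"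
proof -
  obtain K where K: "0 < K" "\<And>x. \<bar>c x\<bar> \<le> K" using bdd_borel_bound[OF c] by blast
  have [measurable]: "c \<in> borel_measurable borel" "f \<in> borel_measurable borel"
    using c f by (auto simp: bdd_borel_def sq_integrable_def)
  have "integrable lborel (\<lambda>x. (cmod (complex_of_real (c x) * f x))\<^sup>2)"
  proof (rule Bochner_Integration.integrable_bound)
    show "integrable lborel (\<lambda>x. (K * cmod (f x))\<^sup>2)"
      using f by (simp add: power_mult_distrib sq_integrable_def)
    show "AE x in lborel. norm ((cmod (complex_of_real (c x) * f x))\<^sup>2) \<le> norm ((K * cmod (f x))\<^sup>2)"
      using K by (intro AE_I2) (auto simp: norm_mult intro!: power_mono mult_right_mono)
  qed measurable
  then show ?thesis by (simp add: sq_integrable_def)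
qed

definition mulop :: "('a::euclidean_space \<Rightarrow> real) \<Rightarrow> 'a L2 \<Rightarrow> 'a L2" where
  "mulop c f = abs_L2 (\<lambda>x. complex_of_real (c x) * rep_L2 f x)"

lemma rep_mulop:
  "bdd_borel c \<Longrightarrow> AE x in lborel. rep_L2 (mulop c f) x = complex_of_real (c x) * rep_L2 f x"
  unfolding mulop_def by (intro rep_abs_L2 sq_integrable_mult) auto

lemma adjoint_pair_mulop:
  assumes c: "bdd_borel c" shows "adjoint_pair (mulop c) (mulop c)"
  unfolding adjoint_pair_def
proof (intro allI)
  fix f g :: "'a L2"
  show "cinner (mulop c f) g = cinner f (mulop c g)"
    unfolding cinner_rep
  proof (rule integral_cong_AE)
    show "AE x in lborel. cnj (rep_L2 (mulop c f) x) * rep_L2 g x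
        = cnj (rep_L2 f x) * rep_L2 (mulop c g) x"
      using rep_mulop[OF c, of f] rep_mulop[OF c, of g] by eventually_elim simp
  qed measurable
qed

lemma mulop_mulop:
  assumes c: "bdd_borel c" and d: "bdd_borel d"
  shows "mulop c (mulop d f) = mulop (\<lambda>x. c x * d x) f"
  by (rule L2_eqI)
    (use rep_mulop[OF c, of "mulop d f"] rep_mulop[OF d, of f] rep_mulop[OF bdd_borel_mult[OF c d], of f]
      in \<open>eventually_elim, simp\<close>)

lemma bounded_op_mulop:
  assumes c: "bdd_borel c" shows "bounded_op (mulop c :: 'a::euclidean_space L2 \<Rightarrow> 'a L2)"
proof -
  obtain K where K: "0 < K" "\<And>x. \<bar>c x\<bar> \<le> K" using bdd_borel_bound[OF c] by blast
  show ?thesis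
  proof (rule bounded_opI)
    fix f g :: "'a L2" and r :: complex
    show "mulop c (f + g) = mulop c f + mulop c g"
      by (rule L2_eqI) (use rep_mulop[OF c, of f] rep_mulop[OF c, of g] rep_mulop[OF c, of "f + g"]
          rep_plus[of f g] rep_plus[of "mulop c f" "mulop c g"]
          in \<open>eventually_elim, simp add: ring_distribs\<close>)
    show "mulop c (cscale r f) = cscale r (mulop c f)"
      by (rule L2_eqI) (use rep_mulop[OF c, of f] rep_mulop[OF c, of "cscale r f"]
          rep_cscale[of r f] rep_cscale[of r "mulop c f"] in \<open>eventually_elim, simp\<close>)
    have "(norm (mulop c f))\<^sup>2 \<le> (\<integral>x. (K * cmod (rep_L2 f x))\<^sup>2 \<partial>lborel)"
      unfolding norm_sq_L2
    proof (rule integral_mono_AE[OF integrable_rep_square])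
      show "integrable lborel (\<lambda>x. (K * cmod (rep_L2 f x))\<^sup>2)"
        by (simp add: power_mult_distrib integrable_rep_square)
      show "AE x in lborel. (cmod (rep_L2 (mulop c f) x))\<^sup>2 \<le> (K * cmod (rep_L2 f x))\<^sup>2"
        using rep_mulop[OF c, of f]
        by eventually_elim (use K in \<open>auto simp: norm_mult intro!: power_mono mult_right_mono\<close>)
    qed
    also have "\<dots> = (K * norm f)\<^sup>2"
      by (simp add: power_mult_distrib norm_sq_L2)
    finally show "norm (mulop c f) \<le> K * norm f"
      by (rule power2_le_imp_le) (use K in simp)
  qed
qed

subsection \<open>The diagonal of a nuclear representation\<close>

abbreviation pair_term ::
  "(nat \<Rightarrow> 'a::euclidean_space L2) \<Rightarrow> (nat \<Rightarrow> 'a L2) \<Rightarrow> nat \<Rightarrow> 'a \<Rightarrow> complex" where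
  "pair_term f g k x \<equiv> rep_L2 (f k) x * cnj (rep_L2 (g k) x)"

text \<open>The diagonal of the kernel \<open>\<Sum>k. f k x * cnj (g k y)\<close>. It is a function in \<open>L\<^sup>1\<close>, and its
  integral against a bounded \<open>c\<close> is the trace of multiplication by \<open>c\<close> composed with the operator.\<close>

definition pair_density ::
  "(nat \<Rightarrow> 'a::euclidean_space L2) \<Rightarrow> (nat \<Rightarrow> 'a L2) \<Rightarrow> 'a \<Rightarrow> complex" where
  "pair_density f g x = (\<Sum>k. pair_term f g k x)"

context
  fixes f g :: "nat \<Rightarrow> 'a::euclidean_space L2"
  assumes fg: "summable (\<lambda>k. norm (f k) * norm (g k))"
begin

lemma pair_term_integrable: "integrable lborel (\<lambda>x. pair_term f g k x)"
  using integrable_rep_mult[of "g k" "f k"] by (simp add: mult.commute)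

text \<open>The integral of a product of absolute values is itself an \<open>L\<^sup>2\<close> pairing, of the
  pointwise absolute values.\<close>

lemma pair_term_norm: "(\<integral>x. cmod (pair_term f g k x) \<partial>lborel) \<le> norm (f k) * norm (g k)"
proof -
  have sq: "sq_integrable (\<lambda>x. complex_of_real (cmod (rep_L2 h x)))" for h :: "'a L2"
    using integrable_rep_square[of h] by (simp add: sq_integrable_def)
  let ?F = "abs_L2 (\<lambda>x. complex_of_real (cmod (rep_L2 (f k) x)))"
  let ?G = "abs_L2 (\<lambda>x. complex_of_real (cmod (rep_L2 (g k) x)))"
  have n: "norm (abs_L2 (\<lambda>x. complex_of_real (cmod (rep_L2 h x)))) = norm h" for h :: "'a L2"
  proof -
    have "(norm (abs_L2 (\<lambda>x. complex_of_real (cmod (rep_L2 h x)))))\<^sup>2 = (norm h)\<^sup>2"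
      unfolding norm_sq_abs[OF sq] norm_sq_L2[of h] by simp
    then show ?thesis by (simp add: power2_eq_iff_nonneg)
  qed
  have "cinner ?G ?F = complex_of_real (\<integral>x. cmod (pair_term f g k x) \<partial>lborel)"
    unfolding cinner_abs[OF sq sq] by (simp add: norm_mult mult.commute flip: of_real_mult)
  then show ?thesis using cinner_Cauchy_Schwarz[of ?G ?F] by (simp add: n mult.commute)
qed

lemma pair_density_abs_summable:
  "AE x in lborel. summable (\<lambda>k. cmod (pair_term f g k x))"
proof -
  have "(\<integral>\<^sup>+x. (\<Sum>k. ennreal (cmod (pair_term f g k x))) \<partial>lborel)
      = (\<Sum>k. \<integral>\<^sup>+x. ennreal (cmod (pair_term f g k x)) \<partial>lborel)"
    by (rule nn_integral_suminf) measurable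
  also have "\<dots> \<le> (\<Sum>k. ennreal (norm (f k) * norm (g k)))"
    by (intro suminf_le)
      (auto simp: nn_integral_eq_integral[OF integrable_norm[OF pair_term_integrable]]
        intro!: ennreal_leI pair_term_norm simp del: norm_mult)
  also have "\<dots> = ennreal (\<Sum>k. norm (f k) * norm (g k))"
    by (rule suminf_ennreal2) (use fg in auto)
  also have "\<dots> < \<infinity>" by simp
  finally have "AE x in lborel. (\<Sum>k. ennreal (cmod (pair_term f g k x))) \<noteq> \<infinity>"
    by (intro nn_integral_PInf_AE) auto
  then show ?thesis
    by eventually_elim (intro summable_suminf_not_top, auto simp: top_ennreal_def infinity_ennreal_def)
qed

lemma pair_density_sums:
  "AE x in lborel. (\<lambda>k. pair_term f g k x) sums pair_density f g x"
  using pair_density_abs_summable unfolding pair_density_def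
  by eventually_elim (rule summable_sums[OF summable_norm_cancel])

lemma measurable_pair_density [measurable]: "pair_density f g \<in> borel_measurable borel"
  unfolding pair_density_def by measurable

lemma pair_density_integral:
  assumes c: "bdd_borel c"
  shows "integrable lborel (\<lambda>x. complex_of_real (c x) * pair_density f g x)"
    and "(\<lambda>k. cinner (g k) (mulop c (f k))) sums (\<integral>x. complex_of_real (c x) * pair_density f g x \<partial>lborel)"
proof -
  let ?t = "\<lambda>k x. complex_of_real (c x) * (pair_term f g k x)"
  obtain K where K: "0 < K" "\<And>x. \<bar>c x\<bar> \<le> K" using bdd_borel_bound[OF c] by blast
  have [measurable]: "c \<in> borel_measurable borel" using c by (simp add: bdd_borel_def)
  have int: "integrable lborel (?t k)" for k
  proof (rule Bochner_Integration.integrable_bound)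
    show "integrable lborel (\<lambda>x. K * cmod (pair_term f g k x))"
      by (intro integrable_mult_right integrable_norm pair_term_integrable)
    show "AE x in lborel. norm (?t k x) \<le> norm (K * cmod (pair_term f g k x))"
      using K by (intro AE_I2) (auto simp: norm_mult abs_mult intro!: mult_right_mono)
  qed measurable
  have AEs: "AE x in lborel. summable (\<lambda>k. norm (?t k x))"
    using pair_density_abs_summable
    by eventually_elim (simp add: norm_mult[of "complex_of_real (c _)"] summable_mult del: norm_mult)
  have s: "summable (\<lambda>k. \<integral>x. norm (?t k x) \<partial>lborel)"
  proof (rule summable_comparison_test'[OF summable_mult[OF fg, of K], where N=0])
    fix k
    have "(\<integral>x. norm (?t k x) \<partial>lborel) \<le> (\<integral>x. K * cmod (pair_term f g k x) \<partial>lborel)"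
      by (intro integral_mono integrable_norm int integrable_mult_right pair_term_integrable)
        (use K in \<open>auto simp: norm_mult intro!: mult_right_mono\<close>)
    also have "\<dots> \<le> K * (norm (f k) * norm (g k))"
      using pair_term_norm[of k] K by simp
    finally show "norm (\<integral>x. norm (?t k x) \<partial>lborel) \<le> K * (norm (f k) * norm (g k))"
      by simp
  qed
  have ae: "AE x in lborel. (\<Sum>k. ?t k x) = complex_of_real (c x) * pair_density f g x"
    using pair_density_sums by eventually_elim (auto intro!: sums_unique[symmetric] sums_mult)
  have "integrable lborel (\<lambda>x. \<Sum>k. ?t k x)" by (rule integrable_suminf[OF int AEs s])
  then show "integrable lborel (\<lambda>x. complex_of_real (c x) * pair_density f g x)"
    by (rule integrable_cong_AE_imp) (use ae in \<open>auto elim: eventually_mono\<close>)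
  have "(\<lambda>k. integral\<^sup>L lborel (?t k)) sums (\<integral>x. (\<Sum>k. ?t k x) \<partial>lborel)"
    by (rule sums_integral[OF int AEs s])
  moreover have "(\<integral>x. (\<Sum>k. ?t k x) \<partial>lborel) = (\<integral>x. complex_of_real (c x) * pair_density f g x \<partial>lborel)"
    by (rule integral_cong_AE) (use ae in auto)
  moreover have "integral\<^sup>L lborel (?t k) = cinner (g k) (mulop c (f k))" for k
    unfolding cinner_rep
    by (rule integral_cong_AE) (use rep_mulop[OF c, of "f k"] in \<open>auto elim!: eventually_mono\<close>)
  ultimately show "(\<lambda>k. cinner (g k) (mulop c (f k))) sums (\<integral>x. complex_of_real (c x) * pair_density f g x \<partial>lborel)"
    by simp
qed

lemma integrable_pair_density: "integrable lborel (pair_density f g)"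
  using pair_density_integral(1)[OF bdd_borel_const[of 1]] by simp

end

subsection \<open>The density of a self-adjoint trace-class operator\<close>

text \<open>The integral of the diagonal over a Borel set \<open>A\<close> is the trace of \<open>mulop (indicator A) \<circ> T\<close>,
  which does not depend on the representation.\<close>

lemma pair_density_unique:
  fixes T :: "'a::euclidean_space op" and e :: "nat \<Rightarrow> 'a L2"
  assumes e: "onb e" and fg: "nuclear_rep T f g" and fg': "nuclear_rep T f' g'"
  shows "AE x in lborel. pair_density f g x = pair_density f' g' x"
proof (rule sigma_finite_measure.density_unique_banach[OF sigma_finite_lborel])
  have s: "summable (\<lambda>k. norm (f k) * norm (g k))" and s': "summable (\<lambda>k. norm (f' k) * norm (g' k))"
    using fg fg' by (auto simp: nuclear_rep_def)
  show "integrable lborel (pair_density f g)" "integrable lborel (pair_density f' g')"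
    using s s' by (auto intro: integrable_pair_density)
  fix A :: "'a set" assume "A \<in> sets lborel"
  then have c: "bdd_borel (indicator A)" by (simp add: bdd_borel_indicator)
  have tr: "(LINT x:A|lborel. pair_density u v x) = op_trace (\<lambda>h. mulop (indicator A) (T h))"
    if uv: "nuclear_rep T u v" for u v
  proof -
    have "nuclear_rep (\<lambda>h. mulop (indicator A) (T h)) (\<lambda>k. mulop (indicator A) (u k)) v"
      using nuclear_rep_conjugate[OF uv bounded_op_mulop[OF c], of "\<lambda>f. f" "\<lambda>f. f"]
      by (simp add: adjoint_pair_def bounded_op_id)
    then have "op_trace (\<lambda>h. mulop (indicator A) (T h)) = (\<Sum>k. cinner (v k) (mulop (indicator A) (u k)))"
      by (rule op_trace_onb[OF e])
    also have "\<dots> = (\<integral>x. complex_of_real (indicator A x) * pair_density u v x \<partial>lborel)"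
      using uv by (intro sums_unique[symmetric] pair_density_integral c) (simp add: nuclear_rep_def)
    finally show ?thesis by (simp add: set_lebesgue_integral_def scaleR_conv_of_real)
  qed
  show "(LINT x:A|lborel. pair_density f g x) = (LINT x:A|lborel. pair_density f' g' x)"
    by (simp add: tr[OF fg] tr[OF fg'])
qed

text \<open>Exchanging \<open>f\<close> and \<open>g\<close> represents the adjoint and conjugates the diagonal.\<close>

lemma pair_density_real:
  fixes T :: "'a::euclidean_space op" and e :: "nat \<Rightarrow> 'a L2"
  assumes e: "onb e" and fg: "nuclear_rep T f g" and T: "adjoint_pair T T"
  shows "AE x in lborel. complex_of_real (Re (pair_density f g x)) = pair_density f g x"
proof -
  have s: "summable (\<lambda>k. norm (f k) * norm (g k))" using fg by (auto simp: nuclear_rep_def)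
  have "AE x in lborel. pair_density g f x = cnj (pair_density f g x)"
    using pair_density_sums[OF s]
  proof eventually_elim
    case (elim x)
    then have "(\<lambda>k. cnj (pair_term f g k x)) sums cnj (pair_density f g x)"
      by (simp only: sums_cnj)
    then show ?case unfolding pair_density_def by (simp add: sums_iff mult.commute)
  qed
  moreover have "AE x in lborel. pair_density f g x = pair_density g f x"
    by (rule pair_density_unique[OF e fg nuclear_rep_adjoint[OF fg T]])
  ultimately show ?thesis by eventually_elim (metis Reals_cnj_iff of_real_Re)
qed

text \<open>The real part of any diagonal meets the requirements of \<^const>\<open>density\<close>, so the chosen
  function meets them too and, by uniqueness, is that diagonal.\<close>

lemma density_eq_pair_density:
  fixes T :: "'a::euclidean_space op" and e :: "nat \<Rightarrow> 'a L2"
  assumes e: "onb e" and fg: "nuclear_rep T f g" and T: "adjoint_pair T T"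
  shows "density T \<in> borel_measurable borel"
    and "AE x in lborel. complex_of_real (density T x) = pair_density f g x"
proof -
  let ?P = "\<lambda>\<rho>. \<rho> \<in> borel_measurable borel \<and>
     (\<exists>f g. nuclear_rep T f g \<and>
       (AE x in lborel.
         (\<lambda>k. pair_term f g k x) sums complex_of_real (\<rho> x)))"
  have s: "summable (\<lambda>k. norm (f k) * norm (g k))" using fg by (auto simp: nuclear_rep_def)
  have "?P (\<lambda>x. Re (pair_density f g x))"
  proof (rule conjI)
    show "(\<lambda>x. Re (pair_density f g x)) \<in> borel_measurable borel"
      using measurable_pair_density[OF s] by measurable
    have "AE x in lborel. (\<lambda>k. pair_term f g k x) sums
        complex_of_real (Re (pair_density f g x))"
      using pair_density_sums[OF s] pair_density_real[OF e fg T] by eventually_elim simp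
    with fg show "\<exists>f' g'. nuclear_rep T f' g' \<and>
       (AE x in lborel. (\<lambda>k. pair_term f' g' k x) sums
         complex_of_real (Re (pair_density f g x)))"
      by blast
  qed
  then have P: "?P (density T)" unfolding density_def by (rule someI[of ?P])
  then show "density T \<in> borel_measurable borel" by blast
  from P obtain f' g' where fg': "nuclear_rep T f' g'"
    and d: "AE x in lborel. (\<lambda>k. pair_term f' g' k x) sums complex_of_real (density T x)"
    by blast
  show "AE x in lborel. complex_of_real (density T x) = pair_density f g x"
    using d pair_density_unique[OF e fg fg']
    by eventually_elim (simp add: pair_density_def sums_iff)
qed

section \<open>Dilations\<close>

lemma AE_lborel_scale:
  fixes a :: real
  assumes a: "a \<noteq> 0" and P: "AE x in (lborel :: 'a::euclidean_space measure). P x"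
  shows "AE x in lborel. P (a *\<^sub>R x)"
proof -
  let ?D = "distr lborel borel (\<lambda>x::'a. 0 + a *\<^sub>R x)"
  have "AE x in Nonnegative_Lebesgue_Integration.density ?D (\<lambda>_. ennreal (\<bar>a\<bar> ^ DIM('a))). P x"
    unfolding lborel_affine[OF a, of "0::'a", symmetric] by (rule P)
  then have "AE x in ?D. P x"
    using a by (subst (asm) AE_density) auto
  then show ?thesis by (auto dest: AE_distrD[rotated])
qed

lemma nn_integral_lborel_scale:
  fixes f :: "'a::euclidean_space \<Rightarrow> ennreal"
  assumes a: "a \<noteq> 0" and f: "f \<in> borel_measurable borel"
  shows "(\<integral>\<^sup>+x. f (a *\<^sub>R x) \<partial>lborel) = ennreal (inverse (\<bar>a\<bar> ^ DIM('a))) * (\<integral>\<^sup>+x. f x \<partial>lborel)"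
proof -
  have "(\<integral>\<^sup>+x. f x \<partial>lborel) = ennreal (\<bar>a\<bar> ^ DIM('a)) * (\<integral>\<^sup>+x. f (a *\<^sub>R x) \<partial>lborel)"
    using f by (subst lborel_affine[OF a, of 0]) (simp add: nn_integral_density nn_integral_distr nn_integral_cmult ennreal_power)
  then show ?thesis
    using a by (simp add: mult.assoc[symmetric] ennreal_mult[symmetric])
qed

lemma integrable_lborel_scale_iff:
  fixes f :: "'a::euclidean_space \<Rightarrow> 'b::{banach, second_countable_topology}"
  assumes a: "a \<noteq> 0" and f: "f \<in> borel_measurable borel"
  shows "integrable lborel (\<lambda>x. f (a *\<^sub>R x)) \<longleftrightarrow> integrable lborel f"
proof -
  have "(\<integral>\<^sup>+x. ennreal (norm (f (a *\<^sub>R x))) \<partial>lborel)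
      = ennreal (inverse (\<bar>a\<bar> ^ DIM('a))) * (\<integral>\<^sup>+x. ennreal (norm (f x)) \<partial>lborel)"
    by (rule nn_integral_lborel_scale[OF a]) (use f in measurable)
  then show ?thesis
    using f a by (auto simp: integrable_iff_bounded ennreal_mult_less_top top_unique less_top[symmetric] ennreal_mult_eq_top_iff)
qed

lemma integral_lborel_scale:
  fixes f :: "'a::euclidean_space \<Rightarrow> 'b::{banach, second_countable_topology}"
  assumes a: "a \<noteq> 0" and f: "f \<in> borel_measurable borel"
  shows "(\<integral>x. f (a *\<^sub>R x) \<partial>lborel) = (\<integral>x. f x \<partial>lborel) /\<^sub>R \<bar>a\<bar> ^ DIM('a)"
proof -
  have "(\<integral>x. f x \<partial>lborel) = \<bar>a\<bar> ^ DIM('a) *\<^sub>R (\<integral>x. f (a *\<^sub>R x) \<partial>lborel)"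
    using f by (subst lborel_affine[OF a, of 0])
      (simp add: integral_density integral_distr ennreal_power)
  then show ?thesis using a by simp
qed

definition dil :: "real \<Rightarrow> 'a::euclidean_space op" where
  "dil a f = abs_L2 (\<lambda>x. complex_of_real (a powr (real DIM('a) / 2)) * rep_L2 f (a *\<^sub>R x))"

lemma powr_half_dim_square:
  "0 < a \<Longrightarrow> (a powr (real DIM('a::euclidean_space) / 2))\<^sup>2 = a ^ DIM('a)"
  by (simp add: power2_eq_square powr_realpow[symmetric] flip: powr_add)

context
  fixes a :: real assumes a: "0 < a"
begin

lemma AE_dil: "AE x in (lborel :: 'a::euclidean_space measure). P x \<Longrightarrow> AE x in lborel. P (a *\<^sub>R x)"
  using a by (intro AE_lborel_scale) auto

lemma sq_integrable_dil:
  fixes f :: "'a::euclidean_space \<Rightarrow> complex"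
  assumes "sq_integrable f"
  shows "sq_integrable (\<lambda>x. complex_of_real (a powr (real DIM('a) / 2)) * f (a *\<^sub>R x))"
proof (rule sq_integrable_scale)
  have [measurable]: "f \<in> borel_measurable borel" using assms by (simp add: sq_integrable_def)
  show "sq_integrable (\<lambda>x. f (a *\<^sub>R x))"
    using assms a integrable_lborel_scale_iff[of a "\<lambda>x. (cmod (f x))\<^sup>2"]
    by (simp add: sq_integrable_def)
qed

lemma rep_dil:
  "AE x in lborel. rep_L2 (dil a f) x
    = complex_of_real (a powr (real DIM('a) / 2)) * rep_L2 (f :: 'a::euclidean_space L2) (a *\<^sub>R x)"
  unfolding dil_def by (rule rep_abs_L2[OF sq_integrable_dil]) simp

lemma cinner_dil: "cinner (dil a f) (dil a g) = cinner f (g :: 'a::euclidean_space L2)"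
proof -
  have "cinner (dil a f) (dil a g)
      = (\<integral>x. of_real (a ^ DIM('a)) * (cnj (rep_L2 f (a *\<^sub>R x)) * rep_L2 g (a *\<^sub>R x)) \<partial>lborel)"
    unfolding cinner_rep
  proof (rule integral_cong_AE)
    show "AE x in lborel. cnj (rep_L2 (dil a f) x) * rep_L2 (dil a g) x
        = of_real (a ^ DIM('a)) * (cnj (rep_L2 f (a *\<^sub>R x)) * rep_L2 g (a *\<^sub>R x))"
      using rep_dil[of f] rep_dil[of g]
      by eventually_elim
        (simp add: powr_half_dim_square[OF a, where 'a='a, symmetric] power2_eq_square)
  qed measurable
  also have "\<dots> = cinner f g"
    using a integral_lborel_scale[of a "\<lambda>x. cnj (rep_L2 f x) * rep_L2 g x"]
    by (simp add: cinner_rep scaleR_conv_of_real)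
  finally show ?thesis .
qed

lemma norm_dil [simp]: "norm (dil a f) = norm f"
  by (rule norm_eq_of_cinner, unfold cinner_dil) (simp_all add: cinner_self)

lemma dil_add: "dil a (f + g) = dil a f + dil a g"
  by (rule L2_eqI) (use rep_dil[of f] rep_dil[of g] rep_dil[of "f + g"]
    AE_dil[OF rep_plus[of f g]] rep_plus[of "dil a f" "dil a g"]
    in \<open>eventually_elim, simp add: ring_distribs\<close>)

lemma dil_cscale: "dil a (cscale c f) = cscale c (dil a f)"
  by (rule L2_eqI) (use rep_dil[of f] rep_dil[of "cscale c f"]
    AE_dil[OF rep_cscale[of c f]] rep_cscale[of c "dil a f"]
    in \<open>eventually_elim, simp\<close>)

lemma cnj_L2_dil: "cnj_L2 (dil a f) = dil a (cnj_L2 f)"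
  by (rule L2_eqI) (use rep_dil[of f] rep_dil[of "cnj_L2 f"]
    AE_dil[OF rep_cnj[of f]] rep_cnj[of "dil a f"]
    in \<open>eventually_elim, simp\<close>)

lemma bounded_op_dil: "bounded_op (dil a)"
  by (rule bounded_opI[where K = 1]) (auto simp: dil_add dil_cscale)

end

lemma dil_dil:
  assumes a: "0 < a" and b: "0 < b" shows "dil a (dil b f) = dil (b * a) f"
proof (rule L2_eqI)
  show "AE x in lborel. rep_L2 (dil a (dil b f)) x = rep_L2 (dil (b * a) f) x"
    using rep_dil[OF a, of "dil b f"] AE_dil[OF a rep_dil[OF b, of f]] rep_dil[OF mult_pos_pos[OF b a], of f]
    by eventually_elim (use a b in \<open>simp add: powr_mult mult_ac\<close>)
qed

lemma dil_one: "dil 1 f = f"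
  by (simp add: dil_def)

lemma dil_inverse [simp]:
  "0 < a \<Longrightarrow> dil a (dil (inverse a) f) = f" "0 < a \<Longrightarrow> dil (inverse a) (dil a f) = f"
  by (simp_all add: dil_dil dil_one)

lemma adjoint_pair_dil: "0 < a \<Longrightarrow> adjoint_pair (dil a) (dil (inverse a))"
  unfolding adjoint_pair_def using cinner_dil dil_inverse(1) by metis

lemma onb_dil:
  assumes a: "0 < a" and e: "onb e" shows "onb (\<lambda>k. dil a (e k))"
  unfolding onb_def
proof (intro conjI allI impI)
  show "cinner (dil a (e j)) (dil a (e k)) = (if j = k then 1 else 0)" for j k
    by (simp add: cinner_dil[OF a] onb_orthonormal[OF e])
  fix f assume z: "\<forall>k. cinner (dil a (e k)) f = 0"
  have "cinner (e k) (dil (inverse a) f) = 0" for k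
    using z adjoint_pair_dil[OF a] unfolding adjoint_pair_def by metis
  then have "dil (inverse a) f = 0" using e unfolding onb_def by blast
  then have "norm f = 0" using a norm_dil[of "inverse a" f] by simp
  then show "f = 0" by simp
qed

section \<open>The Fourier transform\<close>

subsection \<open>Gaussian integrals\<close>

lemma measurable_cis [measurable (raw)]:
  "f \<in> borel_measurable M \<Longrightarrow> (\<lambda>x. cis (f x)) \<in> borel_measurable M"
  by (rule borel_measurable_continuous_on[of cis]) (auto simp: cis_conv_exp intro!: continuous_intros)

lemma integral_lborel_prod:
  fixes \<phi> :: "'a::euclidean_space \<Rightarrow> real \<Rightarrow> complex"
  assumes int: "\<And>b. b \<in> Basis \<Longrightarrow> integrable lborel (\<phi> b)"
  shows "integrable lborel (\<lambda>x. \<Prod>b\<in>Basis. \<phi> b (x \<bullet> b))"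
    and "(\<integral>x. (\<Prod>b\<in>Basis. \<phi> b (x \<bullet> b)) \<partial>lborel) = (\<Prod>b\<in>Basis. integral\<^sup>L lborel (\<phi> b))"
proof -
  interpret product_sigma_finite "\<lambda>_::'a. lborel :: real measure" by standard
  have [measurable]: "b \<in> Basis \<Longrightarrow> \<phi> b \<in> borel_measurable borel" for b
    using borel_measurable_integrable[OF int, of b] by simp
  let ?M = "\<Pi>\<^sub>M b\<in>(Basis :: 'a set). (lborel :: real measure)"
  let ?h = "\<lambda>f. \<Sum>b\<in>(Basis :: 'a set). f b *\<^sub>R b"
  have h: "?h \<in> ?M \<rightarrow>\<^sub>M borel" by measurable
  have F: "(\<lambda>x. \<Prod>b\<in>Basis. \<phi> b (x \<bullet> b)) \<in> borel_measurable borel" by measurable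
  have eq: "(\<Prod>b\<in>Basis. \<phi> b (?h f \<bullet> b)) = (\<Prod>b\<in>Basis. \<phi> b (f b))" for f
    by (intro prod.cong refl) simp
  have "integrable ?M (\<lambda>f. \<Prod>b\<in>Basis. \<phi> b (f b))"
    by (rule product_integrable_prod) (auto intro: int)
  then show "integrable lborel (\<lambda>x. \<Prod>b\<in>Basis. \<phi> b (x \<bullet> b))"
    unfolding lborel_eq[where 'a='a] integrable_distr_eq[OF h F] eq .
  show "(\<integral>x. (\<Prod>b\<in>Basis. \<phi> b (x \<bullet> b)) \<partial>lborel) = (\<Prod>b\<in>Basis. integral\<^sup>L lborel (\<phi> b))"
    unfolding lborel_eq[where 'a='a] integral_distr[OF h F] eq
    by (rule product_integral_prod) (auto intro: int)
qed

lemma gaussian_fourier_real: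
  shows "integrable lborel (\<lambda>x::real. cis (x * t) * of_real (exp (- x\<^sup>2 / 2)))"
    and "(\<integral>x. cis (x * t) * of_real (exp (- x\<^sup>2 / 2)) \<partial>lborel)
      = complex_of_real (sqrt (2 * pi) * exp (- t\<^sup>2 / 2))"
proof -
  have d: "std_normal_density x = exp (- x\<^sup>2 / 2) / sqrt (2 * pi)" for x
    by (simp add: std_normal_density_def)
  have "integrable lborel (\<lambda>x. sqrt (2 * pi) * std_normal_density x)"
    by (intro integrable_mult_right integrable_normal_density) simp
  then have g: "integrable lborel (\<lambda>x::real. exp (- x\<^sup>2 / 2))" by (simp add: d)
  show "integrable lborel (\<lambda>x::real. cis (x * t) * of_real (exp (- x\<^sup>2 / 2)))"
    by (rule Bochner_Integration.integrable_bound[OF g]) (auto simp: norm_mult)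
  have "complex_of_real (exp (- (t^2) / 2)) = (CLINT x|std_normal_distribution. iexp (t * x))"
    using fun_cong[OF char_std_normal_distribution, of t] by (simp add: char_def)
  also have "\<dots> = (\<integral>x. std_normal_density x *\<^sub>R iexp (t * x) \<partial>lborel)"
    by (rule integral_density) auto
  also have "\<dots> = (\<integral>x. (cis (x * t) * of_real (exp (- x\<^sup>2 / 2))) / of_real (sqrt (2 * pi)) \<partial>lborel)"
    by (intro Bochner_Integration.integral_cong refl)
      (simp add: d cis_conv_exp scaleR_conv_of_real mult_ac)
  also have "\<dots> = (\<integral>x. cis (x * t) * of_real (exp (- x\<^sup>2 / 2)) \<partial>lborel) / of_real (sqrt (2 * pi))"
    by (rule integral_divide_zero)
  finally show "(\<integral>x. cis (x * t) * of_real (exp (- x\<^sup>2 / 2)) \<partial>lborel)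
      = complex_of_real (sqrt (2 * pi) * exp (- t\<^sup>2 / 2))"
    by (simp add: field_simps flip: of_real_mult)
qed

definition gauss :: "'a::real_normed_vector \<Rightarrow> real" where
  "gauss z = exp (- (norm z)\<^sup>2 / 2)"

lemma gauss_simps [simp]: "0 \<le> gauss z" "gauss z \<le> 1" "gauss 0 = 1" "gauss (- z) = gauss z"
  by (simp_all add: gauss_def)

lemma measurable_gauss [measurable]: "gauss \<in> borel_measurable (borel :: 'a::euclidean_space measure)"
  unfolding gauss_def[abs_def] by measurable

text \<open>A Gaussian times a character is a product over the coordinates, which reduces its integral to
  the characteristic function of the normal distribution.\<close>

lemma gaussian_factor:
  fixes z p :: "'a::euclidean_space"
  shows "cis (p \<bullet> z) * of_real (gauss p)
    = (\<Prod>b\<in>Basis. cis ((p \<bullet> b) * (z \<bullet> b)) * of_real (exp (- (p \<bullet> b)\<^sup>2 / 2)))"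
proof -
  have "cis (p \<bullet> z) = (\<Prod>b\<in>Basis. cis ((p \<bullet> b) * (z \<bullet> b)))"
    unfolding cis_conv_exp euclidean_inner[of p z] by (simp add: sum_distrib_left exp_sum)
  moreover have "complex_of_real (gauss p) = (\<Prod>b\<in>Basis. of_real (exp (- (p \<bullet> b)\<^sup>2 / 2)))"
    unfolding gauss_def power2_norm_eq_inner euclidean_inner[of p p] of_real_prod[symmetric] exp_sum[OF finite_Basis, symmetric]
    by (simp add: sum_negf sum_divide_distrib power2_eq_square)
  ultimately show ?thesis by (simp add: prod.distrib)
qed

lemma gaussian_fourier:
  fixes z :: "'a::euclidean_space"
  shows "(\<integral>p. cis (p \<bullet> z) * of_real (gauss p) \<partial>lborel)
      = complex_of_real ((2 * pi) powr (real DIM('a) / 2) * gauss z)"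
proof -
  have "(\<integral>p. cis (p \<bullet> z) * of_real (gauss p) \<partial>lborel)
      = (\<Prod>b\<in>Basis. of_real (sqrt (2 * pi)) * complex_of_real (exp (- (z \<bullet> b)\<^sup>2 / 2)))"
    unfolding gaussian_factor
      integral_lborel_prod(2)[where \<phi> = "\<lambda>b x. cis (x * (z \<bullet> b)) * of_real (exp (- x\<^sup>2 / 2))",
        OF gaussian_fourier_real(1)]
    by (simp only: gaussian_fourier_real(2) of_real_mult)
  also have "\<dots> = of_real (sqrt (2 * pi) ^ DIM('a)) * (\<Prod>b\<in>Basis. complex_of_real (exp (- (z \<bullet> b)\<^sup>2 / 2)))"
    by (simp add: prod.distrib)
  also have "sqrt (2 * pi) ^ DIM('a) = (2 * pi) powr (real DIM('a) / 2)"
    by (simp add: powr_half_sqrt[symmetric] powr_powr flip: powr_realpow)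
  also have "(\<Prod>b\<in>Basis. complex_of_real (exp (- (z \<bullet> b)\<^sup>2 / 2))) = of_real (gauss z)"
    using gaussian_factor[of z 0] by simp
  finally show ?thesis by simp
qed

lemma gaussian_integrable: "integrable lborel (gauss :: 'a::euclidean_space \<Rightarrow> real)"
proof -
  have "integrable lborel (\<lambda>p::'a. cis (p \<bullet> 0) * of_real (gauss p))"
    unfolding gaussian_factor by (rule integral_lborel_prod(1)[OF gaussian_fourier_real(1)])
  then show ?thesis by (simp add: complex_of_real_integrable_eq)
qed

lemma gaussian_integral:
  "(\<integral>p. gauss p \<partial>(lborel :: 'a::euclidean_space measure)) = (2 * pi) powr (real DIM('a) / 2)"
proof -
  have "complex_of_real (\<integral>p. gauss (p::'a) \<partial>lborel)
      = (\<integral>p. cis (p \<bullet> 0) * of_real (gauss (p::'a)) \<partial>lborel)"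
    by simp
  also have "\<dots> = complex_of_real ((2 * pi) powr (real DIM('a) / 2))"
    unfolding gaussian_fourier by simp
  finally show ?thesis by (simp only: of_real_eq_iff)
qed

lemma gaussian_scaled_integrable:
  "0 < s \<Longrightarrow> integrable lborel (\<lambda>p::'a::euclidean_space. gauss (s *\<^sub>R p))"
  using gaussian_integrable[where 'a='a]
  by (subst integrable_lborel_scale_iff[of s "\<lambda>p. gauss p"]) auto

lemma gaussian_scaled_fourier:
  fixes z :: "'a::euclidean_space"
  assumes s: "0 < s"
  shows "(\<integral>p. cis (p \<bullet> z) * of_real (gauss (s *\<^sub>R p)) \<partial>lborel)
      = complex_of_real ((2 * pi) powr (real DIM('a) / 2) / s ^ DIM('a) * gauss (z /\<^sub>R s))"
proof -
  have "(\<integral>p. cis (p \<bullet> z) * of_real (gauss (s *\<^sub>R p)) \<partial>lborel)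
      = (\<integral>p. cis ((s *\<^sub>R p) \<bullet> (z /\<^sub>R s)) * of_real (gauss (s *\<^sub>R p)) \<partial>lborel)"
  proof -
    have "(s *\<^sub>R p) \<bullet> (z /\<^sub>R s) = p \<bullet> z" for p using s by simp
    then show ?thesis by (simp only:)
  qed
  also have "\<dots> = (\<integral>p. cis (p \<bullet> (z /\<^sub>R s)) * of_real (gauss p) \<partial>lborel) /\<^sub>R s ^ DIM('a)"
    using s by (subst integral_lborel_scale[of s "\<lambda>p. cis (p \<bullet> (z /\<^sub>R s)) * of_real (gauss p)"]) auto
  finally show ?thesis
    unfolding gaussian_fourier by (simp add: scaleR_conv_of_real field_simps)
qed

subsection \<open>The regularised Plancherel identity\<close>

lemma integrable_pair_mult:
  fixes u :: "'a::euclidean_space \<Rightarrow> complex" and v :: "'b::euclidean_space \<Rightarrow> complex"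
  assumes u: "integrable lborel u" and v: "integrable lborel v"
  shows "integrable (lborel :: ('a \<times> 'b) measure) (\<lambda>w. u (fst w) * v (snd w))"
    and "(\<integral>w. u (fst w) * v (snd w) \<partial>(lborel :: ('a \<times> 'b) measure)) = integral\<^sup>L lborel u * integral\<^sup>L lborel v"
proof -
  have [measurable]: "u \<in> borel_measurable borel" "v \<in> borel_measurable borel"
    using u v by (auto dest: borel_measurable_integrable)
  have i: "integrable (lborel \<Otimes>\<^sub>M lborel) (\<lambda>w. u (fst w) * v (snd w))"
  proof (rule lborel_pair.Fubini_integrable)
    show "integrable lborel (\<lambda>x. \<integral>y. norm (u (fst (x, y)) * v (snd (x, y))) \<partial>lborel)"
      using u by (simp add: norm_mult)
    show "AE x in lborel. integrable lborel (\<lambda>y. u (fst (x, y)) * v (snd (x, y)))"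
      using v by simp
  qed measurable
  then show "integrable (lborel :: ('a \<times> 'b) measure) (\<lambda>w. u (fst w) * v (snd w))"
    by (simp add: lborel_prod)
  have "(\<integral>w. u (fst w) * v (snd w) \<partial>(lborel \<Otimes>\<^sub>M lborel)) = (\<integral>x. \<integral>y. u x * v y \<partial>lborel \<partial>lborel)"
    using lborel_pair.integral_fst'[OF i] by simp
  then show "(\<integral>w. u (fst w) * v (snd w) \<partial>(lborel :: ('a \<times> 'b) measure)) = integral\<^sup>L lborel u * integral\<^sup>L lborel v"
    by (simp add: lborel_prod)
qed

text \<open>The integral that \<^const>\<open>fourier\<close> takes on integrable functions.\<close>

definition ft :: "('a::euclidean_space \<Rightarrow> complex) \<Rightarrow> 'a \<Rightarrow> complex" where
  "ft f p = complex_of_real ((2 * pi) powr (- real DIM('a) / 2)) * (\<integral>x. cis (- (p \<bullet> x)) * f x \<partial>lborel)"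

lemma measurable_ft [measurable (raw)]:
  assumes [measurable]: "f \<in> borel_measurable borel"
  shows "ft f \<in> borel_measurable borel"
  unfolding ft_def by measurable

lemma integrable_cis_mult: 
  assumes "integrable lborel (f :: 'a::euclidean_space \<Rightarrow> complex)"
  shows "integrable lborel (\<lambda>x. cis (p \<bullet> x) * f x)" "integrable lborel (\<lambda>x. cis (- (p \<bullet> x)) * f x)"
  using assms borel_measurable_integrable[OF assms]
  by (auto intro!: Bochner_Integration.integrable_bound[OF assms] simp: norm_mult)

text \<open>Inserting a Gaussian makes the triple integral over \<open>p\<close>, \<open>x\<close>, \<open>y\<close> absolutely convergent;
  the \<open>p\<close>-integral is then an explicit approximate identity in \<open>x - y\<close>.\<close>

lemma regularised_Plancherel:
  fixes f g :: "'a::euclidean_space \<Rightarrow> complex"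
  assumes f: "integrable lborel f" and g: "integrable lborel g" and s: "0 < s"
  shows "(\<integral>p. cnj (ft f p) * ft g p * of_real (gauss (s *\<^sub>R p)) \<partial>lborel)
      = of_real ((2 * pi) powr (- real DIM('a) / 2)) *
        (\<integral>x. cnj (f x) * (\<integral>z. g (x + s *\<^sub>R z) * of_real (gauss z) \<partial>lborel) \<partial>lborel)"
    (is "?L = ?R")
proof -
  let ?c = "(2 * pi) powr (- real DIM('a) / 2)"
  let ?g = "\<lambda>p::'a. complex_of_real (gauss (s *\<^sub>R p))"
  let ?W = "\<lambda>w::'a \<times> 'a. cnj (f (fst w)) * g (snd w)"
  let ?e = "\<lambda>p w. cis (p \<bullet> (fst w - snd w))" and ?h = "\<lambda>w. of_real (gauss ((fst w - snd w :: 'a) /\<^sub>R s))"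
    and ?J = "\<lambda>x. \<integral>z. g (x + s *\<^sub>R z) * of_real (gauss z) \<partial>lborel"
  have [measurable]: "f \<in> borel_measurable borel" "g \<in> borel_measurable borel"
    using f g by (auto dest: borel_measurable_integrable)
  have cf: "integrable lborel (\<lambda>x. cnj (f x))" using f by simp
  have W: "integrable lborel ?W" by (rule integrable_pair_mult(1)[OF cf g])
  have gi: "integrable lborel ?g"
    using gaussian_scaled_integrable[OF s] by (simp add: complex_of_real_integrable_eq)
  have prod: "cnj (ft f p) * ft g p = of_real (?c * ?c) * (\<integral>w. ?e p w * ?W w \<partial>lborel)" for p
  proof -
    have "(\<integral>w. ?e p w * ?W w \<partial>lborel)
        = (\<integral>w. (cis (p \<bullet> fst w) * cnj (f (fst w))) * (cis (- (p \<bullet> snd w)) * g (snd w)) \<partial>lborel)"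
    proof -
      have "cis (p \<bullet> (x - y)) = cis (p \<bullet> x) * cis (- (p \<bullet> y))" for x y
        by (simp add: cis_mult inner_diff_right)
      then show ?thesis by (simp only: mult_ac)
    qed
    also have "\<dots> = (\<integral>x. cis (p \<bullet> x) * cnj (f x) \<partial>lborel) * (\<integral>y. cis (- (p \<bullet> y)) * g y \<partial>lborel)"
      by (rule integrable_pair_mult(2)[OF integrable_cis_mult(1)[OF cf] integrable_cis_mult(2)[OF g]])
    also have "(\<integral>x. cis (p \<bullet> x) * cnj (f x) \<partial>lborel) = cnj (\<integral>x. cis (- (p \<bullet> x)) * f x \<partial>lborel)"
      by (subst Bochner_Integration.integral_cnj[symmetric]) (simp add: cis_cnj)
    finally show ?thesis by (simp add: ft_def)
  qed
  have iH: "integrable (lborel \<Otimes>\<^sub>M (lborel :: ('a \<times> 'a) measure)) (\<lambda>(p, w). ?e p w * ?W w * ?g p)"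
  proof (rule Bochner_Integration.integrable_bound)
    show "integrable (lborel \<Otimes>\<^sub>M (lborel :: ('a \<times> 'a) measure)) (\<lambda>v. ?g (fst v) * ?W (snd v))"
      using integrable_pair_mult(1)[OF gi W] by (simp add: lborel_prod)
    have [measurable]: "(\<lambda>v. fst (snd v)) \<in> borel_measurable (lborel \<Otimes>\<^sub>M (lborel :: ('a \<times> 'a) measure))"
      "(\<lambda>v. snd (snd v)) \<in> borel_measurable (lborel \<Otimes>\<^sub>M (lborel :: ('a \<times> 'a) measure))"
      by (rule measurable_compose[OF measurable_snd],
          simp add: borel_measurable_continuous_onI continuous_on_fst continuous_on_snd)+
    show "(\<lambda>(p, w). ?e p w * ?W w * ?g p)
        \<in> borel_measurable (lborel \<Otimes>\<^sub>M (lborel :: ('a \<times> 'a) measure))"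
      unfolding case_prod_unfold by measurable
  qed (auto simp: norm_mult case_prod_unfold)
  have "?L = of_real (?c * ?c) * (\<integral>p. (\<integral>w. ?e p w * ?W w * ?g p \<partial>lborel) \<partial>lborel)"
    by (simp only: prod mult.assoc[of "complex_of_real (?c * ?c)"] integral_mult_left_zero
        integral_mult_right_zero)
  also have "(\<integral>p. (\<integral>w. ?e p w * ?W w * ?g p \<partial>lborel) \<partial>lborel)
      = (\<integral>w. (\<integral>p. ?e p w * ?W w * ?g p \<partial>lborel) \<partial>lborel)"
    by (rule lborel_pair.Fubini_integral[OF iH, symmetric])
  also have "\<dots> = (\<integral>w. ?W w * (\<integral>p. ?e p w * ?g p \<partial>lborel) \<partial>lborel)"
    by (intro Bochner_Integration.integral_cong refl)
      (simp add: mult_ac flip: integral_mult_right_zero)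
  also have "\<dots> = (\<integral>w. of_real ((2 * pi) powr (real DIM('a) / 2) / s ^ DIM('a))
      * (?W w * ?h w) \<partial>lborel)"
    unfolding gaussian_scaled_fourier[OF s] by (simp add: mult_ac)
  also have "\<dots> = of_real ((2 * pi) powr (real DIM('a) / 2) / s ^ DIM('a))
      * (\<integral>w. ?W w * ?h w \<partial>lborel)"
    by (rule integral_mult_right_zero)
  also have "(\<integral>w. ?W w * ?h w \<partial>lborel)
      = (\<integral>x. (\<integral>y. cnj (f x) * g y * of_real (gauss ((x - y) /\<^sub>R s)) \<partial>lborel) \<partial>lborel)"
  proof -
    have "integrable (lborel :: ('a \<times> 'a) measure) (\<lambda>w. ?W w * ?h w)"
    proof (rule Bochner_Integration.integrable_bound[OF W])
      have "(\<lambda>w::'a \<times> 'a. ?W w * ?h w)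
          \<in> borel_measurable (borel \<Otimes>\<^sub>M borel)" by measurable
      then show "(\<lambda>w::'a \<times> 'a. ?W w * ?h w)
          \<in> borel_measurable lborel" by (simp add: borel_prod)
    qed (auto simp: norm_mult intro!: mult_left_le AE_I2)
    then have "integrable (lborel \<Otimes>\<^sub>M lborel) (\<lambda>w. ?W w * ?h w)"
      by (simp add: lborel_prod)
    from lborel_pair.integral_fst'[OF this] show ?thesis by (simp add: lborel_prod)
  qed
  also have "\<dots> = (\<integral>x. of_real (s ^ DIM('a)) * (cnj (f x) * ?J x) \<partial>lborel)"
  proof (intro Bochner_Integration.integral_cong refl)
    fix x
    have cancel: "inverse s * (s * t) = t" for t :: real using s by simp
    have "(\<integral>y. cnj (f x) * g y * of_real (gauss ((x - y) /\<^sub>R s)) \<partial>lborel)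
        = s ^ DIM('a) *\<^sub>R (\<integral>z. cnj (f x) * g (x + s *\<^sub>R z) * of_real (gauss z) \<partial>lborel)"
      using s by (subst lborel_affine[of s x]) (simp_all add: integral_density integral_distr ennreal_power cancel)
    then show "(\<integral>y. cnj (f x) * g y * of_real (gauss ((x - y) /\<^sub>R s)) \<partial>lborel)
        = of_real (s ^ DIM('a)) * (cnj (f x) * ?J x)"
      by (simp add: mult.assoc scaleR_conv_of_real)
  qed
  also have "\<dots> = of_real (s ^ DIM('a)) * (\<integral>x. cnj (f x) * ?J x \<partial>lborel)"
    by (rule integral_mult_right_zero)
  finally have "?L = of_real (?c * ?c * ((2 * pi) powr (real DIM('a) / 2) / s ^ DIM('a)) * s ^ DIM('a))
      * (\<integral>x. cnj (f x) * ?J x \<partial>lborel)"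
    by (simp add: mult_ac)
  also have "?c * ?c * ((2 * pi) powr (real DIM('a) / 2) / s ^ DIM('a)) * s ^ DIM('a)
      = ?c * (?c * (2 * pi) powr (real DIM('a) / 2))"
    using s by simp
  also have "?c * (2 * pi) powr (real DIM('a) / 2) = 1" by (simp flip: powr_add)
  finally show ?thesis by simp
qed

subsection \<open>The transform is a contraction\<close>

lemma ennreal_norm_integral_le:
  fixes f :: "'a \<Rightarrow> 'b::{banach, second_countable_topology}"
  shows "ennreal (norm (integral\<^sup>L M f)) \<le> (\<integral>\<^sup>+x. ennreal (norm (f x)) \<partial>M)"
  by (cases "integrable M f") (auto simp: integral_norm_bound_ennreal not_integrable_integral_eq)

lemma nn_integral_lborel_translate:
  fixes h :: "'a::euclidean_space \<Rightarrow> ennreal"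
  assumes [measurable]: "h \<in> borel_measurable borel"
  shows "(\<integral>\<^sup>+x. h (x + t) \<partial>lborel) = (\<integral>\<^sup>+x. h x \<partial>lborel)"
proof -
  have "(\<integral>\<^sup>+x. h x \<partial>lborel) = (\<integral>\<^sup>+x. h x \<partial>(distr lborel borel ((+) t)))"
    by (simp add: lborel_distr_plus)
  then show ?thesis by (simp add: nn_integral_distr add.commute)
qed

lemma cmod_ft_le: "cmod (ft f p) \<le> (2 * pi) powr (- real DIM('a) / 2) * (\<integral>x. cmod (f x) \<partial>lborel)"
  for f :: "'a::euclidean_space \<Rightarrow> complex"
proof -
  have "cmod (\<integral>x. cis (- (p \<bullet> x)) * f x \<partial>lborel) \<le> (\<integral>x. cmod (cis (- (p \<bullet> x)) * f x) \<partial>lborel)"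
    by (rule integral_norm_bound)
  then show ?thesis by (simp add: ft_def norm_mult mult_left_mono)
qed

text \<open>In the regularised Plancherel identity for \<open>f = g\<close> the right-hand side is at most
  \<open>\<integral>\<bar>f\<bar>\<^sup>2\<close> for every width of the Gaussian: bound \<open>\<bar>f x\<bar> \<bar>f (x + s z)\<bar>\<close> by the mean of the squares
  and use translation invariance.\<close>

lemma regularised_ft_bound:
  fixes f :: "'a::euclidean_space \<Rightarrow> complex"
  assumes f: "integrable lborel f" and f2: "sq_integrable f" and s: "0 < s"
  shows "(\<integral>\<^sup>+p. ennreal ((cmod (ft f p))\<^sup>2 * gauss (s *\<^sub>R p)) \<partial>lborel)
    \<le> (\<integral>\<^sup>+x. ennreal ((cmod (f x))\<^sup>2) \<partial>lborel)"
proof -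
  let ?c = "(2 * pi) powr (- real DIM('a) / 2)" and ?d = "(2 * pi) powr (real DIM('a) / 2)"
  let ?q = "\<lambda>x. ennreal ((cmod (f x))\<^sup>2)" and ?h = "\<lambda>z::'a. ennreal (gauss z / 2)"
    and ?J = "\<lambda>x. \<integral>z. f (x + s *\<^sub>R z) * of_real (gauss z) \<partial>lborel"
  let ?N = "\<integral>\<^sup>+x. ?q x \<partial>lborel"
  have [measurable]: "f \<in> borel_measurable borel" using f2 by (simp add: sq_integrable_def)
  have G: "(\<integral>\<^sup>+z. ennreal (gauss z) \<partial>(lborel :: 'a measure)) = ennreal ?d"
    using nn_integral_eq_integral[OF gaussian_integrable[where 'a='a]] unfolding gaussian_integral by simp
  have le: "(cmod (ft f p))\<^sup>2 \<le> (?c * (\<integral>x. cmod (f x) \<partial>lborel))\<^sup>2" for p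
    by (intro power_mono cmod_ft_le) simp
  have int: "integrable lborel (\<lambda>p. (cmod (ft f p))\<^sup>2 * gauss (s *\<^sub>R p))"
  proof (rule Bochner_Integration.integrable_bound)
    show "integrable lborel (\<lambda>p::'a. (?c * (\<integral>x. cmod (f x) \<partial>lborel))\<^sup>2 * gauss (s *\<^sub>R p))"
      by (intro integrable_mult_right gaussian_scaled_integrable s)
    show "AE p in lborel. norm ((cmod (ft f p))\<^sup>2 * gauss (s *\<^sub>R p))
      \<le> norm ((?c * (\<integral>x. cmod (f x) \<partial>lborel))\<^sup>2 * gauss (s *\<^sub>R p))"
      unfolding norm_mult by (intro AE_I2 mult_right_mono) (use le in simp_all)
  qed measurable
  have "complex_of_real (\<integral>p. (cmod (ft f p))\<^sup>2 * gauss (s *\<^sub>R p) \<partial>lborel)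
      = (\<integral>p. cnj (ft f p) * ft f p * of_real (gauss (s *\<^sub>R p)) \<partial>lborel)"
    unfolding integral_complex_of_real[symmetric]
    by (intro Bochner_Integration.integral_cong refl) (simp add: complex_norm_square mult.commute del: of_real_power)
  also have "\<dots> = of_real ?c * (\<integral>x. cnj (f x) * (\<integral>z. f (x + s *\<^sub>R z) * of_real (gauss z) \<partial>lborel) \<partial>lborel)"
    by (rule regularised_Plancherel[OF f f s])
  finally have eq: "complex_of_real (\<integral>p. (cmod (ft f p))\<^sup>2 * gauss (s *\<^sub>R p) \<partial>lborel)
      = of_real ?c * (\<integral>x. cnj (f x) * ?J x \<partial>lborel)" .
  have "(\<integral>p. (cmod (ft f p))\<^sup>2 * gauss (s *\<^sub>R p) \<partial>lborel) \<le> ?c * cmod (\<integral>x. cnj (f x) * ?J x \<partial>lborel)"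
    using arg_cong[OF eq, of cmod] by (simp only: norm_mult norm_of_real) (simp add: abs_le_iff)
  then have "(\<integral>\<^sup>+p. ennreal ((cmod (ft f p))\<^sup>2 * gauss (s *\<^sub>R p)) \<partial>lborel)
      \<le> ennreal (?c * cmod (\<integral>x. cnj (f x) * ?J x \<partial>lborel))"
    by (subst nn_integral_eq_integral[OF int]) (auto intro: ennreal_leI)
  also have "\<dots> \<le> ennreal ?c * (\<integral>\<^sup>+x. ennreal (cmod (cnj (f x) * ?J x)) \<partial>lborel)"
    by (subst ennreal_mult) (auto intro!: mult_left_mono ennreal_norm_integral_le)
  also have "(\<integral>\<^sup>+x. ennreal (cmod (cnj (f x) * ?J x)) \<partial>lborel)
      \<le> (\<integral>\<^sup>+x. ennreal (cmod (f x)) * (\<integral>\<^sup>+z. ennreal (cmod (f (x + s *\<^sub>R z)) * gauss z) \<partial>lborel) \<partial>lborel)"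
  proof (rule nn_integral_mono)
    fix x
    have "ennreal (cmod (?J x)) \<le> (\<integral>\<^sup>+z. ennreal (cmod (f (x + s *\<^sub>R z)) * gauss z) \<partial>lborel)"
      using ennreal_norm_integral_le[of lborel "\<lambda>z. f (x + s *\<^sub>R z) * of_real (gauss z)"]
      by (simp add: norm_mult)
    then show "ennreal (cmod (cnj (f x) * ?J x))
        \<le> ennreal (cmod (f x)) * (\<integral>\<^sup>+z. ennreal (cmod (f (x + s *\<^sub>R z)) * gauss z) \<partial>lborel)"
      by (simp add: norm_mult ennreal_mult mult_left_mono)
  qed
  also have "\<dots> = (\<integral>\<^sup>+x. (\<integral>\<^sup>+z. ennreal (cmod (f x) * cmod (f (x + s *\<^sub>R z)) * gauss z) \<partial>lborel) \<partial>lborel)"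
    by (intro nn_integral_cong, subst nn_integral_cmult[symmetric]) (auto simp: ennreal_mult[symmetric] mult_ac)
  also have "\<dots> \<le> (\<integral>\<^sup>+x. (\<integral>\<^sup>+z. ?h z * ?q x + ?h z * ?q (x + s *\<^sub>R z) \<partial>lborel) \<partial>lborel)"
  proof (intro nn_integral_mono)
    fix x z :: 'a
    let ?y = "x + s *\<^sub>R z"
    have "cmod (f x) * cmod (f ?y) \<le> ((cmod (f x))\<^sup>2 + (cmod (f ?y))\<^sup>2) / 2"
      using sum_squares_bound[of "cmod (f x)" "cmod (f ?y)"] by simp
    then have "cmod (f x) * cmod (f ?y) * gauss z \<le> ((cmod (f x))\<^sup>2 + (cmod (f ?y))\<^sup>2) / 2 * gauss z"
      by (rule mult_right_mono) simp
    also have "\<dots> = gauss z / 2 * (cmod (f x))\<^sup>2 + gauss z / 2 * (cmod (f ?y))\<^sup>2" by (simp add: field_simps)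
    finally have "ennreal (cmod (f x) * cmod (f ?y) * gauss z)
        \<le> ennreal (gauss z / 2 * (cmod (f x))\<^sup>2 + gauss z / 2 * (cmod (f ?y))\<^sup>2)" by (rule ennreal_leI)
    then show "ennreal (cmod (f x) * cmod (f ?y) * gauss z) \<le> ?h z * ?q x + ?h z * ?q ?y"
      by (simp add: ennreal_mult[symmetric] ennreal_plus[symmetric] del: ennreal_plus)
  qed
  also have "\<dots> = (\<integral>\<^sup>+z. (\<integral>\<^sup>+x. ?h z * ?q x + ?h z * ?q (x + s *\<^sub>R z) \<partial>lborel) \<partial>lborel)"
    by (rule lborel_pair.Fubini'[symmetric]) measurable
  also have "\<dots> = (\<integral>\<^sup>+z. ennreal (gauss (z::'a)) * ?N \<partial>lborel)"
  proof (rule nn_integral_cong)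
    fix z :: 'a
    have "(\<integral>\<^sup>+x. ?h z * ?q x + ?h z * ?q (x + s *\<^sub>R z) \<partial>lborel)
        = ?h z * ?N + ?h z * (\<integral>\<^sup>+x. ?q (x + s *\<^sub>R z) \<partial>lborel)"
      by (subst nn_integral_add) (auto simp: nn_integral_cmult)
    also have "(\<integral>\<^sup>+x. ?q (x + s *\<^sub>R z) \<partial>lborel) = ?N"
      by (rule nn_integral_lborel_translate) measurable
    also have "?h z * ?N + ?h z * ?N = (?h z + ?h z) * ?N" by (simp add: distrib_right)
    also have "?h z + ?h z = ennreal (gauss z)" by (subst ennreal_plus[symmetric]) auto
    finally show "(\<integral>\<^sup>+x. ?h z * ?q x + ?h z * ?q (x + s *\<^sub>R z) \<partial>lborel) = ennreal (gauss z) * ?N" .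
  qed
  also have "\<dots> = ennreal ?d * ?N" unfolding G[symmetric] by (rule nn_integral_multc) measurable
  also have "ennreal ?c * (ennreal ?d * ?N) = ?N"
    by (simp add: mult.assoc[symmetric] ennreal_mult[symmetric] flip: powr_add)
  finally show ?thesis by (simp add: mult_left_mono)
qed

lemma gauss_width_tendsto:
  fixes p :: "'a::real_normed_vector"
  shows "(\<lambda>n. gauss ((1 / real (Suc n)) *\<^sub>R p)) \<longlonglongrightarrow> 1"
proof -
  have "(\<lambda>n. exp (- ((1 / real (Suc n)) * norm p)\<^sup>2 / 2)) \<longlonglongrightarrow> exp (- (0 * norm p)\<^sup>2 / 2)"
    by (intro tendsto_intros LIMSEQ_Suc[OF lim_1_over_n, unfolded of_nat_Suc[symmetric]]) auto
  then show ?thesis by (simp add: gauss_def)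
qed

lemma ft_contraction:
  fixes f :: "'a::euclidean_space \<Rightarrow> complex"
  assumes f: "integrable lborel f" and f2: "sq_integrable f"
  shows "sq_integrable (ft f)" "(\<integral>p. (cmod (ft f p))\<^sup>2 \<partial>lborel) \<le> (\<integral>x. (cmod (f x))\<^sup>2 \<partial>lborel)"
proof -
  have [measurable]: "f \<in> borel_measurable borel" using f2 by (simp add: sq_integrable_def)
  let ?g = "\<lambda>n p::'a. gauss ((1 / real (Suc n)) *\<^sub>R p)"
  have lim: "(\<lambda>n. ennreal ((cmod (ft f p))\<^sup>2 * ?g n p)) \<longlonglongrightarrow> ennreal ((cmod (ft f p))\<^sup>2)" for p
    using tendsto_ennrealI[OF tendsto_mult_left[OF gauss_width_tendsto[of p], of "(cmod (ft f p))\<^sup>2"]] by simp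
  have "(\<integral>\<^sup>+p. ennreal ((cmod (ft f p))\<^sup>2) \<partial>lborel) = (\<integral>\<^sup>+p. liminf (\<lambda>n. ennreal ((cmod (ft f p))\<^sup>2 * ?g n p)) \<partial>lborel)"
    by (intro nn_integral_cong lim_imp_Liminf[OF sequentially_bot lim, symmetric])
  also have "\<dots> \<le> liminf (\<lambda>n. \<integral>\<^sup>+p. ennreal ((cmod (ft f p))\<^sup>2 * ?g n p) \<partial>lborel)"
    by (rule nn_integral_liminf) measurable
  also have "\<dots> \<le> liminf (\<lambda>n. \<integral>\<^sup>+x. ennreal ((cmod (f x))\<^sup>2) \<partial>lborel)"
    by (intro Liminf_mono always_eventually allI regularised_ft_bound[OF f f2]) simp
  also have "\<dots> = ennreal (\<integral>x. (cmod (f x))\<^sup>2 \<partial>lborel)"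
    using f2 by (simp add: Liminf_const sq_integrable_def nn_integral_eq_integral)
  finally have le: "(\<integral>\<^sup>+p. ennreal ((cmod (ft f p))\<^sup>2) \<partial>lborel) \<le> ennreal (\<integral>x. (cmod (f x))\<^sup>2 \<partial>lborel)" .
  then show 2: "sq_integrable (ft f)"
    unfolding sq_integrable_def
    by (auto intro!: integrableI_bounded simp: top_unique less_top[symmetric] dest: le_less_trans)
  show "(\<integral>p. (cmod (ft f p))\<^sup>2 \<partial>lborel) \<le> (\<integral>x. (cmod (f x))\<^sup>2 \<partial>lborel)"
    using le 2 by (simp add: nn_integral_eq_integral sq_integrable_def)
qed

subsection \<open>Plancherel's identity for indicators of boxes\<close>

lemma AE_notin_frontier_box: "AE x in lborel. x \<notin> frontier (box a (b::'a::euclidean_space))"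
proof -
  have "negligible (frontier (box a b))" by (rule negligible_convex_frontier) simp
  then have "frontier (box a b) \<in> null_sets lborel"
    by (subst null_sets_completion_iff[symmetric]) (auto simp: negligible_iff_null_sets)
  then show ?thesis by (rule AE_not_in)
qed

definition ind_box :: "'a::euclidean_space \<Rightarrow> 'a \<Rightarrow> 'a \<Rightarrow> complex" where
  "ind_box a b x = indicator (box a b) x"

lemma ind_box_props:
  shows "integrable lborel (ind_box a b)" "sq_integrable (ind_box a b)"
    and measurable_ind_box [measurable]: "ind_box a b \<in> borel_measurable borel"
proof -
  show m: "ind_box a b \<in> borel_measurable borel" unfolding ind_box_def by measurable
  have i: "integrable lborel (\<lambda>x. indicator (box a b) x *\<^sub>R (1::complex))"
    by (rule integrable_indicator) (auto simp: emeasure_bounded_finite[OF bounded_box, simplified])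
  also have "(\<lambda>x. indicator (box a b) x *\<^sub>R (1::complex)) = ind_box a b"
    by (auto simp: ind_box_def indicator_def)
  finally show i: "integrable lborel (ind_box a b)" .
  have "(\<lambda>x. (cmod (ind_box a b x))\<^sup>2) = (\<lambda>x. cmod (ind_box a b x))"
    by (auto simp: ind_box_def indicator_def)
  then show "sq_integrable (ind_box a b)" using m integrable_norm[OF i] by (simp add: sq_integrable_def)
qed

text \<open>Off the boundary of the box, \<open>ind_box\<close> is continuous, so letting the width of the Gaussian
  tend to infinity in the regularised identity is dominated convergence.\<close>

lemma Plancherel_box:
  fixes a b c d :: "'a::euclidean_space"
  shows "(\<integral>p. cnj (ft (ind_box a b) p) * ft (ind_box c d) p \<partial>lborel) = (\<integral>x. cnj (ind_box a b x) * ind_box c d x \<partial>lborel)"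
proof -
  let ?f = "ind_box a b" and ?g = "ind_box c d"
  let ?c = "(2 * pi) powr (- real DIM('a) / 2)" and ?d = "(2 * pi) powr (real DIM('a) / 2)"
  let ?s = "\<lambda>n. 1 / real (Suc n)"
  let ?J = "\<lambda>n x. \<integral>z. ?g (x + ?s n *\<^sub>R z) * of_real (gauss z) \<partial>lborel"
  have Gi: "integrable lborel (gauss :: 'a \<Rightarrow> real)" by (rule gaussian_integrable)
  have "(\<lambda>n. \<integral>p. cnj (ft ?f p) * ft ?g p * of_real (gauss (?s n *\<^sub>R p)) \<partial>lborel)
      \<longlonglongrightarrow> (\<integral>p. cnj (ft ?f p) * ft ?g p \<partial>lborel)"
  proof (rule integral_dominated_convergence)
    have "integrable lborel (\<lambda>p. cnj (ft ?f p) * ft ?g p)"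
      by (intro integrable_cnj_mult ft_contraction ind_box_props)
    then show "integrable lborel (\<lambda>p. cmod (cnj (ft ?f p) * ft ?g p))" by (rule integrable_norm)
    show "AE p in lborel. (\<lambda>n. cnj (ft ?f p) * ft ?g p * of_real (gauss (?s n *\<^sub>R p)))
        \<longlonglongrightarrow> cnj (ft ?f p) * ft ?g p"
      by (rule AE_I2) (use tendsto_mult_left[OF tendsto_of_real[OF gauss_width_tendsto]] in fastforce)
    show "AE p in lborel. norm (cnj (ft ?f p) * ft ?g p * of_real (gauss (?s n *\<^sub>R p)))
        \<le> cmod (cnj (ft ?f p) * ft ?g p)" for n
      by (rule AE_I2) (simp add: norm_mult mult_left_le)
  qed measurable
  moreover have "(\<lambda>n. of_real ?c * (\<integral>x. cnj (?f x) * ?J n x \<partial>lborel))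
      \<longlonglongrightarrow> of_real ?c * (\<integral>x. cnj (?f x) * (?g x * of_real ?d) \<partial>lborel)"
  proof (intro tendsto_mult_left integral_dominated_convergence)
    show "integrable lborel (\<lambda>x. cmod (?f x) * ?d)"
      using integrable_norm[OF ind_box_props(1)] by simp
    have le1: "cmod (?g x) \<le> 1" for x by (simp add: ind_box_def indicator_def)
    have inner_le: "cmod (?J n x) \<le> ?d" for x n
    proof -
      have "cmod (?J n x) \<le> (\<integral>z. gauss (z::'a) \<partial>lborel)"
      proof (rule order_trans[OF integral_norm_bound integral_mono_AE'])
        show "AE z in lborel. cmod (?g (x + ?s n *\<^sub>R z) * of_real (gauss z)) \<le> gauss z"
          using le1 by (auto simp: norm_mult intro!: AE_I2 mult_left_le_one_le)
      qed (use Gi in auto)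
      then show ?thesis unfolding gaussian_integral .
    qed
    show "AE x in lborel. norm (cnj (?f x) * ?J n x) \<le> cmod (?f x) * ?d" for n
      using inner_le by (auto simp: norm_mult intro!: AE_I2 mult_left_mono)
    show "AE x in lborel. (\<lambda>n. cnj (?f x) * ?J n x)
        \<longlonglongrightarrow> cnj (?f x) * (?g x * of_real ?d)"
      using AE_notin_frontier_box[of c d]
    proof eventually_elim
      case (elim x)
      have cont: "isCont (indicator (box c d) :: 'a \<Rightarrow> real) x" using elim by (simp add: isCont_indicator)
      have "(\<lambda>n. ?J n x) \<longlonglongrightarrow> (\<integral>z. ?g x * of_real (gauss z) \<partial>(lborel :: 'a measure))"
      proof (rule integral_dominated_convergence[OF _ _ Gi])
        show "AE z in lborel. (\<lambda>n. ?g (x + ?s n *\<^sub>R z) * of_real (gauss z)) \<longlonglongrightarrow> ?g x * of_real (gauss z)"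
        proof (intro AE_I2 tendsto_mult_right)
          fix z :: 'a
          have "(\<lambda>n. x + ?s n *\<^sub>R z) \<longlonglongrightarrow> x + 0 *\<^sub>R z"
            by (intro tendsto_intros LIMSEQ_Suc[OF lim_1_over_n, unfolded of_nat_Suc[symmetric]])
          then have "(\<lambda>n. indicator (box c d) (x + ?s n *\<^sub>R z)) \<longlonglongrightarrow> (indicator (box c d) x :: real)"
            using isCont_tendsto_compose[OF cont] by simp
          then have "(\<lambda>n. complex_of_real (indicator (box c d) (x + ?s n *\<^sub>R z))) \<longlonglongrightarrow> complex_of_real (indicator (box c d) x)"
            by (rule tendsto_of_real)
          moreover have "ind_box c d = (\<lambda>x. complex_of_real (indicator (box c d) x))"
            by (auto simp: ind_box_def indicator_def)
          ultimately show "(\<lambda>n. ?g (x + ?s n *\<^sub>R z)) \<longlonglongrightarrow> ?g x"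
            by (simp only:)
        qed
        show "AE z in lborel. norm (?g (x + ?s n *\<^sub>R z) * of_real (gauss z)) \<le> gauss z" for n
          using le1 by (auto simp: norm_mult intro!: AE_I2 mult_left_le_one_le)
      qed measurable
      then show ?case
        unfolding integral_mult_right_zero integral_complex_of_real gaussian_integral
        by (rule tendsto_mult_left)
    qed
  qed measurable
  ultimately have "(\<integral>p. cnj (ft ?f p) * ft ?g p \<partial>lborel) = of_real ?c * (\<integral>x. cnj (?f x) * (?g x * of_real ?d) \<partial>lborel)"
    using regularised_Plancherel[OF ind_box_props(1) ind_box_props(1), of "?s _" a b c d]
    by (simp add: LIMSEQ_unique)
  also have "\<dots> = of_real (?c * ?d) * (\<integral>x. cnj (?f x) * ?g x \<partial>lborel)"
    by (simp only: mult.assoc[symmetric] integral_mult_left_zero of_real_mult) (simp only: mult_ac)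
  also have "?c * ?d = 1" by (simp flip: powr_add)
  finally show ?thesis by simp
qed

subsection \<open>Extension to a unitary operator\<close>

definition trunc :: "nat \<Rightarrow> 'a::euclidean_space op" where
  "trunc n = mulop (indicator (cball 0 (real n)))"

lemma bdd_borel_cball: "bdd_borel (indicator (cball (0::'a::euclidean_space) r))"
  by (rule bdd_borel_indicator) simp

lemma rep_trunc: "AE x in lborel. rep_L2 (trunc n f) x = of_real (indicator (cball 0 (real n)) x) * rep_L2 f x"
  unfolding trunc_def by (rule rep_mulop[OF bdd_borel_cball])

lemma bounded_op_trunc: "bounded_op (trunc n)"
  unfolding trunc_def by (rule bounded_op_mulop[OF bdd_borel_cball])

lemma integrable_trunc: "integrable lborel (rep_L2 (trunc n f))"
proof (rule Bochner_Integration.integrable_bound)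
  show "integrable lborel (\<lambda>x. indicator (cball 0 (real n)) x + (cmod (rep_L2 f x))\<^sup>2)"
    by (intro Bochner_Integration.integrable_add integrable_rep_square integrable_real_indicator)
      (auto simp: emeasure_bounded_finite[OF bounded_cball, simplified])
  show "AE x in lborel. norm (rep_L2 (trunc n f) x) \<le> norm (indicator (cball 0 (real n)) x + (cmod (rep_L2 f x))\<^sup>2)"
    using rep_trunc[of n f]
  proof eventually_elim
    case (elim x)
    have "0 \<le> (cmod (rep_L2 f x) - 1)\<^sup>2" by simp
    then have "2 * cmod (rep_L2 f x) \<le> 1 + (cmod (rep_L2 f x))\<^sup>2" unfolding power2_diff by simp
    then have "cmod (rep_L2 f x) \<le> 1 + (cmod (rep_L2 f x))\<^sup>2" using norm_ge_zero[of "rep_L2 f x"] by linarith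
    then show ?case using elim by (auto simp: norm_mult indicator_def)
  qed
qed simp

lemma mulop_indicator_tendsto:
  fixes f :: "'a::euclidean_space L2"
  assumes A: "\<And>n. A n \<in> sets borel" and ev: "\<And>x. \<forall>\<^sub>F n in sequentially. x \<in> A n"
  shows "(\<lambda>n. mulop (indicator (A n)) f) \<longlonglongrightarrow> f"
proof -
  note A [measurable]
  have "(\<lambda>n. \<integral>x. (cmod (of_real (indicator (A n) x - 1) * rep_L2 f x))\<^sup>2 \<partial>lborel) \<longlonglongrightarrow> (\<integral>x. 0 \<partial>(lborel :: 'a measure))"
  proof (rule integral_dominated_convergence[OF _ _ integrable_rep_square[of f]])
    show "AE x in lborel. (\<lambda>n. (cmod (of_real (indicator (A n) x - 1) * rep_L2 f x))\<^sup>2) \<longlonglongrightarrow> 0"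
    proof (rule AE_I2, rule tendsto_eventually)
      fix x :: 'a
      show "\<forall>\<^sub>F n in sequentially. (cmod (of_real (indicator (A n) x - 1) * rep_L2 f x))\<^sup>2 = 0"
        using ev[of x] by eventually_elim simp
    qed
    show "AE x in lborel. norm ((cmod (of_real (indicator (A n) x - 1) * rep_L2 f x))\<^sup>2) \<le> (cmod (rep_L2 f x))\<^sup>2" for n
      by (rule AE_I2) (auto simp: norm_mult indicator_def)
  qed measurable
  moreover have "(norm (mulop (indicator (A n)) f - f))\<^sup>2 = (\<integral>x. (cmod (of_real (indicator (A n) x - 1) * rep_L2 f x))\<^sup>2 \<partial>lborel)" for n
    unfolding norm_sq_L2
  proof (rule integral_cong_AE)
    show "AE x in lborel. (cmod (rep_L2 (mulop (indicator (A n)) f - f) x))\<^sup>2 = (cmod (of_real (indicator (A n) x - 1) * rep_L2 f x))\<^sup>2"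
      using rep_mulop[OF bdd_borel_indicator[OF A[of n]], of f] rep_minus[of "mulop (indicator (A n)) f" f]
      by eventually_elim (simp add: left_diff_distrib)
  qed measurable
  ultimately have "(\<lambda>n. (norm (mulop (indicator (A n)) f - f))\<^sup>2) \<longlonglongrightarrow> 0" by simp
  then have "(\<lambda>n. sqrt ((norm (mulop (indicator (A n)) f - f))\<^sup>2)) \<longlonglongrightarrow> sqrt 0" by (rule tendsto_real_sqrt)
  then show ?thesis by (simp add: tendsto_norm_zero_iff LIM_zero_iff)
qed

lemma trunc_tendsto: "(\<lambda>n. trunc n f) \<longlonglongrightarrow> f"
  unfolding trunc_def
proof (rule mulop_indicator_tendsto)
  fix x :: 'a
  obtain N where "norm x \<le> real N" using real_arch_simple by blast
  then show "\<forall>\<^sub>F n in sequentially. x \<in> cball 0 (real n)"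
    by (intro eventually_sequentiallyI[of N]) auto
qed simp

lemma ft_cong: "f \<in> borel_measurable borel \<Longrightarrow> g \<in> borel_measurable borel \<Longrightarrow>
    AE x in lborel. f x = g x \<Longrightarrow> ft f = ft g"
  unfolding ft_def fun_eq_iff
  by (intro allI arg_cong2[where f = "(*)"] refl integral_cong_AE) (auto elim: eventually_mono)

lemma ft_add: "integrable lborel f \<Longrightarrow> integrable lborel g \<Longrightarrow> ft (\<lambda>x. f x + g x) p = ft f p + ft g p"
  by (simp add: ft_def ring_distribs integrable_cis_mult)

lemma ft_cmult: "ft (\<lambda>x. c * f x) p = c * ft f p"
  by (simp add: ft_def mult.left_commute[of _ c])

definition ft0 :: "'a::euclidean_space op" where
  "ft0 f = abs_L2 (ft (rep_L2 f))"

lemma rep_ft0: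
  "integrable lborel (rep_L2 f) \<Longrightarrow> AE p in lborel. rep_L2 (ft0 f) p = ft (rep_L2 f) p"
  unfolding ft0_def by (intro rep_abs_L2 ft_contraction) auto

lemma norm_ft0: 
  assumes "integrable lborel (rep_L2 f)" shows "norm (ft0 f) \<le> norm f"
proof (rule power2_le_imp_le)
  show "(norm (ft0 f))\<^sup>2 \<le> (norm f)\<^sup>2"
    unfolding ft0_def norm_sq_abs[OF ft_contraction(1)[OF assms sq_integrable_rep]] norm_sq_L2[of f]
    by (rule ft_contraction(2)[OF assms sq_integrable_rep])
qed simp

lemma integrable_rep_plus:
  assumes "integrable lborel (rep_L2 f)" "integrable lborel (rep_L2 g)"
  shows "integrable lborel (rep_L2 (f + g))"
  by (rule integrable_cong_AE_imp[OF Bochner_Integration.integrable_add[OF assms]])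
    (use rep_plus[of f g] in \<open>auto elim: eventually_mono\<close>)

lemma integrable_rep_cscale:
  assumes "integrable lborel (rep_L2 f)" shows "integrable lborel (rep_L2 (cscale c f))"
  by (rule integrable_cong_AE_imp[OF integrable_mult_right[OF assms, of c]])
    (use rep_cscale[of c f] in \<open>auto elim: eventually_mono\<close>)

lemma ft0_add:
  assumes f: "integrable lborel (rep_L2 f)" and g: "integrable lborel (rep_L2 g)"
  shows "ft0 (f + g) = ft0 f + ft0 g"
proof (rule L2_eqI)
  have eq: "ft (rep_L2 (f + g)) = ft (\<lambda>x. rep_L2 f x + rep_L2 g x)"
    by (rule ft_cong) (use rep_plus[of f g] in auto)
  show "AE p in lborel. rep_L2 (ft0 (f + g)) p = rep_L2 (ft0 f + ft0 g) p"
    using rep_ft0[OF f] rep_ft0[OF g] rep_ft0[OF integrable_rep_plus[OF f g]] rep_plus[of "ft0 f" "ft0 g"]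
    by eventually_elim (simp only: eq ft_add[OF f g])
qed

lemma ft0_cscale:
  assumes f: "integrable lborel (rep_L2 f)" shows "ft0 (cscale c f) = cscale c (ft0 f)"
proof (rule L2_eqI)
  have eq: "ft (rep_L2 (cscale c f)) = ft (\<lambda>x. c * rep_L2 f x)"
    by (rule ft_cong) (use rep_cscale[of c f] in auto)
  show "AE p in lborel. rep_L2 (ft0 (cscale c f)) p = rep_L2 (cscale c (ft0 f)) p"
    using rep_ft0[OF f] rep_ft0[OF integrable_rep_cscale[OF f, of c]] rep_cscale[of c "ft0 f"]
    by eventually_elim (simp only: eq ft_cmult)
qed

lemma ft0_diff:
  assumes f: "integrable lborel (rep_L2 f)" and g: "integrable lborel (rep_L2 g)"
  shows "integrable lborel (rep_L2 (f - g))" "ft0 (f - g) = ft0 f - ft0 g"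
proof -
  have d: "h - k = h + cscale (-1) k" for h k :: "'a L2" by (simp add: uminus_L2_def[symmetric])
  show "integrable lborel (rep_L2 (f - g))" "ft0 (f - g) = ft0 f - ft0 g"
    unfolding d using f g by (simp_all add: ft0_add ft0_cscale integrable_rep_plus integrable_rep_cscale)
qed

text \<open>Every \<open>L\<^sup>2\<close> function is the limit of its restrictions to balls, which are integrable; since the
  integral formula is a contraction on integrable \<open>L\<^sup>2\<close> functions, the limit exists.\<close>

definition ftL2 :: "'a::euclidean_space op" where
  "ftL2 f = lim (\<lambda>n. ft0 (trunc n f))"

lemma ftL2_tendsto: "(\<lambda>n. ft0 (trunc n f)) \<longlonglongrightarrow> ftL2 f"
proof -
  have "Cauchy (\<lambda>n. ft0 (trunc n f))"
  proof (rule metric_CauchyI)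
    fix e :: real assume "0 < e"
    then obtain N where N: "\<And>m n. m \<ge> N \<Longrightarrow> n \<ge> N \<Longrightarrow> dist (trunc m f) (trunc n f) < e"
      using LIMSEQ_imp_Cauchy[OF trunc_tendsto[of f]] unfolding Cauchy_def by blast
    have "dist (ft0 (trunc m f)) (ft0 (trunc n f)) \<le> dist (trunc m f) (trunc n f)" for m n
      using norm_ft0[OF ft0_diff(1)[OF integrable_trunc[of m f] integrable_trunc[of n f]]]
      by (simp add: dist_norm ft0_diff(2)[OF integrable_trunc integrable_trunc])
    then show "\<exists>M. \<forall>m\<ge>M. \<forall>n\<ge>M. dist (ft0 (trunc m f)) (ft0 (trunc n f)) < e"
      using N by (meson le_less_trans)
  qed
  then show ?thesis
    unfolding ftL2_def by (simp add: Cauchy_convergent_iff convergent_LIMSEQ_iff)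
qed

lemma bounded_op_ftL2: "bounded_op ftL2"
proof (rule bounded_opI)
  fix f g :: "'a L2" and c
  show "ftL2 (f + g) = ftL2 f + ftL2 g"
    using LIMSEQ_unique[OF ftL2_tendsto[of "f + g"]] tendsto_add[OF ftL2_tendsto[of f] ftL2_tendsto[of g]]
    by (simp add: bounded_op_add[OF bounded_op_trunc] ft0_add integrable_trunc)
  show "ftL2 (cscale c f) = cscale c (ftL2 f)"
    using LIMSEQ_unique[OF ftL2_tendsto[of "cscale c f"]]
      bounded_linear.tendsto[OF bounded_linear_cscale ftL2_tendsto[of f], of c]
    by (simp add: bounded_op_cscale[OF bounded_op_trunc] ft0_cscale integrable_trunc)
  show "norm (ftL2 f) \<le> 1 * norm f"
    using LIMSEQ_le[OF tendsto_norm[OF ftL2_tendsto[of f]] tendsto_norm[OF trunc_tendsto[of f]]]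
      norm_ft0[OF integrable_trunc[of _ f]] by auto
qed

lemma ftL2_eq_ft0:
  assumes f: "integrable lborel (rep_L2 f)" shows "ftL2 f = ft0 f"
proof -
  have "(\<lambda>n. ft0 (trunc n f) - ft0 f) \<longlonglongrightarrow> 0"
  proof (rule Lim_null_comparison)
    show "\<forall>\<^sub>F n in sequentially. norm (ft0 (trunc n f) - ft0 f) \<le> norm (trunc n f - f)"
      using norm_ft0[OF ft0_diff(1)[OF integrable_trunc f]]
      by (intro always_eventually allI) (simp add: ft0_diff(2)[OF integrable_trunc f])
    show "(\<lambda>n. norm (trunc n f - f)) \<longlonglongrightarrow> 0"
      using trunc_tendsto[of f] by (simp add: tendsto_norm_zero_iff LIM_zero_iff)
  qed
  then show ?thesis using LIMSEQ_unique[OF ftL2_tendsto] by (simp add: LIM_zero_iff)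
qed

text \<open>Two bounded operators that agree on integrable functions agree on all truncations, hence
  everywhere; so \<^const>\<open>ftL2\<close> is the operator described by \<^const>\<open>fourier\<close>.\<close>

lemma fourier_unique:
  fixes F :: "'a::euclidean_space op"
  assumes F: "bounded_op F"
    and ft: "\<And>f. integrable lborel (rep_L2 f) \<Longrightarrow> AE p in lborel. rep_L2 (F f) p = ft (rep_L2 f) p"
  shows "fourier = F"
proof -
  have uniq: "G = ftL2" if G: "bounded_op G"
    and ftG: "\<And>f. integrable lborel (rep_L2 f) \<Longrightarrow> AE p in lborel. rep_L2 (G f) p = ft (rep_L2 f) p"
  for G :: "'a op"
  proof
    fix f
    have "G (trunc n f) = ft0 (trunc n f)" for n
      by (rule L2_eqI) (use ftG[OF integrable_trunc[of n f]] rep_ft0[OF integrable_trunc[of n f]]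
        in \<open>eventually_elim, simp\<close>)
    then show "G f = ftL2 f"
      using bounded_op_tendsto[OF G trunc_tendsto[of f]] ftL2_tendsto[of f] LIMSEQ_unique by simp
  qed
  have "fourier = (ftL2 :: 'a op)"
    unfolding fourier_def
  proof (rule the_equality)
    show "bounded_op (ftL2 :: 'a op) \<and> (\<forall>f :: 'a L2. integrable lborel (rep_L2 f) \<longrightarrow>
       (AE p in lborel. rep_L2 (ftL2 f) p = complex_of_real ((2 * pi) powr (- real DIM('a) / 2)) *
          (\<integral>x. cis (- (p \<bullet> x)) * rep_L2 f x \<partial>lborel)))"
      using bounded_op_ftL2[where 'a='a] rep_ft0[where 'a='a] by (simp add: ftL2_eq_ft0 ft_def)
  qed (intro uniq, simp_all add: ft_def)
  then show ?thesis using uniq[OF F ft] by simp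
qed

lemma fourier_eq_ftL2: "fourier = ftL2"
  by (rule fourier_unique[OF bounded_op_ftL2]) (simp add: ftL2_eq_ft0 rep_ft0)

lemma bounded_op_fourier: "bounded_op fourier"
  by (simp add: fourier_eq_ftL2 bounded_op_ftL2)

lemma rep_fourier:
  "integrable lborel (rep_L2 f) \<Longrightarrow> AE p in lborel. rep_L2 (fourier f) p = ft (rep_L2 f) p"
  by (simp add: fourier_eq_ftL2 ftL2_eq_ft0 rep_ft0)

text \<open>The inverse transform, whose kernel is the complex conjugate of the kernel of \<^const>\<open>fourier\<close>.\<close>

definition ifourier :: "'a::euclidean_space op" where
  "ifourier f = cnj_L2 (fourier (cnj_L2 f))"

lemma bounded_op_ifourier: "bounded_op ifourier"
proof -
  obtain K where K: "0 < K" "\<And>f::'a L2. norm (fourier f) \<le> K * norm f" using bounded_op_bound[OF bounded_op_fourier] by blast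
  show ?thesis
  proof (rule bounded_opI)
    show "norm (ifourier f) \<le> K * norm f" for f :: "'a L2"
      using K(2)[of "cnj_L2 f"] by (simp add: ifourier_def)
  qed (simp_all add: ifourier_def cnj_L2_add cnj_L2_cscale bounded_op_add[OF bounded_op_fourier]
      bounded_op_cscale[OF bounded_op_fourier])
qed

text \<open>For integrable functions this is Fubini's theorem; the general case follows by truncating first
  one argument and then the other.\<close>

lemma adjoint_pair_fourier: "adjoint_pair fourier ifourier"
proof -
  have base: "cinner (fourier f) g = cinner f (ifourier g)"
    if f: "integrable lborel (rep_L2 f)" and g: "integrable lborel (rep_L2 g)" for f g :: "'a L2"
  proof -
    let ?c = "complex_of_real ((2 * pi) powr (- real DIM('a) / 2))"
    let ?H = "\<lambda>p x. cis (p \<bullet> x) * (cnj (rep_L2 f x) * rep_L2 g p)"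
    have cg: "integrable lborel (rep_L2 (cnj_L2 g))"
      by (rule integrable_cong_AE_imp[OF integrable_cnj[OF g]]) (use rep_cnj[of g] in \<open>auto elim: eventually_mono\<close>)
    have cf: "integrable lborel (\<lambda>x. cnj (rep_L2 f x))" using f by simp
    have iH: "integrable (lborel \<Otimes>\<^sub>M lborel) (\<lambda>(p, x). ?H p x)"
    proof (rule Bochner_Integration.integrable_bound)
      show "integrable (lborel \<Otimes>\<^sub>M lborel) (\<lambda>w. rep_L2 g (fst w) * cnj (rep_L2 f (snd w)))"
        using integrable_pair_mult(1)[OF g cf] by (simp add: lborel_prod)
      show "(\<lambda>(p, x). ?H p x) \<in> borel_measurable (lborel \<Otimes>\<^sub>M lborel)" by measurable
    qed (auto simp: norm_mult case_prod_unfold)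
    have ifg: "AE x in lborel. rep_L2 (ifourier g) x = ?c * (\<integral>p. cis (p \<bullet> x) * rep_L2 g p \<partial>lborel)"
    proof -
      have *: "ft (rep_L2 (cnj_L2 g)) = ft (\<lambda>x. cnj (rep_L2 g x))"
        by (rule ft_cong) (use rep_cnj[of g] in auto)
      have **: "cnj (ft (\<lambda>x. cnj (rep_L2 g x)) x) = ?c * (\<integral>p. cis (p \<bullet> x) * rep_L2 g p \<partial>lborel)" for x
        unfolding ft_def complex_cnj_mult Bochner_Integration.integral_cnj[symmetric]
        by (simp add: cis_cnj inner_commute)
      show ?thesis
        using rep_fourier[OF cg] rep_cnj[of "fourier (cnj_L2 g)"] unfolding ifourier_def *
        by eventually_elim (simp only: **)
    qed
    have "cinner (fourier f) g = (\<integral>p. ?c * (\<integral>x. ?H p x \<partial>lborel) \<partial>lborel)"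
      unfolding cinner_rep
    proof (rule integral_cong_AE)
      have "cnj (ft (rep_L2 f) p) * rep_L2 g p = ?c * (\<integral>x. ?H p x \<partial>lborel)" for p
        unfolding ft_def complex_cnj_mult Bochner_Integration.integral_cnj[symmetric]
        by (simp add: cis_cnj mult.assoc[symmetric])
      note ** = this
      show "AE p in lborel. cnj (rep_L2 (fourier f) p) * rep_L2 g p = ?c * (\<integral>x. ?H p x \<partial>lborel)"
        using rep_fourier[OF f] by eventually_elim (simp only: **)
    qed measurable
    also have "\<dots> = ?c * (\<integral>p. (\<integral>x. ?H p x \<partial>lborel) \<partial>lborel)" by simp
    also have "(\<integral>p. (\<integral>x. ?H p x \<partial>lborel) \<partial>lborel) = (\<integral>x. (\<integral>p. ?H p x \<partial>lborel) \<partial>lborel)"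
      by (rule lborel_pair.Fubini_integral[OF iH, symmetric])
    also have "?c * \<dots> = (\<integral>x. ?c * (\<integral>p. ?H p x \<partial>lborel) \<partial>lborel)" by simp
    also have "\<dots> = cinner f (ifourier g)"
      unfolding cinner_rep
    proof (rule integral_cong_AE)
      have "?c * (\<integral>p. ?H p x \<partial>lborel) = cnj (rep_L2 f x) * (?c * (\<integral>p. cis (p \<bullet> x) * rep_L2 g p \<partial>lborel))" for x
        by (simp only: mult.left_commute[of "cis _" "cnj (rep_L2 f x)"] integral_mult_right_zero)
          (simp only: mult_ac)
      note ** = this
      show "AE x in lborel. ?c * (\<integral>p. ?H p x \<partial>lborel) = cnj (rep_L2 f x) * rep_L2 (ifourier g) x"
        using ifg by eventually_elim (simp only: **)
    qed measurable
    finally show ?thesis .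
  qed
  have step: "cinner (fourier f) g = cinner f (ifourier g)"
    if g: "integrable lborel (rep_L2 g)" for f g :: "'a L2"
  proof -
    have "(\<lambda>n. cinner (fourier (trunc n f)) g) \<longlonglongrightarrow> cinner (fourier f) g"
      by (intro bounded_linear.tendsto[OF bounded_linear_cinner_left] bounded_op_tendsto[OF bounded_op_fourier] trunc_tendsto)
    moreover have "(\<lambda>n. cinner (trunc n f) (ifourier g)) \<longlonglongrightarrow> cinner f (ifourier g)"
      by (intro bounded_linear.tendsto[OF bounded_linear_cinner_left] trunc_tendsto)
    ultimately show ?thesis
      unfolding base[OF integrable_trunc g] by (rule LIMSEQ_unique)
  qed
  show ?thesis
    unfolding adjoint_pair_def
  proof (intro allI)
    fix f g :: "'a L2"
    have "(\<lambda>n. cinner (fourier f) (trunc n g)) \<longlonglongrightarrow> cinner (fourier f) g"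
      by (intro bounded_linear.tendsto[OF bounded_linear_cinner_right] trunc_tendsto)
    moreover have "(\<lambda>n. cinner f (ifourier (trunc n g))) \<longlonglongrightarrow> cinner f (ifourier g)"
      by (intro bounded_linear.tendsto[OF bounded_linear_cinner_right] bounded_op_tendsto[OF bounded_op_ifourier] trunc_tendsto)
    ultimately show "cinner (fourier f) g = cinner f (ifourier g)"
      unfolding step[OF integrable_trunc] by (rule LIMSEQ_unique)
  qed
qed

text \<open>\<open>ifourier \<circ> fourier - 1\<close> annihilates box indicators, because by Plancherel's identity for
  boxes its values on them are orthogonal to all box indicators. Being self-adjoint, it then maps
  everything to the orthogonal complement of the box indicators, which is zero.\<close>

lemma orthogonal_boxes_zero:
  assumes "\<And>a b. cinner (abs_L2 (ind_box a b)) h = 0" shows "h = 0"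
proof -
  have "AE x in lborel. rep_L2 h x = 0"
  proof (rule AE_zero_if_box_integrals_zero)
    fix a b :: 'a
    have eq: "(\<lambda>x. indicator (box a b) x *\<^sub>R rep_L2 h x) = (\<lambda>x. cnj (ind_box a b x) * rep_L2 h x)"
      by (auto simp: ind_box_def indicator_def)
    show "set_integrable lborel (box a b) (rep_L2 h)"
      unfolding set_integrable_def eq by (rule integrable_cnj_mult[OF ind_box_props(2)]) simp
    have "cinner (abs_L2 (ind_box a b)) (abs_L2 (rep_L2 h)) = (LINT x:box a b|lborel. rep_L2 h x)"
      unfolding set_lebesgue_integral_def eq by (rule cinner_abs[OF ind_box_props(2)]) simp
    then show "(LINT x:box a b|lborel. rep_L2 h x) = 0" using assms by simp
  qed
  then have "AE x in lborel. rep_L2 h x = rep_L2 0 x"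
    using rep_zero[where 'a='a] by eventually_elim simp
  then show ?thesis by (rule L2_eqI)
qed

lemma ifourier_fourier [simp]: "ifourier (fourier f) = (f :: 'a::euclidean_space L2)"
proof -
  let ?I = "\<lambda>a b::'a. abs_L2 (ind_box a b)"
  have F: "fourier (?I a b) = abs_L2 (ft (ind_box a b))" for a b
  proof (rule L2_eq_absI)
    show "sq_integrable (ft (ind_box a b))" by (intro ft_contraction ind_box_props)
    have int: "integrable lborel (rep_L2 (?I a b))"
      by (rule integrable_cong_AE_imp[OF ind_box_props(1)[of a b]]) (use rep_abs_L2[OF ind_box_props(2)[of a b]] in \<open>auto elim: eventually_mono\<close>)
    have "ft (rep_L2 (?I a b)) = ft (ind_box a b)"
      by (rule ft_cong) (use rep_abs_L2[OF ind_box_props(2)] in auto)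
    then show "AE p in lborel. rep_L2 (fourier (?I a b)) p = ft (ind_box a b) p"
      using rep_fourier[OF int] by simp
  qed
  have FF: "adjoint_pair fourier (ifourier :: 'a op)" "adjoint_pair ifourier (fourier :: 'a op)"
    using adjoint_pair_fourier adjoint_pair_sym by auto
  have iso: "cinner (?I a b) (ifourier (fourier (?I c d))) = cinner (?I a b) (?I c d)" for a b c d
  proof -
    have "cinner (?I a b) (ifourier (fourier (?I c d))) = cinner (fourier (?I a b)) (fourier (?I c d))"
      using FF by (simp add: adjoint_pair_def)
    also have "\<dots> = cinner (?I a b) (?I c d)"
      unfolding F by (subst (1 2) cinner_abs) (auto intro: ft_contraction ind_box_props simp: Plancherel_box)
    finally show ?thesis .
  qed
  have box: "ifourier (fourier (?I c d)) = ?I c d" for c d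
    using orthogonal_boxes_zero[of "ifourier (fourier (?I c d)) - ?I c d"] by (simp add: cinner_diff_right iso)
  have "cinner (?I a b) (ifourier (fourier f) - f) = 0" for a b
  proof -
    have "cinner (?I a b) (ifourier (fourier f)) = cinner (ifourier (fourier (?I a b))) f"
      using FF unfolding adjoint_pair_def by metis
    then show ?thesis by (simp add: cinner_diff_right box)
  qed
  then show ?thesis using orthogonal_boxes_zero[of "ifourier (fourier f) - f"] by simp
qed

lemma fourier_ifourier [simp]: "fourier (ifourier f) = f"
proof -
  have "fourier (ifourier f) = cnj_L2 (ifourier (fourier (cnj_L2 f)))"
    by (simp add: ifourier_def)
  then show ?thesis by simp
qed

lemma fourier_inj: "fourier f = fourier g \<longleftrightarrow> f = g"
  by (metis ifourier_fourier)

lemma cinner_fourier: "cinner (fourier f) (fourier g) = cinner f (g :: 'a::euclidean_space L2)"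
  using adjoint_pair_fourier[where 'a='a] by (simp add: adjoint_pair_def)

lemma norm_fourier [simp]: "norm (fourier f) = norm f"
  by (rule norm_eq_of_cinner, unfold cinner_fourier) (simp_all add: cinner_self)

text \<open>Conjugating \<^const>\<open>fourier\<close> with dilations gives a bounded operator with the same values on
  integrable functions, so the uniqueness above yields the scaling law.\<close>

lemma fourier_dil:
  fixes f :: "'a::euclidean_space L2"
  assumes a: "0 < a" shows "fourier (dil a f) = dil (inverse a) (fourier f)"
proof -
  have "fourier = (\<lambda>f::'a L2. dil a (fourier (dil a f)))"
  proof (rule fourier_unique)
    show "bounded_op (\<lambda>f::'a L2. dil a (fourier (dil a f)))"
      by (rule bounded_op_comp[OF bounded_op_dil[OF a] bounded_op_comp[OF bounded_op_fourier bounded_op_dil[OF a]]])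
    fix f :: "'a L2" assume f: "integrable lborel (rep_L2 f)"
    let ?r = "complex_of_real (a powr (real DIM('a) / 2))"
    have rr: "?r * ?r = of_real (a ^ DIM('a))"
      using powr_half_dim_square[OF a, where 'a='a] by (simp add: power2_eq_square flip: of_real_mult)
    have int: "integrable lborel (\<lambda>x. ?r * rep_L2 f (a *\<^sub>R x))"
      using a f by (intro integrable_mult_right) (simp add: integrable_lborel_scale_iff)
    have int': "integrable lborel (rep_L2 (dil a f))"
      by (rule integrable_cong_AE_imp[OF int]) (use rep_dil[OF a, of f] in \<open>auto elim: eventually_mono\<close>)
    have ft: "ft (rep_L2 (dil a f)) = ft (\<lambda>x. ?r * rep_L2 f (a *\<^sub>R x))"
      by (rule ft_cong) (use rep_dil[OF a, of f] in auto)
    have key: "?r * ft (\<lambda>x. ?r * rep_L2 f (a *\<^sub>R x)) (a *\<^sub>R p) = ft (rep_L2 f) p" for p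
    proof -
      have "(\<integral>x. cis (- (p \<bullet> (a *\<^sub>R x))) * rep_L2 f (a *\<^sub>R x) \<partial>lborel)
          = (\<integral>x. cis (- (p \<bullet> x)) * rep_L2 f x \<partial>lborel) /\<^sub>R a ^ DIM('a)"
        using a integral_lborel_scale[of a "\<lambda>x. cis (- (p \<bullet> x)) * rep_L2 f x"] by simp
      then have "?r * ?r * (\<integral>x. cis (- (p \<bullet> (a *\<^sub>R x))) * rep_L2 f (a *\<^sub>R x) \<partial>lborel)
          = (\<integral>x. cis (- (p \<bullet> x)) * rep_L2 f x \<partial>lborel)"
        unfolding rr using a by (simp add: scaleR_conv_of_real)
      then show ?thesis unfolding ft_cmult by (simp add: ft_def mult_ac)
    qed
    show "AE p in lborel. rep_L2 (dil a (fourier (dil a f))) p = ft (rep_L2 f) p"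
      using rep_dil[OF a, of "fourier (dil a f)"] AE_dil[OF a rep_fourier[OF int']]
      by eventually_elim (simp only: ft key)
  qed
  from fun_cong[OF this, of f] have "fourier f = dil a (fourier (dil a f))" .
  then have "dil (inverse a) (fourier f) = dil (inverse a) (dil a (fourier (dil a f)))" by simp
  then show ?thesis using a by simp
qed

section \<open>Functions of the momentum operator\<close>

subsection \<open>Bounded Fourier multipliers\<close>

definition fmul :: "('a::euclidean_space \<Rightarrow> real) \<Rightarrow> 'a L2 \<Rightarrow> 'a L2" where
  "fmul c f = ifourier (mulop c (fourier f))"

abbreviation fconj :: "('a::euclidean_space \<Rightarrow> real) \<Rightarrow> 'a op \<Rightarrow> 'a op" where
  "fconj c T \<equiv> \<lambda>f. fmul c (T (fmul c f))"

lemma fourier_fmul: "fourier (fmul c f) = mulop c (fourier f)"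
  by (simp add: fmul_def)

lemma rep_fourier_fmul:
  "bdd_borel c \<Longrightarrow> AE p in lborel. rep_L2 (fourier (fmul c f)) p = complex_of_real (c p) * rep_L2 (fourier f) p"
  unfolding fourier_fmul by (rule rep_mulop)

lemma fmul_fmul: "bdd_borel c \<Longrightarrow> bdd_borel d \<Longrightarrow> fmul c (fmul d f) = fmul (\<lambda>p. c p * d p) f"
  by (simp add: fmul_def mulop_mulop)

lemma bounded_op_fmul:
  assumes "bdd_borel c" shows "bounded_op (fmul c)"
  unfolding fmul_def[abs_def]
  by (rule bounded_op_comp[OF bounded_op_ifourier bounded_op_comp[OF bounded_op_mulop[OF assms] bounded_op_fourier]])

lemma adjoint_pair_fmul:
  assumes "bdd_borel c" shows "adjoint_pair (fmul c) (fmul c)"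
  unfolding fmul_def[abs_def]
  by (rule adjoint_pair_comp[OF adjoint_pair_sym[OF adjoint_pair_fourier]
        adjoint_pair_comp[OF adjoint_pair_mulop[OF assms] adjoint_pair_fourier]])

lemma multiplier_unique: "multiplier a f g \<Longrightarrow> multiplier a f h \<Longrightarrow> g = h"
proof -
  assume "multiplier a f g" "multiplier a f h"
  then have "AE p in lborel. rep_L2 (fourier g) p = rep_L2 (fourier h) p"
    unfolding multiplier_def by eventually_elim simp
  then have "fourier g = fourier h" by (rule L2_eqI)
  then show "g = h" by (simp only: fourier_inj)
qed

text \<open>The cut-off functions \<open>fmul (indicator A) f\<close> with \<open>A\<close> a sublevel set of \<open>\<bar>h\<bar>\<close> lie in the
  domain of \<open>h(-i\<nabla>)\<close> and are dense, which determines a bounded extension of \<open>h \<gamma> h\<close>.\<close>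

lemma sandwich_unique:
  fixes h :: "'a::euclidean_space \<Rightarrow> real"
  assumes h: "h \<in> borel_measurable borel" and T: "sandwich h \<gamma> T" and T': "sandwich h \<gamma> T'"
  shows "T = T'"
proof
  fix f
  note h [measurable]
  define A where "A n = {p. \<bar>h p\<bar> \<le> real n}" for n :: nat
  have A: "A n \<in> sets borel" for n unfolding A_def by measurable
  have Tf: "T (fmul (indicator (A n)) f) = T' (fmul (indicator (A n)) f)" for n
  proof -
    have b1: "bdd_borel (indicator (A n))" by (rule bdd_borel_indicator[OF A])
    have b2: "bdd_borel (\<lambda>p. h p * indicator (A n) p)"
      by (rule bdd_borelI[of _ "real n"]) (use A in \<open>auto simp: A_def indicator_def\<close>)
    have "multiplier h (fmul (indicator (A n)) f) (fmul (\<lambda>p. h p * indicator (A n) p) f)"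
      unfolding multiplier_def using rep_fourier_fmul[OF b1, of f] rep_fourier_fmul[OF b2, of f]
      by eventually_elim simp
    then show ?thesis using T T' unfolding sandwich_def by (blast intro: multiplier_unique)
  qed
  have "(\<lambda>n. mulop (indicator (A n)) (fourier f)) \<longlonglongrightarrow> fourier f"
  proof (rule mulop_indicator_tendsto[OF A])
    fix p
    obtain N where "\<bar>h p\<bar> \<le> real N" using real_arch_simple by blast
    then show "\<forall>\<^sub>F n in sequentially. p \<in> A n"
      by (intro eventually_sequentiallyI[of N]) (auto simp: A_def)
  qed
  then have lim: "(\<lambda>n. fmul (indicator (A n)) f) \<longlonglongrightarrow> f"
    using bounded_op_tendsto[OF bounded_op_ifourier] unfolding fmul_def by fastforce
  have "(\<lambda>n. T (fmul (indicator (A n)) f)) \<longlonglongrightarrow> T f" "(\<lambda>n. T' (fmul (indicator (A n)) f)) \<longlonglongrightarrow> T' f"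
    using T T' lim by (auto simp: sandwich_def intro: bounded_op_tendsto)
  then show "T f = T' f" unfolding Tf by (rule LIMSEQ_unique)
qed

text \<open>If \<open>b \<gamma> b\<close> is bounded and \<open>h = c b\<close> with \<open>c\<close> bounded, then \<open>h \<gamma> h = c (b \<gamma> b) c\<close>. This gives all
  the weighted operators of the energy from the single one that membership in \<^const>\<open>X_space\<close>
  provides.\<close>

lemma sandwich_mult:
  assumes T: "sandwich b \<gamma> T" and c: "bdd_borel c" and h: "\<And>p. h p = c p * b p"
  shows "sandwich h \<gamma> (fconj c T)"
  unfolding sandwich_def
proof (intro conjI allI impI)
  have bT: "bounded_op T" using T by (simp add: sandwich_def)
  show "bounded_op (fconj c T)"
    by (rule bounded_op_comp[OF bounded_op_fmul[OF c] bounded_op_comp[OF bT bounded_op_fmul[OF c]]])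
  fix f g assume "multiplier h f g"
  then have "multiplier b (fmul c f) g"
    unfolding multiplier_def using rep_fourier_fmul[OF c, of f] by eventually_elim (simp add: h)
  then have "multiplier b (\<gamma> g) (T (fmul c f))" using T by (simp add: sandwich_def)
  then show "multiplier h (\<gamma> g) (fmul c (T (fmul c f)))"
    unfolding multiplier_def using rep_fourier_fmul[OF c, of "T (fmul c f)"] by eventually_elim (simp add: h)
qed

lemma sandwich_inverse:
  assumes T: "sandwich b \<gamma> T" and b: "bdd_borel (\<lambda>p. inverse (b p))" "\<And>p. b p \<noteq> 0"
  shows "\<gamma> g = fmul (\<lambda>p. inverse (b p)) (T (fmul (\<lambda>p. inverse (b p)) g))"
proof -
  let ?M = "fmul (\<lambda>p. inverse (b p))"
  have "multiplier b (?M g) g"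
    unfolding multiplier_def using rep_fourier_fmul[OF b(1), of g] by eventually_elim (simp add: b)
  then have "multiplier b (\<gamma> g) (T (?M g))" using T by (simp add: sandwich_def)
  then have "AE p in lborel. rep_L2 (fourier (\<gamma> g)) p = rep_L2 (fourier (?M (T (?M g)))) p"
    unfolding multiplier_def using rep_fourier_fmul[OF b(1), of "T (?M g)"]
    by eventually_elim (simp add: b)
  then have "fourier (\<gamma> g) = fourier (?M (T (?M g)))" by (rule L2_eqI)
  then show ?thesis by (simp only: fourier_inj)
qed

subsection \<open>Multipliers and dilations\<close>

lemma multiplier_dil:
  assumes s: "0 < s" and m: "multiplier (\<lambda>p. h (s *\<^sub>R p)) f g"
  shows "multiplier h (dil s f) (dil s g)"
proof -
  have s': "0 < inverse s" using s by simp
  show ?thesis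
    unfolding multiplier_def fourier_dil[OF s]
    using rep_dil[OF s', of "fourier f"] rep_dil[OF s', of "fourier g"] AE_dil[OF s' m[unfolded multiplier_def]]
    by eventually_elim (use s in simp)
qed

lemma multiplier_dil_iff:
  assumes s: "0 < s"
  shows "multiplier h (dil s f) (dil s g) \<longleftrightarrow> multiplier (\<lambda>p. h (s *\<^sub>R p)) f g"
proof
  assume "multiplier h (dil s f) (dil s g)"
  then have "multiplier (\<lambda>p. h (s *\<^sub>R (inverse s *\<^sub>R p))) (dil s f) (dil s g)" using s by simp
  then show "multiplier (\<lambda>p. h (s *\<^sub>R p)) f g"
    using multiplier_dil[of "inverse s" "\<lambda>p. h (s *\<^sub>R p)" "dil s f" "dil s g"] s by simp
qed (rule multiplier_dil[OF s])

definition dilop :: "real \<Rightarrow> 'a::euclidean_space op \<Rightarrow> 'a L2 \<Rightarrow> 'a L2" where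
  "dilop s T f = dil s (T (dil (inverse s) f))"

lemma bounded_op_dilop: "0 < s \<Longrightarrow> bounded_op T \<Longrightarrow> bounded_op (dilop s T)"
  unfolding dilop_def[abs_def]
  by (rule bounded_op_comp[OF bounded_op_dil bounded_op_comp[OF _ bounded_op_dil]]) auto

lemma sandwich_dilop:
  assumes s: "0 < s" and T: "sandwich (\<lambda>p. h (s *\<^sub>R p)) \<gamma> T"
  shows "sandwich h (dilop s \<gamma>) (dilop s T)"
  unfolding sandwich_def
proof (intro conjI allI impI)
  show "bounded_op (dilop s T)" using T s by (simp add: sandwich_def bounded_op_dilop)
  fix f g assume "multiplier h f g"
  then have "multiplier h (dil s (dil (inverse s) f)) (dil s (dil (inverse s) g))" using s by simp
  then have "multiplier (\<lambda>p. h (s *\<^sub>R p)) (dil (inverse s) f) (dil (inverse s) g)"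
    by (simp add: multiplier_dil_iff[OF s])
  then have "multiplier (\<lambda>p. h (s *\<^sub>R p)) (\<gamma> (dil (inverse s) g)) (T (dil (inverse s) f))"
    using T by (simp add: sandwich_def)
  then show "multiplier h (dilop s \<gamma> g) (dilop s T f)"
    by (simp add: dilop_def multiplier_dil_iff[OF s])
qed

lemma nuclear_rep_dilop:
  assumes s: "0 < s" and T: "nuclear_rep T f g"
  shows "nuclear_rep (dilop s T) (\<lambda>k. dil s (f k)) (\<lambda>k. dil s (g k))"
proof -
  have s': "0 < inverse s" using s by simp
  have "adjoint_pair (dil (inverse s)) (dil s)" using adjoint_pair_dil[OF s'] by simp
  then show ?thesis
    unfolding dilop_def[abs_def]
    using nuclear_rep_conjugate[OF T bounded_op_dil[OF s] _ bounded_op_dil[OF s]] by blast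
qed

lemma trace_class_dilop: "0 < s \<Longrightarrow> trace_class T \<Longrightarrow> trace_class (dilop s T)"
  unfolding trace_class_def using bounded_op_dilop nuclear_rep_dilop by blast

lemma op_trace_dilop:
  fixes T :: "'a::euclidean_space op" and e :: "nat \<Rightarrow> 'a L2"
  assumes s: "0 < s" and e: "onb e" and T: "trace_class T"
  shows "op_trace (dilop s T) = op_trace T"
proof -
  obtain f g where fg: "nuclear_rep T f g" using T by (auto simp: trace_class_def)
  show ?thesis
    unfolding op_trace_onb[OF e fg] op_trace_onb[OF e nuclear_rep_dilop[OF s fg]] cinner_dil[OF s] ..
qed

lemma trace_class_fmul:
  assumes T: "trace_class T" and c: "bdd_borel c"
  shows "trace_class (fconj c T)"
  using T nuclear_rep_conjugate[OF _ bounded_op_fmul[OF c] adjoint_pair_fmul[OF c] bounded_op_fmul[OF c]]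
    bounded_op_comp[OF bounded_op_fmul[OF c] bounded_op_comp[OF _ bounded_op_fmul[OF c]]]
  unfolding trace_class_def by blast

subsection \<open>The momentum density\<close>

lemma op_trace_fmul:
  fixes T :: "'a::euclidean_space op" and e :: "nat \<Rightarrow> 'a L2"
  assumes e: "onb e" and fg: "nuclear_rep T f g" and c: "bdd_borel c"
  shows "op_trace (fconj c T)
    = (\<integral>p. complex_of_real (c p * c p) * pair_density (\<lambda>k. fourier (f k)) (\<lambda>k. fourier (g k)) p \<partial>lborel)"
proof -
  have "nuclear_rep (fconj c T) (\<lambda>k. fmul c (f k)) (\<lambda>k. fmul c (g k))"
    by (rule nuclear_rep_conjugate[OF fg bounded_op_fmul[OF c] adjoint_pair_fmul[OF c] bounded_op_fmul[OF c]])
  then have "op_trace (fconj c T) = (\<Sum>k. cinner (fmul c (g k)) (fmul c (f k)))"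
    by (rule op_trace_onb[OF e])
  also have "(\<lambda>k. cinner (fmul c (g k)) (fmul c (f k)))
      = (\<lambda>k. cinner (fourier (g k)) (mulop (\<lambda>p. c p * c p) (fourier (f k))))"
  proof
    fix k
    have "cinner (fmul c (g k)) (fmul c (f k)) = cinner (mulop c (fourier (g k))) (mulop c (fourier (f k)))"
      by (metis cinner_fourier fourier_fmul)
    also have "\<dots> = cinner (fourier (g k)) (mulop c (mulop c (fourier (f k))))"
      using adjoint_pair_mulop[OF c] unfolding adjoint_pair_def by blast
    finally show "cinner (fmul c (g k)) (fmul c (f k)) = cinner (fourier (g k)) (mulop (\<lambda>p. c p * c p) (fourier (f k)))"
      by (simp add: mulop_mulop[OF c c])
  qed
  also have "suminf \<dots> = (\<integral>p. complex_of_real (c p * c p) * pair_density (\<lambda>k. fourier (f k)) (\<lambda>k. fourier (g k)) p \<partial>lborel)"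
    using fg by (intro sums_unique[symmetric] pair_density_integral(2) bdd_borel_mult[OF c c]) (simp add: nuclear_rep_def)
  finally show ?thesis .
qed

lemma trace_mult_eq:
  assumes h: "(\<lambda>p. sqrt (a p)) \<in> borel_measurable borel" and T: "sandwich (\<lambda>p. sqrt (a p)) \<gamma> T"
  shows "trace_mult a \<gamma> = Re (op_trace T)"
proof -
  have "(THE T. sandwich (\<lambda>p. sqrt (a p)) \<gamma> T) = T"
    using T sandwich_unique[OF h] by (intro the_equality) auto
  then show ?thesis by (simp add: trace_mult_def)
qed

text \<open>For \<open>b \<ge> 1\<close> with \<open>b \<gamma> b\<close> trace class, everything is read off from the diagonal \<open>\<tau>\<close> of
  \<open>b \<gamma> b\<close> in momentum space: the density of \<open>\<gamma>\<close> is \<open>\<tau> / b\<^sup>2\<close>, and \<open>a(-i\<nabla>)\<close> with \<open>a = O(b\<^sup>2)\<close> only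
  involves the bounded multiplier \<open>a / b\<^sup>2\<close> of \<open>\<tau>\<close>.\<close>

lemma momentum_density:
  fixes \<gamma> T :: "'a::euclidean_space op" and e :: "nat \<Rightarrow> 'a L2" and b :: "'a \<Rightarrow> real"
  assumes e: "onb e" and T: "sandwich b \<gamma> T" "trace_class T"
    and b: "b \<in> borel_measurable borel" "\<And>p. 1 \<le> b p"
    and pos: "\<And>f. 0 \<le> f \<bullet> \<gamma> f"
  obtains \<sigma> :: "'a \<Rightarrow> real" where "\<sigma> \<in> borel_measurable borel" "AE p in lborel. 0 \<le> \<sigma> p"
    "integrable lborel (\<lambda>p. (b p)\<^sup>2 * \<sigma> p)" "Re (op_trace \<gamma>) = (\<integral>p. \<sigma> p \<partial>lborel)"
    "\<And>a K. a \<in> borel_measurable borel \<Longrightarrow> (\<And>p. 0 \<le> a p) \<Longrightarrow> (\<And>p. a p \<le> K * (b p)\<^sup>2) \<Longrightarrow>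
      \<exists>S. sandwich (\<lambda>p. sqrt (a p)) \<gamma> S \<and> trace_class S \<and> trace_mult a \<gamma> = (\<integral>p. a p * \<sigma> p \<partial>lborel)"
proof -
  note b(1) [measurable]
  have b0: "0 < b p" "b p \<noteq> 0" for p using b(2)[of p] by auto
  have bi: "bdd_borel (\<lambda>p. inverse (b p))"
  proof (rule bdd_borelI[of _ 1])
    show "\<bar>inverse (b p)\<bar> \<le> 1" for p
      using b(2)[of p] by (simp add: inverse_le_1_iff abs_if)
  qed measurable
  obtain f g where fg: "nuclear_rep T f g" using T(2) by (auto simp: trace_class_def)
  define \<tau> where "\<tau> = pair_density (\<lambda>k. fourier (f k)) (\<lambda>k. fourier (g k))"
  have sF: "summable (\<lambda>k. norm (fourier (f k)) * norm (fourier (g k)))"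
    using fg by (simp add: nuclear_rep_def)
  have \<tau>: "integrable lborel \<tau>" unfolding \<tau>_def by (rule integrable_pair_density[OF sF])
  have c\<tau>: "integrable lborel (\<lambda>p. complex_of_real (c p) * \<tau> p)" if "bdd_borel c" for c
    unfolding \<tau>_def by (rule pair_density_integral(1)[OF sF that])
  have Rec: "Re (\<integral>p. complex_of_real (c p) * \<tau> p \<partial>lborel) = (\<integral>p. c p * Re (\<tau> p) \<partial>lborel)" if "bdd_borel c" for c
    using integral_Re[OF c\<tau>[OF that], symmetric] by simp
  have tr: "Re (op_trace (fconj c T)) = (\<integral>p. c p * c p * Re (\<tau> p) \<partial>lborel)" if c: "bdd_borel c" for c
    unfolding op_trace_fmul[OF e fg c] \<tau>_def[symmetric] by (rule Rec[OF bdd_borel_mult[OF c c]])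
  have [measurable]: "\<tau> \<in> borel_measurable borel" using \<tau> by (auto dest: borel_measurable_integrable)
  define \<sigma> where "\<sigma> p = Re (\<tau> p) / (b p)\<^sup>2" for p
  have \<sigma>m: "\<sigma> \<in> borel_measurable borel" unfolding \<sigma>_def by measurable
  have \<gamma>: "\<gamma> = (\<lambda>h. fmul (\<lambda>p. inverse (b p)) (T (fmul (\<lambda>p. inverse (b p)) h)))"
    using sandwich_inverse[OF T(1) bi b0(2)] by blast
  have \<sigma>i: "inverse (b p) * inverse (b p) * Re (\<tau> p) = \<sigma> p" for p
    by (simp add: \<sigma>_def field_simps power2_eq_square)
  show ?thesis
  proof (rule that[OF \<sigma>m])
    have "Re (complex_of_real (inverse (b p) * inverse (b p)) * \<tau> p) = \<sigma> p" for p
      unfolding \<sigma>i[symmetric] by (simp del: of_real_mult of_real_inverse)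
    then have \<sigma>int: "integrable lborel \<sigma>"
      using integrable_Re[OF c\<tau>[OF bdd_borel_mult[OF bi bi]]] by (simp only:)
    show "AE p in lborel. 0 \<le> \<sigma> p"
    proof (rule sigma_finite_measure.density_nonneg[OF sigma_finite_lborel \<sigma>int])
      fix A :: "'a set" assume "A \<in> sets lborel"
      then have A: "bdd_borel (indicator A)" by (simp add: bdd_borel_indicator)
      let ?c = "\<lambda>p. indicator A p * inverse (b p)"
      have c: "bdd_borel ?c" by (rule bdd_borel_mult[OF A bi])
      \<comment> \<open>The integral of \<open>\<sigma>\<close> over \<open>A\<close> is the trace of \<open>\<gamma>\<close> compressed to the momenta in \<open>A\<close>.\<close>
      have fc: "fmul (indicator A) (\<gamma> (fmul (indicator A) h)) = fmul ?c (T (fmul ?c h))" for h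
        unfolding \<gamma> by (simp add: fmul_fmul A bi mult.commute)
      have nr: "nuclear_rep (fconj ?c T) (\<lambda>k. fmul ?c (f k)) (\<lambda>k. fmul ?c (g k))"
        by (rule nuclear_rep_conjugate[OF fg bounded_op_fmul[OF c] adjoint_pair_fmul[OF c] bounded_op_fmul[OF c]])
      from nuclear_trace_sums[OF e nr]
      have "(\<lambda>j. cinner (e j) (fmul ?c (T (fmul ?c (e j))))) sums op_trace (fconj ?c T)"
        unfolding op_trace_onb[OF e nr] .
      then have sm: "(\<lambda>j. Re (cinner (e j) (fmul ?c (T (fmul ?c (e j)))))) sums Re (op_trace (fconj ?c T))"
        by (rule sums_Re)
      have ge: "0 \<le> Re (cinner (e j) (fmul ?c (T (fmul ?c (e j)))))" for j
      proof -
        have "cinner (e j) (fmul (indicator A) (\<gamma> (fmul (indicator A) (e j))))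
            = cinner (fmul (indicator A) (e j)) (\<gamma> (fmul (indicator A) (e j)))"
          using adjoint_pair_fmul[OF A] by (simp add: adjoint_pair_def)
        then show ?thesis
          using pos[of "fmul (indicator A) (e j)"] unfolding fc inner_L2_def by simp
      qed
      have "0 \<le> Re (op_trace (fconj ?c T))"
        by (rule sums_le[OF ge sums_zero sm])
      also have "\<dots> = (\<integral>p. ?c p * ?c p * Re (\<tau> p) \<partial>lborel)" by (rule tr[OF c])
      also have "\<dots> = (LINT p:A|lborel. \<sigma> p)"
        unfolding set_lebesgue_integral_def
        by (intro Bochner_Integration.integral_cong refl) (auto simp: \<sigma>i[symmetric] indicator_def)
      finally show "0 \<le> (LINT p:A|lborel. \<sigma> p)" .
    qed
    have "(b p)\<^sup>2 * \<sigma> p = Re (\<tau> p)" for p using b0 by (simp add: \<sigma>_def)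
    then show "integrable lborel (\<lambda>p. (b p)\<^sup>2 * \<sigma> p)" using \<tau> by simp
    have "Re (op_trace \<gamma>) = (\<integral>p. inverse (b p) * inverse (b p) * Re (\<tau> p) \<partial>lborel)"
      by (subst \<gamma>) (rule tr[OF bi])
    then show "Re (op_trace \<gamma>) = (\<integral>p. \<sigma> p \<partial>lborel)" by (simp add: \<sigma>i)
    fix a :: "'a \<Rightarrow> real" and K
    assume a[measurable]: "a \<in> borel_measurable borel" and a0: "\<And>p. 0 \<le> a p" and aK: "\<And>p. a p \<le> K * (b p)\<^sup>2"
    let ?c = "\<lambda>p. sqrt (a p) / b p"
    have c: "bdd_borel ?c"
    proof (rule bdd_borelI[of _ "sqrt K"])
      fix p
      have "sqrt (a p) \<le> sqrt (K * (b p)\<^sup>2)" using aK by simp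
      also have "\<dots> = sqrt K * b p" using b0(1)[of p] by (simp add: real_sqrt_mult)
      finally show "\<bar>sqrt (a p) / b p\<bar> \<le> sqrt K" using b0(1)[of p] a0[of p] by (simp add: field_simps)
    qed measurable
    let ?S = "fconj ?c T"
    have S: "sandwich (\<lambda>p. sqrt (a p)) \<gamma> ?S"
      by (rule sandwich_mult[OF T(1) c]) (use b0 in simp)
    have cc: "?c p * ?c p * Re (\<tau> p) = a p * \<sigma> p" for p
      using a0[of p] by (simp add: \<sigma>_def power2_eq_square)
    have "trace_mult a \<gamma> = Re (op_trace ?S)" by (rule trace_mult_eq[OF _ S]) measurable
    also have "\<dots> = (\<integral>p. a p * \<sigma> p \<partial>lborel)" unfolding tr[OF c] cc ..
    finally show "\<exists>S. sandwich (\<lambda>p. sqrt (a p)) \<gamma> S \<and> trace_class S \<and> trace_mult a \<gamma> = (\<integral>p. a p * \<sigma> p \<partial>lborel)"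
      using S trace_class_fmul[OF T(2) c] by blast
  qed
qed

lemma trace_mult_dilop:
  fixes \<gamma> :: "'a::euclidean_space op" and e :: "nat \<Rightarrow> 'a L2"
  assumes s: "0 < s" and e: "onb e" and a: "a \<in> borel_measurable borel"
    and S: "sandwich (\<lambda>p. sqrt (a (s *\<^sub>R p))) \<gamma> S" "trace_class S"
  shows "trace_mult a (dilop s \<gamma>) = trace_mult (\<lambda>p. a (s *\<^sub>R p)) \<gamma>"
proof -
  note a [measurable]
  have "trace_mult a (dilop s \<gamma>) = Re (op_trace (dilop s S))"
    by (rule trace_mult_eq) (measurable, rule sandwich_dilop[OF s, where h = "\<lambda>p. sqrt (a p)", OF S(1)])
  also have "\<dots> = Re (op_trace S)" by (simp add: op_trace_dilop[OF s e S(2)])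
  also have "\<dots> = trace_mult (\<lambda>p. a (s *\<^sub>R p)) \<gamma>"
    by (rule trace_mult_eq[symmetric, OF _ S(1)]) measurable
  finally show ?thesis .
qed

section \<open>Integral kernels\<close>

subsection \<open>Tensor products\<close>

lemma AE_lborel_fst_snd:
  assumes "AE x in (lborel :: 'a::euclidean_space measure). P x"
  shows AE_lborel_fst: "AE w in (lborel :: ('a \<times> 'b::euclidean_space) measure). P (fst w)"
    and AE_lborel_snd: "AE w in (lborel :: ('b \<times> 'a) measure). P (snd w)"
proof -
  obtain N where N: "{x. \<not> P x} \<subseteq> N" "N \<in> null_sets lborel"
    using AE_E3[OF assms] by (metis (no_types, lifting) Diff_iff UNIV_I mem_Collect_eq space_borel space_lborel subsetI)
  then have "N \<times> (UNIV :: 'b set) \<in> null_sets (lborel \<Otimes>\<^sub>M lborel)"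
      "(UNIV :: 'b set) \<times> N \<in> null_sets (lborel \<Otimes>\<^sub>M lborel)"
    by (auto intro!: null_setsI pair_measureI trans[OF lborel.emeasure_pair_measure_Times])
  then have "AE w in lborel. w \<notin> N \<times> (UNIV :: 'b set)" "AE w in lborel. w \<notin> (UNIV :: 'b set) \<times> N"
    unfolding lborel_prod by (auto intro: AE_not_in)
  then show "AE w in (lborel :: ('a \<times> 'b) measure). P (fst w)" "AE w in (lborel :: ('b \<times> 'a) measure). P (snd w)"
    using N(1) by (auto elim!: eventually_mono)
qed

definition tensor :: "'a::euclidean_space L2 \<Rightarrow> 'a L2 \<Rightarrow> ('a \<times> 'a) L2" where
  "tensor f g = abs_L2 (\<lambda>w. rep_L2 f (fst w) * cnj (rep_L2 g (snd w)))"

lemma measurable_pair_fun [measurable]: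
  fixes u :: "'a::euclidean_space \<Rightarrow> 'c::topological_space"
  assumes "u \<in> borel_measurable borel"
  shows "(\<lambda>w::'a \<times> 'b::euclidean_space. u (fst w)) \<in> borel_measurable borel"
    and "(\<lambda>w::'b \<times> 'a. u (snd w)) \<in> borel_measurable borel"
  by (rule measurable_compose[OF _ assms], simp add: borel_measurable_continuous_onI continuous_on_fst continuous_on_snd)+

lemma sq_integrable_tensor:
  fixes f g :: "'a::euclidean_space L2"
  shows "sq_integrable (\<lambda>w::'a \<times> 'a. rep_L2 f (fst w) * cnj (rep_L2 g (snd w)))"
  unfolding sq_integrable_def
proof
  show "(\<lambda>w::'a \<times> 'a. rep_L2 f (fst w) * cnj (rep_L2 g (snd w))) \<in> borel_measurable borel"
    by (intro borel_measurable_times borel_measurable_cnj measurable_pair_fun) auto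
  have "integrable (lborel :: ('a \<times> 'a) measure)
      (\<lambda>w. complex_of_real ((cmod (rep_L2 f (fst w)))\<^sup>2) * complex_of_real ((cmod (rep_L2 g (snd w)))\<^sup>2))"
    by (rule integrable_pair_mult(1)) (simp_all only: complex_of_real_integrable_eq integrable_rep_square)
  then show "integrable lborel (\<lambda>w::'a \<times> 'a. (cmod (rep_L2 f (fst w) * cnj (rep_L2 g (snd w))))\<^sup>2)"
    by (simp only: of_real_mult[symmetric] complex_of_real_integrable_eq norm_mult complex_mod_cnj power_mult_distrib)
qed

lemma rep_tensor: "AE w in lborel. rep_L2 (tensor f g) w = rep_L2 f (fst w) * cnj (rep_L2 g (snd w))"
  unfolding tensor_def by (rule rep_abs_L2[OF sq_integrable_tensor])

lemma cinner_tensor: "cinner (tensor f g) (tensor f' g') = cinner f f' * cinner g' g"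
proof -
  have "cinner (tensor f g) (tensor f' g')
      = (\<integral>w. (cnj (rep_L2 f (fst w)) * rep_L2 f' (fst w)) * (cnj (rep_L2 g' (snd w)) * rep_L2 g (snd w)) \<partial>lborel)"
    unfolding tensor_def cinner_abs[OF sq_integrable_tensor sq_integrable_tensor] by (simp add: mult_ac)
  also have "\<dots> = cinner f f' * cinner g' g"
    unfolding cinner_rep by (rule integrable_pair_mult(2)[OF integrable_rep_mult integrable_rep_mult])
  finally show ?thesis .
qed

lemma norm_tensor: "norm (tensor f g) = norm f * norm g"
  by (rule norm_eq_of_cinner, unfold cinner_tensor) (simp_all add: cinner_self power_mult_distrib)

lemma dil_tensor:
  fixes f g :: "'a::euclidean_space L2"
  assumes s: "0 < s" shows "dil s (tensor f g) = tensor (dil s f) (dil s g)"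
proof (rule L2_eqI)
  have p: "s powr (real DIM('a \<times> 'a) / 2) = s powr (real DIM('a) / 2) * s powr (real DIM('a) / 2)"
    by (simp flip: powr_add)
  show "AE w in lborel. rep_L2 (dil s (tensor f g)) w = rep_L2 (tensor (dil s f) (dil s g)) w"
    using rep_dil[OF s, of "tensor f g"] AE_dil[OF s rep_tensor[of f g]] rep_tensor[of "dil s f" "dil s g"]
      AE_lborel_fst[OF rep_dil[OF s, of f], where 'b = 'a] AE_lborel_snd[OF rep_dil[OF s, of g], where 'b = 'a]
    by eventually_elim (simp only: p fst_scaleR snd_scaleR of_real_mult complex_cnj_mult complex_cnj_complex_of_real mult_ac)
qed

subsection \<open>Weak characterisation of the kernel\<close>

text \<open>Tested against \<open>g\<close>, the kernel equation becomes the pairing of \<open>K\<close> with the function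
  \<open>g x * cnj (f y)\<close>. In this form it passes to limits of \<open>K\<close> in \<open>L\<^sup>2\<close>, and two kernels of the
  same operator are seen to agree because products of boxes are boxes.\<close>

definition weak_kernel :: "'a::euclidean_space op \<Rightarrow> ('a \<times> 'a) L2 \<Rightarrow> bool" where
  "weak_kernel T K \<longleftrightarrow> (\<forall>f g. cinner g (T f) = cinner (tensor g f) K)"

abbreviation kernel_apply :: "('a::euclidean_space \<times> 'a) L2 \<Rightarrow> 'a L2 \<Rightarrow> 'a \<Rightarrow> complex" where
  "kernel_apply K f x \<equiv> \<integral>y. rep_L2 K (x, y) * rep_L2 f y \<partial>lborel"

text \<open>Fubini's theorem for the pairing in \<open>L\<^sup>2\<close> of the product space.\<close>

lemma integrable_tensor_kernel:
  fixes f g :: "'a::euclidean_space L2" and K :: "('a \<times> 'a) L2"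
  shows "integrable (lborel \<Otimes>\<^sub>M lborel) (\<lambda>w. cnj (rep_L2 g (fst w)) * rep_L2 f (snd w) * rep_L2 K w)"
    and "cinner (tensor g f) K = (\<integral>x. cnj (rep_L2 g x) * kernel_apply K f x \<partial>lborel)"
    and "integrable lborel (\<lambda>x. cnj (rep_L2 g x) * kernel_apply K f x)"
proof -
  have 1: "integrable lborel (\<lambda>w. cnj (rep_L2 g (fst w) * cnj (rep_L2 f (snd w))) * rep_L2 K w)"
    by (rule integrable_cnj_mult[OF sq_integrable_tensor]) simp
  then show 2: "integrable (lborel \<Otimes>\<^sub>M lborel) (\<lambda>w. cnj (rep_L2 g (fst w)) * rep_L2 f (snd w) * rep_L2 K w)"
    by (simp add: lborel_prod)
  have inner: "(\<integral>y. cnj (rep_L2 g (fst (x, y))) * rep_L2 f (snd (x, y)) * rep_L2 K (x, y) \<partial>lborel)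
      = cnj (rep_L2 g x) * kernel_apply K f x" for x
    by (simp only: fst_conv snd_conv mult.assoc integral_mult_right_zero) (simp only: mult.commute)
  have "cinner (tensor g f) (abs_L2 (rep_L2 K)) = (\<integral>w. cnj (rep_L2 g (fst w)) * rep_L2 f (snd w) * rep_L2 K w \<partial>lborel)"
    unfolding tensor_def by (subst cinner_abs[OF sq_integrable_tensor]) auto
  also have "\<dots> = (\<integral>x. cnj (rep_L2 g x) * kernel_apply K f x \<partial>lborel)"
    using lborel_pair.integral_fst'[OF 2] unfolding inner by (simp only: lborel_prod)
  finally show "cinner (tensor g f) K = (\<integral>x. cnj (rep_L2 g x) * kernel_apply K f x \<partial>lborel)"
    by simp
  show "integrable lborel (\<lambda>x. cnj (rep_L2 g x) * kernel_apply K f x)"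
    using lborel_pair.integrable_fst'[OF 2] unfolding inner .
qed

lemma measurable_kernel_section [measurable]:
  fixes f :: "'a::euclidean_space L2" and K :: "('a \<times> 'a) L2"
  shows "kernel_apply K f \<in> borel_measurable borel"
proof -
  have [measurable]: "rep_L2 K \<in> borel_measurable (borel \<Otimes>\<^sub>M lborel)"
  proof -
    have "sets ((borel :: 'a measure) \<Otimes>\<^sub>M (lborel :: 'a measure)) = sets borel"
      by (rule trans[OF sets_pair_measure_cong[OF refl sets_lborel] arg_cong[OF borel_prod, of sets]])
    then show ?thesis by (simp cong: measurable_cong_sets)
  qed
  show ?thesis by measurable
qed

lemma weak_kernel_iff:
  fixes T :: "'a::euclidean_space op"
  shows "weak_kernel T K \<longleftrightarrow>
    (\<forall>f. AE x in lborel. rep_L2 (T f) x = kernel_apply K f x)"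
proof
  assume K: "\<forall>f. AE x in lborel. rep_L2 (T f) x = kernel_apply K f x"
  show "weak_kernel T K"
    unfolding weak_kernel_def
  proof (intro allI)
    fix f g
    have "AE x in lborel. rep_L2 (T f) x = kernel_apply K f x" using K by blast
    then have "AE x in lborel. cnj (rep_L2 g x) * rep_L2 (T f) x = cnj (rep_L2 g x) * kernel_apply K f x"
      by eventually_elim simp
    then show "cinner g (T f) = cinner (tensor g f) K"
      unfolding integrable_tensor_kernel(2) cinner_rep[of g] by (intro integral_cong_AE) auto
  qed
next
  assume K: "weak_kernel T K"
  show "\<forall>f. AE x in lborel. rep_L2 (T f) x = kernel_apply K f x"
  proof
    fix f
    let ?k = "kernel_apply K f"
    have "AE x in lborel. rep_L2 (T f) x - ?k x = 0"
    proof (rule AE_zero_if_box_integrals_zero)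
      fix a b :: 'a
      let ?g = "abs_L2 (ind_box a b)"
      have g: "AE x in lborel. cnj (rep_L2 ?g x) * h x = indicator (box a b) x *\<^sub>R h x" for h :: "'a \<Rightarrow> complex"
        using rep_abs_L2[OF ind_box_props(2)[of a b]]
        by eventually_elim (auto simp: ind_box_def indicator_def)
      have iT: "integrable lborel (\<lambda>x. indicator (box a b) x *\<^sub>R rep_L2 (T f) x)"
        by (rule integrable_cong_AE_imp[OF integrable_rep_mult[of ?g "T f"]]) (use g in auto)
      have ik: "integrable lborel (\<lambda>x. indicator (box a b) x *\<^sub>R ?k x)"
        by (rule integrable_cong_AE_imp[OF integrable_tensor_kernel(3)[of ?g K f]]) (use g in auto)
      show "set_integrable lborel (box a b) (\<lambda>x. rep_L2 (T f) x - ?k x)"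
        unfolding set_integrable_def scaleR_diff_right by (rule Bochner_Integration.integrable_diff[OF iT ik])
      have "(\<integral>x. indicator (box a b) x *\<^sub>R rep_L2 (T f) x \<partial>lborel) = cinner ?g (T f)"
        unfolding cinner_rep by (rule integral_cong_AE) (use g[of "rep_L2 (T f)"] in \<open>auto elim: eventually_mono\<close>)
      moreover have "(\<integral>x. indicator (box a b) x *\<^sub>R ?k x \<partial>lborel) = cinner (tensor ?g f) K"
        unfolding integrable_tensor_kernel(2) by (rule integral_cong_AE) (use g[of ?k] in \<open>auto elim: eventually_mono\<close>)
      ultimately show "(LINT x:box a b|lborel. rep_L2 (T f) x - ?k x) = 0"
        using K unfolding set_lebesgue_integral_def scaleR_diff_right
        by (simp add: Bochner_Integration.integral_diff[OF iT ik] weak_kernel_def)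
    qed
    then show "AE x in lborel. rep_L2 (T f) x = ?k x" by eventually_elim simp
  qed
qed

lemma weak_kernel_unique:
  fixes T :: "'a::euclidean_space op"
  assumes "weak_kernel T K" "weak_kernel T K'" shows "K = K'"
proof -
  have "cinner (abs_L2 (ind_box a b)) (K - K') = 0" for a b :: "'a \<times> 'a"
  proof -
    let ?g = "abs_L2 (ind_box (fst a) (fst b))" and ?f = "abs_L2 (ind_box (snd a) (snd b))"
    have "abs_L2 (ind_box a b) = tensor ?g ?f"
    proof (rule L2_eqI)
      have factor: "ind_box a b w = ind_box (fst a) (fst b) (fst w) * cnj (ind_box (snd a) (snd b) (snd w))" for w
        by (cases a, cases b, cases w) (auto simp: ind_box_def indicator_def box_def Basis_prod_def ball_Un)
      show "AE w in lborel. rep_L2 (abs_L2 (ind_box a b)) w = rep_L2 (tensor ?g ?f) w"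
        using rep_abs_L2[OF ind_box_props(2)[of a b]] rep_tensor[of ?g ?f]
          AE_lborel_fst[OF rep_abs_L2[OF ind_box_props(2)[of "fst a" "fst b"]], where 'b = 'a]
          AE_lborel_snd[OF rep_abs_L2[OF ind_box_props(2)[of "snd a" "snd b"]], where 'b = 'a]
        by eventually_elim (simp only: factor)
    qed
    then show ?thesis using assms by (simp add: weak_kernel_def cinner_diff_right)
  qed
  then show ?thesis using orthogonal_boxes_zero[of "K - K'"] by simp
qed

lemma int_kernel_eq: "weak_kernel T K \<Longrightarrow> int_kernel T = K"
  unfolding int_kernel_def weak_kernel_iff[symmetric] by (rule the_equality) (auto intro: weak_kernel_unique)

lemma weak_kernel_series:
  assumes S: "summable (\<lambda>k. tensor (u k) (v k))"
    and T: "\<And>f. (\<lambda>k. cscale (cinner (v k) f) (u k)) sums T f"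
  shows "weak_kernel T (\<Sum>k. tensor (u k) (v k))"
  unfolding weak_kernel_def
proof (intro allI)
  fix f g
  have "(\<lambda>k. cinner (v k) f * cinner g (u k)) sums cinner g (T f)"
    using bounded_linear.sums[OF bounded_linear_cinner_right T, of g] by (simp add: cinner_cscale_right)
  moreover have "(\<lambda>k. cinner (v k) f * cinner g (u k)) sums cinner (tensor g f) (\<Sum>k. tensor (u k) (v k))"
    using bounded_linear.sums[OF bounded_linear_cinner_right summable_sums[OF S], of "tensor g f"]
    by (simp add: cinner_tensor mult.commute)
  ultimately show "cinner g (T f) = cinner (tensor g f) (\<Sum>k. tensor (u k) (v k))" by (rule sums_unique2)
qed

lemma trace_class_has_kernel:
  assumes "trace_class T" shows "\<exists>K. weak_kernel T K"
proof -
  obtain f g where fg: "nuclear_rep T f g" using assms by (auto simp: trace_class_def)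
  have "summable (\<lambda>k. tensor (f k) (g k))"
    by (rule summable_norm_cancel) (use fg in \<open>simp add: norm_tensor nuclear_rep_def\<close>)
  then show ?thesis using weak_kernel_series[of f g T] fg by (auto simp: nuclear_rep_def)
qed

text \<open>The functions \<open>tensor (T (e k)) (e k)\<close> are pairwise orthogonal with square-summable norms, so
  their sum converges and is the kernel.\<close>

lemma hilbert_schmidt_has_kernel:
  fixes T :: "'a::euclidean_space op"
  assumes "hilbert_schmidt T" shows "\<exists>K. weak_kernel T K"
proof -
  obtain e where T: "bounded_op T" and e: "onb e" and s: "summable (\<lambda>k. (norm (T (e k)))\<^sup>2)"
    using assms by (auto simp: hilbert_schmidt_def)
  have "summable (\<lambda>k. tensor (T (e k)) (e k))"
    by (rule orthogonal_series_summable)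
      (use s in \<open>simp_all add: inner_L2_def cinner_tensor onb_orthonormal[OF e] norm_tensor onb_norm[OF e]\<close>)
  moreover have "(\<lambda>k. cscale (cinner (e k) f) (T (e k))) sums T f" for f
    using bounded_linear.sums[OF bounded_op_linear[OF T] onb_expansion[OF e, of f]]
    by (simp add: bounded_op_cscale[OF T])
  ultimately show ?thesis using weak_kernel_series[of "\<lambda>k. T (e k)" e T] by blast
qed

subsection \<open>Scaling of the interaction energies\<close>

text \<open>The factor \<open>s ^ 6\<close> is the Jacobian of the dilation of \<open>\<real>\<^sup>3 \<times> \<real>\<^sup>3\<close>, so what is left is the
  factor \<open>s\<close> from the Coulomb potential.\<close>

lemma coulomb_scaling:
  fixes F G :: "(real^3) \<times> (real^3) \<Rightarrow> real"
  assumes s: "0 < s" and F: "F \<in> borel_measurable borel" and G: "G \<in> borel_measurable borel"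
    and FG: "AE w in lborel. F w = s ^ 6 * G (s *\<^sub>R w)"
  shows "(\<integral>w. F w / norm (fst w - snd w) \<partial>lborel) = s * (\<integral>w. G w / norm (fst w - snd w) \<partial>lborel)"
proof -
  have m: "(\<lambda>w. H w / norm (fst w - snd w)) \<in> borel_measurable borel"
    if "H \<in> borel_measurable borel" for H :: "(real^3) \<times> (real^3) \<Rightarrow> real"
    by (intro borel_measurable_divide that borel_measurable_norm borel_measurable_diff
        measurable_pair_fun[where u = "\<lambda>x. x"]) auto
  let ?H = "\<lambda>w. G w / norm (fst w - snd w)"
  note m[OF G, measurable]
  have "(\<integral>w. F w / norm (fst w - snd w) \<partial>lborel) = (\<integral>w. s ^ 7 * ?H (s *\<^sub>R w) \<partial>lborel)"
  proof (rule integral_cong_AE)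
    show "AE w in lborel. F w / norm (fst w - snd w) = s ^ 7 * ?H (s *\<^sub>R w)"
      using FG
    proof eventually_elim
      case (elim w)
      have "norm (fst (s *\<^sub>R w) - snd (s *\<^sub>R w)) = s * norm (fst w - snd w)"
        using s by (simp flip: scaleR_diff_right)
      then show ?case using s elim by (simp add: power_numeral_reduce)
    qed
  qed (use m[OF F] in \<open>simp, measurable\<close>)
  also have "\<dots> = s ^ 7 * (integral\<^sup>L lborel ?H /\<^sub>R s ^ 6)"
    unfolding integral_mult_right_zero
    using s by (subst integral_lborel_scale[of s ?H, OF _ m[OF G]]) simp_all
  also have "s ^ 7 = s * s ^ 6" by (simp add: power_numeral_reduce)
  finally show ?thesis using s by simp
qed

lemma cinner_dil_right:
  fixes h k :: "'a::euclidean_space L2"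
  assumes s: "0 < s" shows "cinner h (dil s k) = cinner (dil (inverse s) h) k"
  using adjoint_pair_dil[of "inverse s", where 'a = 'a] s by (simp add: adjoint_pair_def)

lemma weak_kernel_dilop:
  assumes s: "0 < s" and K: "weak_kernel T K" shows "weak_kernel (dilop s T) (dil s K)"
  unfolding weak_kernel_def
proof (intro allI)
  fix f g
  have s': "0 < inverse s" using s by simp
  show "cinner g (dilop s T f) = cinner (tensor g f) (dil s K)"
    using K by (simp add: dilop_def cinner_dil_right[OF s] dil_tensor[OF s'] weak_kernel_def)
qed

lemma exchange_energy_dilop:
  assumes s: "0 < s" and K: "weak_kernel T K"
  shows "exchange_energy (dilop s T) = s * exchange_energy T"
proof -
  have sq: "(cmod (complex_of_real (s powr (real DIM((real^3) \<times> (real^3)) / 2)) * z))\<^sup>2 = s ^ 6 * (cmod z)\<^sup>2" for z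
    unfolding norm_mult power_mult_distrib
    using powr_half_dim_square[OF s, where 'a = "(real^3) \<times> (real^3)"] by simp
  have "(\<integral>w. (cmod (rep_L2 (dil s K) w))\<^sup>2 / norm (fst w - snd w) \<partial>lborel)
      = s * (\<integral>w. (cmod (rep_L2 K w))\<^sup>2 / norm (fst w - snd w) \<partial>lborel)"
  proof (rule coulomb_scaling[OF s])
    show "AE w in lborel. (cmod (rep_L2 (dil s K) w))\<^sup>2 = s ^ 6 * (cmod (rep_L2 K (s *\<^sub>R w)))\<^sup>2"
      using rep_dil[OF s, of K] by eventually_elim (simp only: sq)
  qed auto
  then show ?thesis
    by (simp add: exchange_energy_def int_kernel_eq[OF weak_kernel_dilop[OF s K]] int_kernel_eq[OF K] case_prod_unfold)
qed

lemma pair_density_dil: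
  fixes f g :: "nat \<Rightarrow> 'a::euclidean_space L2"
  assumes s: "0 < s" and fg: "summable (\<lambda>k. norm (f k) * norm (g k))"
  shows "AE x in lborel. pair_density (\<lambda>k. dil s (f k)) (\<lambda>k. dil s (g k)) x
    = of_real (s ^ DIM('a)) * pair_density f g (s *\<^sub>R x)"
proof -
  have "AE x in lborel. \<forall>k. rep_L2 (dil s (f k)) x * cnj (rep_L2 (dil s (g k)) x)
      = of_real (s ^ DIM('a)) * (pair_term f g k (s *\<^sub>R x))"
    unfolding AE_all_countable
  proof
    fix k
    show "AE x in lborel. rep_L2 (dil s (f k)) x * cnj (rep_L2 (dil s (g k)) x)
        = of_real (s ^ DIM('a)) * (pair_term f g k (s *\<^sub>R x))"
      using rep_dil[OF s, of "f k"] rep_dil[OF s, of "g k"]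
      by eventually_elim (simp add: powr_half_dim_square[OF s, where 'a='a, symmetric] power2_eq_square)
  qed
  then show ?thesis using AE_dil[OF s pair_density_sums[OF fg]]
  proof eventually_elim
    case (elim x)
    then show ?case
      using sums_mult[OF elim(2), of "of_real (s ^ DIM('a))"] unfolding pair_density_def[of "\<lambda>k. dil s (f k)"]
      by (simp add: sums_iff)
  qed
qed

lemma density_dilop:
  fixes T :: "'a::euclidean_space op" and e :: "nat \<Rightarrow> 'a L2"
  assumes s: "0 < s" and e: "onb e" and T: "trace_class T" "adjoint_pair T T"
  shows "AE x in lborel. density (dilop s T) x = s ^ DIM('a) * density T (s *\<^sub>R x)"
    and "density T \<in> borel_measurable borel" "density (dilop s T) \<in> borel_measurable borel"
proof -
  obtain f g where fg: "nuclear_rep T f g" using T by (auto simp: trace_class_def)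
  have sfg: "summable (\<lambda>k. norm (f k) * norm (g k))" using fg by (simp add: nuclear_rep_def)
  have s': "0 < inverse s" using s by simp
  have adj: "adjoint_pair (dilop s T) (dilop s T)"
    unfolding dilop_def[abs_def]
    using adjoint_pair_comp[OF adjoint_pair_dil[OF s] adjoint_pair_comp[OF T(2) adjoint_pair_dil[OF s']]] by simp
  note d = density_eq_pair_density[OF e fg T(2)]
  note d' = density_eq_pair_density[OF e nuclear_rep_dilop[OF s fg] adj]
  show "density T \<in> borel_measurable borel" "density (dilop s T) \<in> borel_measurable borel"
    by (rule d(1), rule d'(1))
  show "AE x in lborel. density (dilop s T) x = s ^ DIM('a) * density T (s *\<^sub>R x)"
    using d'(2) AE_dil[OF s d(2)] pair_density_dil[OF s sfg]
  proof eventually_elim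
    case (elim x)
    then have "complex_of_real (density (dilop s T) x) = complex_of_real (s ^ DIM('a) * density T (s *\<^sub>R x))"
      by simp
    then show ?case by (simp only: of_real_eq_iff)
  qed
qed

lemma direct_energy_dilop:
  fixes T :: op3
  assumes s: "0 < s" and e: "onb (e :: nat \<Rightarrow> (real^3) L2)" and T: "trace_class T" "adjoint_pair T T"
  shows "direct_energy (density (dilop s T)) = s * direct_energy (density T)"
proof -
  note d = density_dilop[OF s e T]
  have "(\<integral>w. density (dilop s T) (fst w) * density (dilop s T) (snd w) / norm (fst w - snd w) \<partial>lborel)
      = s * (\<integral>w. density T (fst w) * density T (snd w) / norm (fst w - snd w) \<partial>lborel)"
  proof (rule coulomb_scaling[OF s])
    show "AE w in lborel. density (dilop s T) (fst w) * density (dilop s T) (snd w)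
        = s ^ 6 * (density T (fst (s *\<^sub>R w)) * density T (snd (s *\<^sub>R w)))"
      using AE_lborel_fst[OF d(1), where 'b = "real^3"] AE_lborel_snd[OF d(1), where 'b = "real^3"]
      by eventually_elim (simp add: power_numeral_reduce)
  qed (intro borel_measurable_times measurable_pair_fun d)+
  then show ?thesis by (simp add: direct_energy_def case_prod_unfold)
qed

section \<open>Dilating admissible pairs\<close>

lemma inner_dil_right: "0 < s \<Longrightarrow> h \<bullet> dil s k = dil (inverse s) h \<bullet> k"
  by (simp add: inner_L2_def cinner_dil_right)

lemma conj_op_dilop: "0 < s \<Longrightarrow> conj_op (dilop s T) = dilop s (conj_op T)"
  by (simp add: conj_op_def dilop_def fun_eq_iff cnj_L2_dil)

lemma adjoint_pair_dilop:
  assumes s: "0 < s" and T: "adjoint_pair T S" shows "adjoint_pair (dilop s T) (dilop s S)"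
proof -
  have s': "0 < inverse s" using s by simp
  show ?thesis
    unfolding dilop_def[abs_def]
    using adjoint_pair_comp[OF adjoint_pair_dil[OF s] adjoint_pair_comp[OF T adjoint_pair_dil[OF s']]] by simp
qed

lemma bounded_op_conj_op: "bounded_op T \<Longrightarrow> bounded_op (conj_op T)"
proof -
  assume T: "bounded_op T"
  obtain K where K: "0 < K" "\<And>f. norm (T f) \<le> K * norm f" using bounded_op_bound[OF T] by blast
  show ?thesis
  proof (rule bounded_opI)
    show "norm (conj_op T f) \<le> K * norm f" for f
      using K(2)[of "cnj_L2 f"] by (simp add: conj_op_def)
  qed (simp_all add: conj_op_def cnj_L2_add cnj_L2_cscale bounded_op_add[OF T] bounded_op_cscale[OF T])
qed

lemma adjoint_dilop:
  fixes T :: "'a::euclidean_space op" and e :: "nat \<Rightarrow> 'a L2"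
  assumes s: "0 < s" and e: "onb e" and T: "bounded_op T"
  shows "adjoint (dilop s T) = dilop s (adjoint T)"
  by (rule adjoint_pair_adjoint[OF adjoint_pair_dilop[OF s adjoint_pair_adjoint_self[OF e T]]])

lemma transpose_op_dilop:
  fixes T :: "'a::euclidean_space op" and e :: "nat \<Rightarrow> 'a L2"
  assumes s: "0 < s" and e: "onb e" and T: "bounded_op T"
  shows "transpose_op (dilop s T) = dilop s (transpose_op T)"
  unfolding transpose_op_def conj_op_dilop[OF s] by (rule adjoint_dilop[OF s e bounded_op_conj_op[OF T]])

lemma hilbert_schmidt_comp:
  assumes A: "bounded_op A" and T: "hilbert_schmidt T" shows "hilbert_schmidt (\<lambda>f. A (T f))"
proof -
  obtain e where bT: "bounded_op T" and e: "onb e" "summable (\<lambda>k. (norm (T (e k)))\<^sup>2)"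
    using T by (auto simp: hilbert_schmidt_def)
  obtain K where K: "0 < K" "\<And>f. norm (A f) \<le> K * norm f" using bounded_op_bound[OF A] by blast
  have "summable (\<lambda>k. (norm (A (T (e k))))\<^sup>2)"
  proof (rule summable_comparison_test'[OF summable_mult[OF e(2), of "K\<^sup>2"], where N = 0])
    fix k
    have "(norm (A (T (e k))))\<^sup>2 \<le> (K * norm (T (e k)))\<^sup>2" by (intro power_mono K) simp
    then show "norm ((norm (A (T (e k))))\<^sup>2) \<le> K\<^sup>2 * (norm (T (e k)))\<^sup>2" by (simp add: power_mult_distrib)
  qed
  then show ?thesis using e(1) bounded_op_comp[OF A bT] by (auto simp: hilbert_schmidt_def)
qed

lemma hilbert_schmidt_dilop:
  assumes s: "0 < s" and T: "hilbert_schmidt T" shows "hilbert_schmidt (dilop s T)"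
proof -
  obtain e where bT: "bounded_op T" and e: "onb e" "summable (\<lambda>k. (norm (T (e k)))\<^sup>2)"
    using T by (auto simp: hilbert_schmidt_def)
  have "summable (\<lambda>k. (norm (dilop s T (dil s (e k))))\<^sup>2)" using e(2) s by (simp add: dilop_def)
  then show ?thesis using onb_dil[OF s e(1)] bounded_op_dilop[OF s bT] by (auto simp: hilbert_schmidt_def)
qed

lemma bessel_props: "bessel \<in> borel_measurable borel" "1 \<le> bessel p" "(bessel p)\<^sup>2 = sqrt (1 + (norm p)\<^sup>2)"
proof -
  show "bessel \<in> borel_measurable borel" unfolding bessel_def[abs_def] by measurable
  show "1 \<le> bessel p" unfolding bessel_def by (rule ge_one_powr_ge_zero) auto
  show "(bessel p)\<^sup>2 = sqrt (1 + (norm p)\<^sup>2)"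
    unfolding bessel_def power2_eq_square by (simp add: powr_half_sqrt flip: powr_add)
qed

lemma bessel_scale_bounded: "bdd_borel (\<lambda>p. bessel (s *\<^sub>R p) / bessel p)"
proof (rule bdd_borelI)
  fix p
  have "bessel (s *\<^sub>R p) \<le> ((1 + s\<^sup>2) * (1 + (norm p)\<^sup>2)) powr (1/4)"
    unfolding bessel_def by (intro powr_mono2) (auto simp: power_mult_distrib algebra_simps)
  also have "\<dots> = (1 + s\<^sup>2) powr (1/4) * bessel p" unfolding bessel_def by (simp add: powr_mult)
  finally show "\<bar>bessel (s *\<^sub>R p) / bessel p\<bar> \<le> (1 + s\<^sup>2) powr (1/4)"
    using bessel_props(2)[of p] bessel_props(2)[of "s *\<^sub>R p"] by (simp add: field_simps)
next
  note bessel_props(1) [measurable]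
  show "(\<lambda>p. bessel (s *\<^sub>R p) / bessel p) \<in> borel_measurable borel" by measurable
qed

text \<open>Dilating replaces the weight \<open>bessel p\<close> by \<open>bessel (s p)\<close>, which differs from it by a bounded
  factor, so the weighted operators stay trace class and Hilbert--Schmidt.\<close>

lemma X_space_dilop:
  assumes s: "0 < s" and X: "(\<gamma>, \<alpha>) \<in> X_space" shows "(dilop s \<gamma>, dilop s \<alpha>) \<in> X_space"
proof -
  from X have \<gamma>: "trace_class \<gamma>" "adjoint \<gamma> = \<gamma>" and \<alpha>: "hilbert_schmidt \<alpha>" "transpose_op \<alpha> = (\<lambda>f. - \<alpha> f)"
    by (auto simp: X_space_def)
  from X obtain T S where T: "sandwich bessel \<gamma> T" "trace_class T" and S: "left_mult bessel \<alpha> S" "hilbert_schmidt S"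
    by (auto simp: X_space_def)
  obtain e where e: "onb (e :: nat \<Rightarrow> (real^3) L2)" and b\<alpha>: "bounded_op \<alpha>"
    using \<alpha>(1) by (auto simp: hilbert_schmidt_def)
  have b\<gamma>: "bounded_op \<gamma>" using \<gamma>(1) by (simp add: trace_class_def)
  let ?c = "\<lambda>p. bessel (s *\<^sub>R p) / bessel p"
  have c: "bdd_borel ?c" by (rule bessel_scale_bounded)
  have nz: "bessel p \<noteq> 0" for p using bessel_props(2)[of p] by auto
  have cb: "bessel (s *\<^sub>R p) = ?c p * bessel p" for p by (simp add: nz)
  have "sandwich (\<lambda>p. bessel (s *\<^sub>R p)) \<gamma> (fconj ?c T)"
    by (rule sandwich_mult[OF T(1) c cb])
  then have 1: "\<exists>T. sandwich bessel (dilop s \<gamma>) T \<and> trace_class T"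
    using sandwich_dilop[OF s, of bessel] trace_class_dilop[OF s trace_class_fmul[OF T(2) c]] by blast
  have "left_mult bessel (dilop s \<alpha>) (dilop s (\<lambda>f. fmul ?c (S f)))"
    unfolding left_mult_def dilop_def multiplier_dil_iff[OF s]
  proof
    fix f
    have "multiplier bessel (\<alpha> (dil (inverse s) f)) (S (dil (inverse s) f))" using S by (simp add: left_mult_def)
    then show "multiplier (\<lambda>p. bessel (s *\<^sub>R p)) (\<alpha> (dil (inverse s) f)) (fmul ?c (S (dil (inverse s) f)))"
      unfolding multiplier_def using rep_fourier_fmul[OF c, of "S (dil (inverse s) f)"]
      by eventually_elim (simp add: nz)
  qed
  then have 2: "\<exists>T. left_mult bessel (dilop s \<alpha>) T \<and> hilbert_schmidt T"
    using hilbert_schmidt_dilop[OF s hilbert_schmidt_comp[OF bounded_op_fmul[OF c] S(2)]] by blast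
  have "dil s (- h) = - dil s h" for h :: "(real^3) L2"
    unfolding uminus_L2_def by (rule dil_cscale[OF s])
  then have 3: "transpose_op (dilop s \<alpha>) = (\<lambda>f. - dilop s \<alpha> f)"
    unfolding transpose_op_dilop[OF s e b\<alpha>] \<alpha>(2) by (simp add: dilop_def fun_eq_iff)
  show ?thesis
    unfolding X_space_def
    using trace_class_dilop[OF s \<gamma>(1)] hilbert_schmidt_dilop[OF s \<alpha>(1)] adjoint_dilop[OF s e b\<gamma>] \<gamma>(2) 1 2 3
    by simp
qed

text \<open>The generalised one-particle density matrix is conjugated by the dilation acting on both
  components, which commutes with complex conjugation.\<close>

lemma hfb_matrix_dilop:
  fixes \<phi> :: "(real^3) L2 \<times> (real^3) L2" and e :: "nat \<Rightarrow> (real^3) L2"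
  assumes s: "0 < s" and e: "onb e" and \<alpha>: "bounded_op \<alpha>"
  defines "\<psi> \<equiv> (dil (inverse s) (fst \<phi>), dil (inverse s) (snd \<phi>))"
  shows "\<phi> \<bullet> hfb_matrix (dilop s \<gamma>) (dilop s \<alpha>) \<phi> = \<psi> \<bullet> hfb_matrix \<gamma> \<alpha> \<psi>" "\<phi> \<bullet> \<phi> = \<psi> \<bullet> \<psi>"
proof -
  have s': "0 < inverse s" using s by simp
  obtain f g where \<phi>: "\<phi> = (f, g)" by (cases \<phi>)
  define f' g' where "f' = dil (inverse s) f" and "g' = dil (inverse s) g"
  have \<psi>: "\<psi> = (f', g')" by (simp add: \<psi>_def \<phi> f'_def g'_def)
  have f: "f \<bullet> dil s h = f' \<bullet> h" and g: "g \<bullet> dil s h = g' \<bullet> h" for h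
    unfolding f'_def g'_def by (rule inner_dil_right[OF s])+
  have ff: "f' \<bullet> f' = f \<bullet> f" and gg: "g' \<bullet> g' = g \<bullet> g"
    unfolding f'_def g'_def inner_L2_def cinner_dil[OF s'] by (rule refl)+
  have M: "hfb_matrix (dilop s \<gamma>) (dilop s \<alpha>) \<phi>
      = (dil s (\<gamma> f') + dil s (\<alpha> g'), dil s (adjoint \<alpha> f') + (g - dil s (conj_op \<gamma> g')))"
    unfolding hfb_matrix_def \<phi> adjoint_dilop[OF s e \<alpha>] conj_op_dilop[OF s] dilop_def f'_def g'_def by simp
  show "\<phi> \<bullet> hfb_matrix (dilop s \<gamma>) (dilop s \<alpha>) \<phi> = \<psi> \<bullet> hfb_matrix \<gamma> \<alpha> \<psi>"
    unfolding M unfolding \<phi> \<psi> by (simp add: hfb_matrix_def inner_add_right inner_diff_right f g gg)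
  show "\<phi> \<bullet> \<phi> = \<psi> \<bullet> \<psi>"
    by (simp add: \<phi> \<psi> ff gg)
qed

lemma K_set_dilop:
  assumes s: "0 < s" and K: "(\<gamma>, \<alpha>) \<in> K_set" shows "(dilop s \<gamma>, dilop s \<alpha>) \<in> K_set"
proof -
  from K have X: "(\<gamma>, \<alpha>) \<in> X_space"
    and M: "\<And>\<phi>. 0 \<le> \<phi> \<bullet> hfb_matrix \<gamma> \<alpha> \<phi> \<and> \<phi> \<bullet> hfb_matrix \<gamma> \<alpha> \<phi> \<le> \<phi> \<bullet> \<phi>"
    by (auto simp: K_set_def)
  obtain e where e: "onb (e :: nat \<Rightarrow> (real^3) L2)" and \<alpha>: "bounded_op \<alpha>"
    using X by (auto simp: X_space_def hilbert_schmidt_def)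
  have "0 \<le> \<phi> \<bullet> hfb_matrix (dilop s \<gamma>) (dilop s \<alpha>) \<phi> \<and>
      \<phi> \<bullet> hfb_matrix (dilop s \<gamma>) (dilop s \<alpha>) \<phi> \<le> \<phi> \<bullet> \<phi>" for \<phi>
    using M[of "(dil (inverse s) (fst \<phi>), dil (inverse s) (snd \<phi>))"]
    unfolding hfb_matrix_dilop(1)[OF s e \<alpha>, of \<phi> \<gamma>] hfb_matrix_dilop(2)[OF s e \<alpha>, of \<phi>, symmetric] .
  then show ?thesis
    unfolding K_set_def using X_space_dilop[OF s X] by blast
qed

section \<open>The energy\<close>

definition interaction :: "real \<Rightarrow> op3 \<Rightarrow> op3 \<Rightarrow> real" where
  "interaction \<kappa> \<gamma> \<alpha> = - \<kappa> / 2 * direct_energy (density \<gamma>)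
     + \<kappa> / 2 * exchange_energy \<gamma> - \<kappa> / 2 * exchange_energy \<alpha>"

lemma kinetic_symbol_props:
  fixes m x :: real
  assumes "0 \<le> m" "0 \<le> x"
  shows "0 \<le> sqrt (x\<^sup>2 + m\<^sup>2) - m" "sqrt (x\<^sup>2 + m\<^sup>2) - m \<le> x" "x \<le> sqrt (x\<^sup>2 + m\<^sup>2)"
proof -
  have "sqrt (m\<^sup>2) \<le> sqrt (x\<^sup>2 + m\<^sup>2)" by simp
  then show "0 \<le> sqrt (x\<^sup>2 + m\<^sup>2) - m" using assms by simp
  have "sqrt (x\<^sup>2 + m\<^sup>2) \<le> x + m" using assms by (intro real_le_lsqrt) (auto simp: power2_sum)
  then show "sqrt (x\<^sup>2 + m\<^sup>2) - m \<le> x" by simp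
  show "x \<le> sqrt (x\<^sup>2 + m\<^sup>2)" by (rule real_le_rsqrt) simp
qed

text \<open>All energies along the dilation orbit of an admissible pair are expressed by the momentum
  density \<open>\<sigma>\<close> of \<open>\<gamma>\<close>; the interaction is homogeneous of degree one, like \<open>\<bar>p\<bar>\<close>.\<close>

definition dilation_profile :: "real \<Rightarrow> real \<Rightarrow> op3 \<Rightarrow> op3 \<Rightarrow> (real^3 \<Rightarrow> real) \<Rightarrow> bool" where
  "dilation_profile \<kappa> l \<gamma> \<alpha> \<sigma> \<longleftrightarrow> \<sigma> \<in> borel_measurable borel \<and> (AE p in lborel. 0 \<le> \<sigma> p) \<and>
    integrable lborel \<sigma> \<and> integrable lborel (\<lambda>p. norm p * \<sigma> p) \<and> (\<integral>p. \<sigma> p \<partial>lborel) = l \<and>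
    (\<forall>s>0. (dilop s \<gamma>, dilop s \<alpha>) \<in> admissible l) \<and>
    (\<forall>s>0. \<forall>m\<ge>0. E_HFB m \<kappa> (dilop s \<gamma>) (dilop s \<alpha>)
      = (\<integral>p. (sqrt ((s * norm p)\<^sup>2 + m\<^sup>2) - m) * \<sigma> p \<partial>lborel) + s * interaction \<kappa> \<gamma> \<alpha>)"

lemma dilation_profileD:
  assumes "dilation_profile \<kappa> l \<gamma> \<alpha> \<sigma>"
  shows "\<sigma> \<in> borel_measurable borel" "AE p in lborel. 0 \<le> \<sigma> p"
    "integrable lborel \<sigma>" "integrable lborel (\<lambda>p. norm p * \<sigma> p)" "(\<integral>p. \<sigma> p \<partial>lborel) = l"
    "0 < s \<Longrightarrow> (dilop s \<gamma>, dilop s \<alpha>) \<in> admissible l"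
    "0 < s \<Longrightarrow> 0 \<le> m \<Longrightarrow> E_HFB m \<kappa> (dilop s \<gamma>) (dilop s \<alpha>)
      = (\<integral>p. (sqrt ((s * norm p)\<^sup>2 + m\<^sup>2) - m) * \<sigma> p \<partial>lborel) + s * interaction \<kappa> \<gamma> \<alpha>"
  using assms unfolding dilation_profile_def by simp_all

lemma dilation_profile_exists:
  assumes adm: "(\<gamma>, \<alpha>) \<in> admissible l"
  shows "\<exists>\<sigma>. dilation_profile \<kappa> l \<gamma> \<alpha> \<sigma>"
proof -
  from adm have K: "(\<gamma>, \<alpha>) \<in> K_set" and tr: "op_trace \<gamma> = complex_of_real l" by (auto simp: admissible_def)
  then have \<gamma>: "trace_class \<gamma>" "adjoint \<gamma> = \<gamma>" and \<alpha>: "hilbert_schmidt \<alpha>"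
    and M: "\<And>\<phi>. 0 \<le> \<phi> \<bullet> hfb_matrix \<gamma> \<alpha> \<phi>"
    by (auto simp: K_set_def X_space_def)
  from K obtain T where T: "sandwich bessel \<gamma> T" "trace_class T" by (auto simp: K_set_def X_space_def)
  obtain e where e: "onb (e :: nat \<Rightarrow> (real^3) L2)" and b\<alpha>: "bounded_op \<alpha>"
    using \<alpha> by (auto simp: hilbert_schmidt_def)
  have b\<gamma>: "bounded_op \<gamma>" using \<gamma>(1) by (simp add: trace_class_def)
  have sa: "adjoint_pair \<gamma> \<gamma>" using adjoint_pair_adjoint_self[OF e b\<gamma>] by (simp add: \<gamma>(2))
  have pos: "0 \<le> f \<bullet> \<gamma> f" for f
  proof -
    have "\<alpha> 0 = 0" using bounded_op_linear[OF b\<alpha>] by (simp add: linear_simps)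
    then show ?thesis using M[of "(f, 0)"] by (simp add: hfb_matrix_def)
  qed
  obtain \<sigma> where \<sigma>: "\<sigma> \<in> borel_measurable borel" "AE p in lborel. 0 \<le> \<sigma> p"
    "integrable lborel (\<lambda>p. (bessel p)\<^sup>2 * \<sigma> p)" "Re (op_trace \<gamma>) = (\<integral>p. \<sigma> p \<partial>lborel)"
    and kin: "\<And>a K. a \<in> borel_measurable borel \<Longrightarrow> (\<And>p. 0 \<le> a p) \<Longrightarrow> (\<And>p. a p \<le> K * (bessel p)\<^sup>2) \<Longrightarrow>
      \<exists>S. sandwich (\<lambda>p. sqrt (a p)) \<gamma> S \<and> trace_class S \<and> trace_mult a \<gamma> = (\<integral>p. a p * \<sigma> p \<partial>lborel)"
    using momentum_density[OF e T bessel_props(1,2) pos] by blast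
  have norm_le: "norm p \<le> (bessel p)\<^sup>2" "1 \<le> (bessel p)\<^sup>2" for p
    unfolding bessel_props(3) by (auto intro!: real_le_rsqrt)
  note \<sigma>(1) [measurable]
  have dom: "integrable lborel (\<lambda>p. a p * \<sigma> p)"
    if "a \<in> borel_measurable borel" "\<And>p. \<bar>a p\<bar> \<le> (bessel p)\<^sup>2" for a
  proof (rule Bochner_Integration.integrable_bound[OF \<sigma>(3)])
    show "(\<lambda>p. a p * \<sigma> p) \<in> borel_measurable lborel" using that(1) by measurable
    show "AE p in lborel. norm (a p * \<sigma> p) \<le> norm ((bessel p)\<^sup>2 * \<sigma> p)"
      using that(2) by (auto simp: abs_mult intro!: AE_I2 mult_right_mono)
  qed
  show ?thesis
    unfolding dilation_profile_def
  proof (intro exI[of _ \<sigma>] conjI \<sigma>(1,2))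
    show "integrable lborel \<sigma>" using dom[of "\<lambda>_. 1"] norm_le(2) by simp
    show "integrable lborel (\<lambda>p. norm p * \<sigma> p)" using dom[of norm] norm_le(1) by simp
    show "(\<integral>p. \<sigma> p \<partial>lborel) = l" using \<sigma>(4) tr by simp
    show "\<forall>s>0. (dilop s \<gamma>, dilop s \<alpha>) \<in> admissible l"
    proof (intro allI impI)
      fix s :: real assume s: "0 < s"
      show "(dilop s \<gamma>, dilop s \<alpha>) \<in> admissible l"
      using K_set_dilop[OF s K] tr by (simp add: admissible_def op_trace_dilop[OF s e \<gamma>(1)])
    qed
    show "\<forall>s>0. \<forall>m\<ge>0. E_HFB m \<kappa> (dilop s \<gamma>) (dilop s \<alpha>)
      = (\<integral>p. (sqrt ((s * norm p)\<^sup>2 + m\<^sup>2) - m) * \<sigma> p \<partial>lborel) + s * interaction \<kappa> \<gamma> \<alpha>"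
    proof (intro allI impI)
      fix s m :: real assume s: "0 < s" and m: "0 \<le> m"
      let ?a = "\<lambda>p::real^3. sqrt ((norm p)\<^sup>2 + m\<^sup>2) - m"
      have as: "?a (s *\<^sub>R p) = sqrt ((s * norm p)\<^sup>2 + m\<^sup>2) - m" for p using s by simp
      have "\<exists>S. sandwich (\<lambda>p. sqrt (?a (s *\<^sub>R p))) \<gamma> S \<and> trace_class S
          \<and> trace_mult (\<lambda>p. ?a (s *\<^sub>R p)) \<gamma> = (\<integral>p. ?a (s *\<^sub>R p) * \<sigma> p \<partial>lborel)"
      proof (rule kin)
        show "(\<lambda>p. ?a (s *\<^sub>R p)) \<in> borel_measurable borel" by measurable
        show "0 \<le> ?a (s *\<^sub>R p)" for p using kinetic_symbol_props(1)[OF m, of "norm (s *\<^sub>R p)"] by simp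
        show "?a (s *\<^sub>R p) \<le> s * (bessel p)\<^sup>2" for p
        proof -
          have "?a (s *\<^sub>R p) \<le> s * norm p" using kinetic_symbol_props(2)[OF m, of "norm (s *\<^sub>R p)"] s by simp
          also have "\<dots> \<le> s * (bessel p)\<^sup>2" using norm_le(1) s by (intro mult_left_mono) auto
          finally show ?thesis .
        qed
      qed
      then obtain S where S: "sandwich (\<lambda>p. sqrt (?a (s *\<^sub>R p))) \<gamma> S" "trace_class S"
        "trace_mult (\<lambda>p. ?a (s *\<^sub>R p)) \<gamma> = (\<integral>p. ?a (s *\<^sub>R p) * \<sigma> p \<partial>lborel)" by blast
      have tm: "trace_mult ?a (dilop s \<gamma>) = (\<integral>p. (sqrt ((s * norm p)\<^sup>2 + m\<^sup>2) - m) * \<sigma> p \<partial>lborel)"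
        unfolding as[symmetric] S(3)[symmetric]
        by (rule trace_mult_dilop[OF s e _ S(1,2)]) measurable
      obtain K1 K2 where k: "weak_kernel \<gamma> K1" "weak_kernel \<alpha> K2"
        using trace_class_has_kernel[OF \<gamma>(1)] hilbert_schmidt_has_kernel[OF \<alpha>] by blast
      show "E_HFB m \<kappa> (dilop s \<gamma>) (dilop s \<alpha>)
        = (\<integral>p. (sqrt ((s * norm p)\<^sup>2 + m\<^sup>2) - m) * \<sigma> p \<partial>lborel) + s * interaction \<kappa> \<gamma> \<alpha>"
        unfolding E_HFB_def tm direct_energy_dilop[OF s e \<gamma>(1) sa] exchange_energy_dilop[OF s k(1)]
          exchange_energy_dilop[OF s k(2)] interaction_def
        by (simp add: algebra_simps)
    qed
  qed
qed

lemma dilop_one: "dilop 1 T = T"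
  by (simp add: dilop_def dil_one fun_eq_iff)

lemma minimizer_le:
  "minimizer m \<kappa> l \<gamma> \<alpha> \<Longrightarrow> (\<gamma>', \<alpha>') \<in> admissible l \<Longrightarrow> E_HFB m \<kappa> \<gamma> \<alpha> \<le> E_HFB m \<kappa> \<gamma>' \<alpha>'"
  unfolding minimizer_def I_HFB_def
  by (metis (mono_tags, lifting) INF_lower case_prod_conv ereal_less_eq(3))

text \<open>Dilating a massless minimizer multiplies its energy by an arbitrary positive factor, so the
  energy is zero.\<close>

lemma massless_minimizer_energy:
  assumes "minimizer 0 \<kappa> l \<gamma> \<alpha>" shows "E_HFB 0 \<kappa> \<gamma> \<alpha> = 0"
proof -
  have adm: "(\<gamma>, \<alpha>) \<in> admissible l" using assms by (simp add: minimizer_def)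
  obtain \<sigma> where prof: "dilation_profile \<kappa> l \<gamma> \<alpha> \<sigma>"
    using dilation_profile_exists[OF adm] by blast
  note \<sigma> = dilation_profileD(1-5)[OF prof] and ad = dilation_profileD(6)[OF prof] and E = dilation_profileD(7)[OF prof]
  have Es: "E_HFB 0 \<kappa> (dilop s \<gamma>) (dilop s \<alpha>) = s * ((\<integral>p. norm p * \<sigma> p \<partial>lborel) + interaction \<kappa> \<gamma> \<alpha>)" if "0 < s" for s
  proof -
    have k: "(sqrt ((s * norm p)\<^sup>2 + 0\<^sup>2) - 0) * \<sigma> p = s * (norm p * \<sigma> p)" for p
      using that by (simp add: mult.assoc)
    show ?thesis
      unfolding E[OF that order_refl] k integral_mult_right_zero by (simp add: distrib_left)
  qed
  have "E_HFB 0 \<kappa> \<gamma> \<alpha> \<le> s * E_HFB 0 \<kappa> \<gamma> \<alpha>" if "0 < s" for s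
    using minimizer_le[OF assms ad[OF that]] Es[OF that] Es[of 1] by (simp add: dilop_one)
  \<comment> \<open>\<open>E \<le> 2 E\<close> and \<open>E \<le> E / 2\<close>.\<close>
  from this[of 2] this[of "1/2"] show ?thesis by simp
qed

lemma sqrt_minus_tendsto:
  fixes x m :: real
  assumes x: "0 < x" shows "(\<lambda>n. sqrt ((real (Suc n) * x)\<^sup>2 + m\<^sup>2) - real (Suc n) * x) \<longlonglongrightarrow> 0"
proof (rule tendsto_sandwich[OF _ _ tendsto_const])
  show "\<forall>\<^sub>F n in sequentially. 0 \<le> sqrt ((real (Suc n) * x)\<^sup>2 + m\<^sup>2) - real (Suc n) * x"
    using x by (intro always_eventually allI) (simp add: real_le_rsqrt)
  show "\<forall>\<^sub>F n in sequentially. sqrt ((real (Suc n) * x)\<^sup>2 + m\<^sup>2) - real (Suc n) * x \<le> m\<^sup>2 / x * (1 / real (Suc n))"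
  proof (intro always_eventually allI)
    fix n
    let ?y = "real (Suc n) * x"
    have y: "0 < ?y" using x by simp
    have "?y\<^sup>2 + m\<^sup>2 \<le> (?y + m\<^sup>2 / ?y)\<^sup>2"
      using y x unfolding power2_sum by simp
    then have "sqrt (?y\<^sup>2 + m\<^sup>2) \<le> ?y + m\<^sup>2 / ?y" using y by (intro real_le_lsqrt) auto
    then show "sqrt (?y\<^sup>2 + m\<^sup>2) - ?y \<le> m\<^sup>2 / x * (1 / real (Suc n))" by (simp add: mult.commute)
  qed
  show "(\<lambda>n. m\<^sup>2 / x * (1 / real (Suc n))) \<longlonglongrightarrow> 0"
    using tendsto_mult_left[OF LIMSEQ_Suc[OF lim_1_over_n], of "m\<^sup>2 / x"] by simp
qed

text \<open>A dilation concentrating the massless minimizer at a point makes the massive energy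
  approach \<open>-m l\<close>.\<close>

lemma massive_energy_le:
  assumes min0: "minimizer 0 \<kappa> l \<gamma> \<alpha>" and m: "0 < m" and min: "minimizer m \<kappa> l \<gamma>' \<alpha>'"
  shows "E_HFB m \<kappa> \<gamma>' \<alpha>' \<le> - m * l"
proof -
  have adm: "(\<gamma>, \<alpha>) \<in> admissible l" using min0 by (simp add: minimizer_def)
  obtain \<sigma> where prof: "dilation_profile \<kappa> l \<gamma> \<alpha> \<sigma>"
    using dilation_profile_exists[OF adm] by blast
  note \<sigma> = dilation_profileD(1-5)[OF prof] and ad = dilation_profileD(6)[OF prof] and E = dilation_profileD(7)[OF prof]
  note \<sigma>(1) [measurable]
  have V: "interaction \<kappa> \<gamma> \<alpha> = - (\<integral>p. norm p * \<sigma> p \<partial>lborel)"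
    using E[of 1 0] massless_minimizer_energy[OF min0] by (simp add: dilop_one)
  \<comment> \<open>Since the massless energy vanishes, the interaction cancels \<open>s \<bar>p\<bar>\<close> in the massive energy; here
    \<open>s = n + 1\<close>.\<close>
  let ?d = "\<lambda>n p. sqrt ((real (Suc n) * norm p)\<^sup>2 + m\<^sup>2) - m - real (Suc n) * norm (p::real^3)"
  have bd: "\<bar>?d n p\<bar> \<le> m" for n p
    using kinetic_symbol_props[of m "real (Suc n) * norm p"] m by (simp add: abs_le_iff)
  have dint: "integrable lborel (\<lambda>p. ?d n p * \<sigma> p)" for n
    by (rule Bochner_Integration.integrable_bound[OF integrable_mult_right[OF \<sigma>(3), of m]])
      (use bd[of n] m in \<open>auto simp: abs_mult intro!: AE_I2 mult_right_mono\<close>)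
  have En: "E_HFB m \<kappa> (dilop (real (Suc n)) \<gamma>) (dilop (real (Suc n)) \<alpha>) = (\<integral>p. ?d n p * \<sigma> p \<partial>lborel)" for n
  proof -
    have "(\<integral>p. ?d n p * \<sigma> p \<partial>lborel) + (\<integral>p. real (Suc n) * (norm p * \<sigma> p) \<partial>lborel)
        = (\<integral>p. ?d n p * \<sigma> p + real (Suc n) * (norm p * \<sigma> p) \<partial>lborel)"
      by (rule Bochner_Integration.integral_add[symmetric, OF dint integrable_mult_right[OF \<sigma>(4)]])
    also have "(\<lambda>p. ?d n p * \<sigma> p + real (Suc n) * (norm p * \<sigma> p))
        = (\<lambda>p. (sqrt ((real (Suc n) * norm p)\<^sup>2 + m\<^sup>2) - m) * \<sigma> p)"
      by (rule ext) (simp only: left_diff_distrib mult.assoc diff_add_cancel)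
    finally have "(\<integral>p. (sqrt ((real (Suc n) * norm p)\<^sup>2 + m\<^sup>2) - m) * \<sigma> p \<partial>lborel)
        = (\<integral>p. ?d n p * \<sigma> p \<partial>lborel) + real (Suc n) * (\<integral>p. norm p * \<sigma> p \<partial>lborel)" by simp
    then show ?thesis using E[of "real (Suc n)" m] m V by simp
  qed
  have "(\<lambda>n. \<integral>p. ?d n p * \<sigma> p \<partial>lborel) \<longlonglongrightarrow> (\<integral>p. - m * \<sigma> p \<partial>lborel)"
  proof (rule integral_dominated_convergence[OF _ _ integrable_mult_right[OF integrable_norm[OF \<sigma>(3)], of m]])
    show "AE p in lborel. (\<lambda>n. ?d n p * \<sigma> p) \<longlonglongrightarrow> - m * \<sigma> p"
      using AE_lborel_singleton[of "0 :: real^3"]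
    proof eventually_elim
      case (elim p)
      have "(\<lambda>n. (sqrt ((real (Suc n) * norm p)\<^sup>2 + m\<^sup>2) - real (Suc n) * norm p) - m) \<longlonglongrightarrow> 0 - m"
        by (intro tendsto_diff tendsto_const sqrt_minus_tendsto) (use elim in simp)
      then have "(\<lambda>n. ?d n p) \<longlonglongrightarrow> - m" by (simp add: algebra_simps)
      then show ?case by (rule tendsto_mult_right)
    qed
    show "AE p in lborel. norm (?d n p * \<sigma> p) \<le> m * norm (\<sigma> p)" for n
      using bd[of n] by (auto simp: abs_mult intro!: AE_I2 mult_right_mono)
  qed measurable
  then have "(\<lambda>n. \<integral>p. ?d n p * \<sigma> p \<partial>lborel) \<longlonglongrightarrow> - m * l" by (simp add: \<sigma>(5))
  moreover have "E_HFB m \<kappa> \<gamma>' \<alpha>' \<le> (\<integral>p. ?d n p * \<sigma> p \<partial>lborel)" for n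
    unfolding En[symmetric] by (rule minimizer_le[OF min ad]) simp
  ultimately show ?thesis by (intro LIMSEQ_le_const) auto
qed

text \<open>Conversely \<open>sqrt (p\<^sup>2 + m\<^sup>2) - m > \<bar>p\<bar> - m\<close> keeps the massive energy strictly above \<open>-m l\<close>
  wherever the massless energy is nonnegative.\<close>

lemma massive_energy_gt:
  assumes adm: "(\<gamma>, \<alpha>) \<in> admissible l" and l: "0 < l" and m: "0 < m" and E0: "0 \<le> E_HFB 0 \<kappa> \<gamma> \<alpha>"
  shows "- m * l < E_HFB m \<kappa> \<gamma> \<alpha>"
proof -
  obtain \<sigma> where prof: "dilation_profile \<kappa> l \<gamma> \<alpha> \<sigma>"
    using dilation_profile_exists[OF adm] by blast
  note \<sigma> = dilation_profileD(1-5)[OF prof] and ad = dilation_profileD(6)[OF prof] and E = dilation_profileD(7)[OF prof]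
  note \<sigma>(1) [measurable]
  let ?d = "\<lambda>p. sqrt ((norm p)\<^sup>2 + m\<^sup>2) - norm (p::real^3)"
  have d0: "0 < ?d p" for p using m by (simp add: real_less_rsqrt)
  have dm: "?d p \<le> m" for p using kinetic_symbol_props(2)[of m "norm p"] m by simp
  have dint: "integrable lborel (\<lambda>p. ?d p * \<sigma> p)"
    by (rule Bochner_Integration.integrable_bound[OF integrable_mult_right[OF \<sigma>(3), of m]])
      (use d0 dm m in \<open>auto simp: abs_mult abs_of_pos intro!: AE_I2 mult_right_mono\<close>)
  have eq: "E_HFB m \<kappa> \<gamma> \<alpha> = (\<integral>p. ?d p * \<sigma> p \<partial>lborel) - m * l + E_HFB 0 \<kappa> \<gamma> \<alpha>"
  proof -
    have "(\<integral>p. (sqrt ((norm p)\<^sup>2 + m\<^sup>2) - m) * \<sigma> p \<partial>lborel)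
        = (\<integral>p. ?d p * \<sigma> p - m * \<sigma> p + norm p * \<sigma> p \<partial>lborel)"
      by (intro Bochner_Integration.integral_cong refl) (simp add: algebra_simps)
    also have "\<dots> = (\<integral>p. ?d p * \<sigma> p \<partial>lborel) - m * l + (\<integral>p. norm p * \<sigma> p \<partial>lborel)"
      using dint \<sigma>(3,4,5) by simp
    finally show ?thesis using E[of 1 m] E[of 1 0] m by (simp add: dilop_one)
  qed
  have nn: "AE p in lborel. 0 \<le> ?d p * \<sigma> p"
    using \<sigma>(2) by eventually_elim (use d0 in \<open>simp add: less_imp_le\<close>)
  have "(\<integral>p. ?d p * \<sigma> p \<partial>lborel) \<noteq> 0"
  proof
    assume "(\<integral>p. ?d p * \<sigma> p \<partial>lborel) = 0"
    then have "AE p in lborel. ?d p * \<sigma> p = 0" by (simp only: integral_nonneg_eq_0_iff_AE[OF dint nn])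
    then have "AE p in lborel. \<sigma> p = 0" by eventually_elim (metis d0 mult_eq_0_iff less_irrefl)
    then have "(\<integral>p. \<sigma> p \<partial>lborel) = 0" by (rule integral_eq_zero_AE)
    then show False using \<sigma>(5) l by simp
  qed
  then have "0 < (\<integral>p. ?d p * \<sigma> p \<partial>lborel)" using integral_nonneg_AE[OF nn] by linarith
  then show ?thesis using eq E0 by simp
qed

theorem lemma1p2:
  fixes \<kappa> l :: real
  assumes "0 < \<kappa>" and "\<kappa> < 4 / pi"
    and "0 < l" and "l \<le> critical_mass \<kappa>"
    and "\<exists>\<gamma> \<alpha>. minimizer 0 \<kappa> l \<gamma> \<alpha>"
  shows "\<forall>m>0. \<not> (\<exists>\<gamma> \<alpha>. minimizer m \<kappa> l \<gamma> \<alpha>)"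
proof (intro allI impI notI)
  fix m :: real assume m: "0 < m" and "\<exists>\<gamma> \<alpha>. minimizer m \<kappa> l \<gamma> \<alpha>"
  then obtain \<gamma> \<alpha> where min: "minimizer m \<kappa> l \<gamma> \<alpha>" by blast
  obtain \<gamma>0 \<alpha>0 where min0: "minimizer 0 \<kappa> l \<gamma>0 \<alpha>0" using assms(5) by blast
  have adm: "(\<gamma>, \<alpha>) \<in> admissible l" using min by (simp add: minimizer_def)
  have "0 \<le> E_HFB 0 \<kappa> \<gamma> \<alpha>"
    using minimizer_le[OF min0 adm] massless_minimizer_energy[OF min0] by simp
  then show False
    using massive_energy_gt[OF adm assms(3) m, of \<kappa>] massive_energy_le[OF min0 m min] by simp
qed

end
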